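(* Let $a,b$ be positive integers and let $n$ be large enough. Consider the $(a:b)$ perfect matching Maker-PhantomBreaker game on $E(K_n)$. (a) If $b>2a$, then Maker has a randomized strategy to win against PhantomBreaker with probability at least a positive constant depending on $a$ and $b$; that is, there exist a constant $c=c(a,b)>0$ and an integer $n_0$ such that for all $n\ge n_0$ Maker has a randomized strategy which, against every strategy of PhantomBreaker, wins with probability at least $c$. (b) If $b\le 2a$, then Maker has a randomized strategy that wins against PhantomBreaker asymptotically almost surely; that is, for every large enough $n$ there is a randomized strategy for Maker and a number $p_n$, with $p_n\to 1$ as $n\to\infty$, such that, against every strategy of PhantomBreaker, this strategy wins with probability at least $p_n$.
   Context: Maker-PhantomBreaker game. The board is the edge set $E(K_n)$ of the complete graph on $n$ vertices, and there is a family of winning sets (edge sets of certain subgraphs of $K_n$). Initially all edges are unclaimed. Two players, Maker and PhantomBreaker, alternate turns, Maker going first. In an $(a:b)$ game, in each round Maker first makes $a$ moves, one after another, each consisting of attempting to claim one edge of $K_n$; then PhantomBreaker claims $b$ unclaimed edges (all remaining unclaimed edges if fewer than $b$ remain). If the edge Maker attempts to claim is unclaimed, it becomes hers. If it has already been claimed by PhantomBreaker, then that move of Maker is lost (she gets no replacement move) and she learns that this edge belongs to PhantomBreaker. Information: PhantomBreaker has complete information about the game so far (he sees all previous moves of Maker, including failed attempts, but not the outcomes of Maker's future random choices). Maker sees none of PhantomBreaker's moves; her only information about them is the success or failure of her own previous attempts. Maker wins if at some point she has claimed all edges of some winning set; otherwise PhantomBreaker wins. Both players may use randomized strategies, where each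 decision of PhantomBreaker may depend only on all previous moves of both players (including Maker's failed attempts) and his own randomness, and each decision of Maker may depend only on her own previous attempts, their success or failure, and her own randomness. Perfect matching game: the winning sets are all perfect matchings of $K_n$.
   Formalization: The number n of vertices is required to be even: for odd n the graph K_n has no perfect matching, so there are no winning sets, Maker wins with probability 0, and the claim for all large n fails. *)

theory Defs
  imports "HOL-Probability.Probability" "HOL-Library.Ramsey"
begin

type_synonym edge = "nat set"

definition board :: "nat \<Rightarrow> edge set" where
  "board n = nsets {..<n} 2"

definition perfect_matching :: "nat \<Rightarrow> edge set \<Rightarrow> bool" where
  "perfect_matching n P \<longleftrightarrow> P \<subseteq> board n \<and> (\<forall>v<n. \<exists>!e. e \<in> P \<and> v \<in> e)"

(* A history is the list of all moves so far, most recent first. Attempt e is a single move of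
   Maker, successful or not; Claim F is a complete turn of PhantomBreaker. *)

datatype move = Attempt edge | Claim "edge set"

fun breaker_edges :: "move list \<Rightarrow> edge set" where
  "breaker_edges [] = {}"
| "breaker_edges (Attempt e # h) = breaker_edges h"
| "breaker_edges (Claim F # h) = F \<union> breaker_edges h"

(* Attempting an edge that is already Maker's changes nothing. *)

fun maker_edges :: "move list \<Rightarrow> edge set" where
  "maker_edges [] = {}"
| "maker_edges (Attempt e # h) =
     (if e \<in> breaker_edges h then maker_edges h else insert e (maker_edges h))"
| "maker_edges (Claim F # h) = maker_edges h"

definition unclaimed :: "nat \<Rightarrow> move list \<Rightarrow> edge set" where
  "unclaimed n h = board n - maker_edges h - breaker_edges h"

(* What Maker knows: her own attempts, most recent first, flagged True for success and False
   if the edge belonged to PhantomBreaker when it was attempted. *)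

fun maker_view :: "move list \<Rightarrow> (edge \<times> bool) list" where
  "maker_view [] = []"
| "maker_view (Attempt e # h) = (e, e \<notin> breaker_edges h) # maker_view h"
| "maker_view (Claim F # h) = maker_view h"

type_synonym maker_strategy = "(edge \<times> bool) list \<Rightarrow> edge"
type_synonym breaker_strategy = "move list \<Rightarrow> edge set"

definition legal_maker :: "nat \<Rightarrow> maker_strategy set" where
  "legal_maker n = {\<sigma>. \<forall>v. \<sigma> v \<in> board n}"

definition legal_breaker :: "nat \<Rightarrow> nat \<Rightarrow> breaker_strategy set" where
  "legal_breaker b n =
     {\<tau>. \<forall>h. \<tau> h \<subseteq> unclaimed n h \<and> card (\<tau> h) = min b (card (unclaimed n h))}"

definition maker_move :: "maker_strategy \<Rightarrow> move list \<Rightarrow> move list" where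
  "maker_move \<sigma> h = Attempt (\<sigma> (maker_view h)) # h"

definition breaker_turn :: "breaker_strategy \<Rightarrow> move list \<Rightarrow> move list" where
  "breaker_turn \<tau> h = Claim (\<tau> h) # h"

definition play_round :: "nat \<Rightarrow> maker_strategy \<Rightarrow> breaker_strategy \<Rightarrow> move list \<Rightarrow> move list" where
  "play_round a \<sigma> \<tau> h = breaker_turn \<tau> ((maker_move \<sigma> ^^ a) h)"

definition history_after :: "nat \<Rightarrow> maker_strategy \<Rightarrow> breaker_strategy \<Rightarrow> nat \<Rightarrow> move list" where
  "history_after a \<sigma> \<tau> t = (play_round a \<sigma> \<tau> ^^ t) []"

(* Maker never loses an edge, so it is enough to inspect her edges at the ends of rounds. *)

definition maker_wins :: "nat \<Rightarrow> nat \<Rightarrow> maker_strategy \<Rightarrow> breaker_strategy \<Rightarrow> bool" where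
  "maker_wins a n \<sigma> \<tau> \<longleftrightarrow>
     (\<exists>t P. perfect_matching n P \<and> P \<subseteq> maker_edges (history_after a \<sigma> \<tau> t))"

(* A randomized strategy is a distribution on deterministic ones: each player draws all of his or
   her private randomness before the game, independently of the opponent, and every decision is
   then a function of this randomness and of the information available to the player. After at
   most card (board n) rounds with b > 0 nothing is left to claim, so only finitely many histories
   matter and discrete distributions lose no generality. *)

definition randomized_maker :: "nat \<Rightarrow> maker_strategy pmf set" where
  "randomized_maker n = {M. set_pmf M \<subseteq> legal_maker n}"

definition randomized_breaker :: "nat \<Rightarrow> nat \<Rightarrow> breaker_strategy pmf set" where
  "randomized_breaker b n = {B. set_pmf B \<subseteq> legal_breaker b n}"

definition maker_win_prob :: "nat \<Rightarrow> nat \<Rightarrow> maker_strategy pmf \<Rightarrow> breaker_strategy pmf \<Rightarrow> real" where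
  "maker_win_prob a n M B =
     measure_pmf.prob (pair_pmf M B) {(\<sigma>, \<tau>). maker_wins a n \<sigma> \<tau>}"

end

theory Submission
  imports Defs
begin

text \<open>
  Maker repeatedly attempts a uniformly random edge between two vertices that are still unmatched,
  until only \<open>\<gamma> n\<close> unmatched vertices are left, for a small constant \<open>\<gamma>\<close>. If none of
  them has PhantomBreaker degree above \<open>n / 4\<close>, she can match the rest almost surely: to match
  \<open>u\<close> and \<open>v\<close> she makes a large constant number of attempts to join \<open>u\<close>, and then \<open>v\<close>, to random
  matched vertices, and closes one of the quadratically many paths of length 5 through two matching
  edges, most of which PhantomBreaker had no time to destroy. Failed repairs are repeated.

  For arbitrary \<open>b\<close>, with probability bounded from below no attempt of the first stage fails and no
  unmatched vertex ever gets a large PhantomBreaker degree. This is shown with a potential that is a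
  product over the unmatched vertices of a weight that decreases from 1 to 0 while the degree of the
  vertex grows to \<open>\<gamma> n / 8\<close>.

  For \<open>b \<le> 2 a\<close>, Maker repairs each failure of the first stage at once. Failures have non-negligible
  probability only when PhantomBreaker owns linearly many edges between unmatched vertices, and then,
  as he owns at most about as many edges as there are matched vertices, he cannot block the repair.
  The average degree of the unmatched vertices is a supermartingale apart from PhantomBreaker's new
  edges, and the few vertices left at the end therefore have sublinear total degree, up to a factor
  that vanishes with \<open>\<gamma>\<close>.
\<close>

section \<open>Randomized strategies against a hidden opponent\<close>

text \<open>Maker cannot see PhantomBreaker's edges, so her strategy is fixed without knowing his
  set \<open>B\<close>, and its guarantee has to be stated for every \<open>B\<close> at once. Hence
  guarantees are functions \<open>\<phi>\<close> of \<open>B\<close>, and every probabilistic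
  argument becomes a one-step inequality: the average over Maker's random edge, with a worst-case
  reply to each edge, must not fall below \<open>\<phi> B\<close>. No stochastic process is built;
  supermartingales survive as the formulas for \<open>\<phi>\<close>.

  The threshold \<open>b = 2 a\<close> compares two speeds: a successful attempt matches 2 vertices,
  while PhantomBreaker gains \<open>b / a\<close> edges per attempt. If \<open>b \<le> 2 a\<close>,
  he cannot both own many edges between unmatched vertices, which make attempts fail, and cut an
  unmatched vertex off from the matched ones. For larger \<open>b\<close> this count gives nothing,
  so a failure of the first stage is written off. In the endgame every repair gives him a constant
  number of edges, possibly all at one vertex; this forces \<open>\<gamma>\<close> to be
  small.\<close>

text \<open>\<open>t div a\<close> is the number of complete turns PhantomBreaker has had after
  \<open>t\<close> attempts. Of the whole history only these facts about his edges survive.\<close>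

definition admissible :: "nat \<Rightarrow> nat \<Rightarrow> nat \<Rightarrow> nat \<Rightarrow> edge set \<Rightarrow> edge set \<Rightarrow> bool" where
  "admissible a b n t E B \<longleftrightarrow> B \<subseteq> board n \<and> B \<inter> E = {} \<and> card B \<le> b * (t div a)"

text \<open>This grants PhantomBreaker more than the rules do: he may also claim edges in the middle
  of a round, provided that the total still fits \<open>admissible\<close>. An edge \<open>e\<close>
  that was not his is Maker's before he replies, so \<open>B'\<close> has to avoid it.\<close>

definition reply :: "nat \<Rightarrow> nat \<Rightarrow> nat \<Rightarrow> nat \<Rightarrow> edge set \<Rightarrow> edge set \<Rightarrow> edge \<Rightarrow> edge set \<Rightarrow> bool" where
  "reply a b n t E B e B' \<longleftrightarrow>
     B \<subseteq> B' \<and> card B' \<le> card B + b \<and> admissible a b n (Suc t) (if e \<in> B then E else insert e E) B'"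

text \<open>\<open>secures a b n t E \<phi>\<close>: after \<open>t\<close> attempts and with the edges \<open>E\<close> in her hands, Maker has a
  strategy that wins with probability at least \<open>\<phi> B\<close> if \<open>B\<close> is the set of PhantomBreaker's edges.
  The strategy may not depend on \<open>B\<close>, which is hidden from her.\<close>

inductive secures :: "nat \<Rightarrow> nat \<Rightarrow> nat \<Rightarrow> nat \<Rightarrow> edge set \<Rightarrow> (edge set \<Rightarrow> real) \<Rightarrow> bool"
  for a b n where
  secures_win: "perfect_matching n P \<Longrightarrow> P \<subseteq> E \<Longrightarrow>
      (\<And>B. admissible a b n t E B \<Longrightarrow> \<phi> B \<le> 1) \<Longrightarrow> secures a b n t E \<phi>"
| secures_lose: "(\<And>B. admissible a b n t E B \<Longrightarrow> \<phi> B \<le> 0) \<Longrightarrow> secures a b n t E \<phi>"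
| secures_move: "A \<subseteq> board n \<Longrightarrow> A \<noteq> {} \<Longrightarrow>
      (\<And>e s. e \<in> A \<Longrightarrow> secures a b n (Suc t) (if s then insert e E else E) (\<psi> e s)) \<Longrightarrow>
      (\<And>B r. admissible a b n t E B \<Longrightarrow> (\<And>e. e \<in> A \<Longrightarrow> reply a b n t E B e (r e)) \<Longrightarrow>
         real (card A) * \<phi> B \<le> (\<Sum>e\<in>A. \<psi> e (e \<notin> B) (r e))) \<Longrightarrow>
      secures a b n t E \<phi>"

lemma finite_board [simp]: "finite (board n)"
  by (simp add: board_def finite_imp_finite_nsets)

section \<open>One attempt at a time instead of rounds\<close>

lemma maker_edges_eq_view: "maker_edges h = {e. (e, True) \<in> set (maker_view h)}"
  by (induction h rule: maker_edges.induct) auto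

text \<open>The number of attempts is the length of Maker's view, so divisibility by
  \<open>a\<close> detects the end of a round and no counter is carried along.\<close>

definition answer :: "nat \<Rightarrow> breaker_strategy \<Rightarrow> move list \<Rightarrow> move list" where
  "answer a \<tau> h = (if a dvd length (maker_view h) then breaker_turn \<tau> h else h)"

definition step :: "nat \<Rightarrow> maker_strategy \<Rightarrow> breaker_strategy \<Rightarrow> move list \<Rightarrow> move list" where
  "step a \<sigma> \<tau> h = answer a \<tau> (maker_move \<sigma> h)"

definition wins_from :: "nat \<Rightarrow> nat \<Rightarrow> maker_strategy \<Rightarrow> breaker_strategy \<Rightarrow> move list \<Rightarrow> bool" where
  "wins_from a n \<sigma> \<tau> h \<longleftrightarrow> (\<exists>j P. perfect_matching n P \<and> P \<subseteq> maker_edges ((step a \<sigma> \<tau> ^^ j) h))"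

lemma maker_view_answer [simp]: "maker_view (answer a \<tau> h) = maker_view h"
  by (simp add: answer_def breaker_turn_def)

lemma maker_view_step:
  "maker_view (step a \<sigma> \<tau> h) = (\<sigma> (maker_view h), \<sigma> (maker_view h) \<notin> breaker_edges h) # maker_view h"
  by (simp add: step_def maker_move_def)

lemma maker_edges_answer [simp]: "maker_edges (answer a \<tau> h) = maker_edges h"
  by (simp add: maker_edges_eq_view)

lemma maker_edges_step_mono: "maker_edges h \<subseteq> maker_edges (step a \<sigma> \<tau> h)"
  by (auto simp: maker_edges_eq_view maker_view_step)

lemma maker_edges_steps_mono: "maker_edges h \<subseteq> maker_edges ((step a \<sigma> \<tau> ^^ j) h)"
  by (induction j) (use maker_edges_step_mono in force)+

lemma length_view_maker_moves:
  "length (maker_view ((maker_move \<sigma> ^^ i) h)) = length (maker_view h) + i"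
  by (induction i) (auto simp: maker_move_def)

lemma steps_within_round:
  assumes "a dvd length (maker_view h)" "i < a"
  shows "(step a \<sigma> \<tau> ^^ i) h = (maker_move \<sigma> ^^ i) h"
  using assms(2)
proof (induction i)
  case (Suc i)
  have "length (maker_view ((maker_move \<sigma> ^^ Suc i) h)) = length (maker_view h) + Suc i"
    by (rule length_view_maker_moves)
  moreover have "\<not> a dvd length (maker_view h) + Suc i"
    using assms(1) Suc.prems by (meson dvd_add_right_iff dvd_imp_le not_less zero_less_Suc)
  ultimately have "\<not> a dvd length (maker_view (maker_move \<sigma> ((maker_move \<sigma> ^^ i) h)))"
    by simp
  then show ?case
    using Suc by (simp add: step_def answer_def)
qed simp

lemma play_round_eq_steps:
  assumes "a dvd length (maker_view h)" "a > 0"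
  shows "play_round a \<sigma> \<tau> h = (step a \<sigma> \<tau> ^^ a) h"
proof -
  obtain i where a: "a = Suc i" using assms(2) by (cases a) auto
  have "(step a \<sigma> \<tau> ^^ a) h = step a \<sigma> \<tau> ((maker_move \<sigma> ^^ i) h)"
    using steps_within_round[OF assms(1), of i \<sigma> \<tau>] a by simp
  moreover have "a dvd length (maker_view (maker_move \<sigma> ((maker_move \<sigma> ^^ i) h)))"
    using length_view_maker_moves[of "Suc i" \<sigma> h] assms(1) dvd_add[of a _ a] unfolding a by simp
  ultimately show ?thesis
    by (simp add: step_def answer_def play_round_def a)
qed

lemma history_after_eq_steps:
  assumes "a > 0"
  shows "history_after a \<sigma> \<tau> t = (step a \<sigma> \<tau> ^^ (a * t)) []
     \<and> length (maker_view (history_after a \<sigma> \<tau> t)) = a * t"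
proof (induction t)
  case (Suc t)
  have "history_after a \<sigma> \<tau> (Suc t) = play_round a \<sigma> \<tau> (history_after a \<sigma> \<tau> t)"
    by (simp add: history_after_def)
  moreover have "play_round a \<sigma> \<tau> (history_after a \<sigma> \<tau> t) = (step a \<sigma> \<tau> ^^ a) (history_after a \<sigma> \<tau> t)"
    by (rule play_round_eq_steps) (use Suc assms in auto)
  ultimately have "history_after a \<sigma> \<tau> (Suc t) = (step a \<sigma> \<tau> ^^ (a * Suc t)) []"
    using Suc by (simp add: funpow_add)
  moreover have "length (maker_view ((step a \<sigma> \<tau> ^^ j) [])) = j" for j
    by (induction j) (auto simp: maker_view_step)
  ultimately show ?case by simp
qed (simp add: history_after_def)

lemma wins_from_imp_maker_wins:
  assumes "a > 0" "wins_from a n \<sigma> \<tau> []"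
  shows "maker_wins a n \<sigma> \<tau>"
proof -
  from assms(2) obtain j P where P: "perfect_matching n P" "P \<subseteq> maker_edges ((step a \<sigma> \<tau> ^^ j) [])"
    by (auto simp: wins_from_def)
  \<comment> \<open>A win after \<open>j\<close> attempts is still visible at the end of round
    \<open>j\<close>, that is after \<open>a * j\<close> attempts, because Maker's edges only
    grow.\<close>
  have "j \<le> a * j" using assms(1) by simp
  then obtain i where i: "a * j = i + j"
    by (metis add.commute le_Suc_ex)
  have "P \<subseteq> maker_edges ((step a \<sigma> \<tau> ^^ (a * j)) [])"
    using P(2) maker_edges_steps_mono unfolding i funpow_add comp_def by (meson subset_trans)
  then show ?thesis
    using P(1) history_after_eq_steps[OF assms(1)] unfolding maker_wins_def by metis
qed

text \<open>Views list the latest attempt first, so the views that follow a success of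
  \<open>e\<close> at \<open>v\<close> are those with suffix \<open>(e, True) # v\<close>. A
  strategy is one function of the entire view, and two continuations can be glued without conflict.
  All remaining views fall to \<open>\<sigma>2\<close>, in particular those after a failure.\<close>

definition splice ::
  "(edge \<times> bool) list \<Rightarrow> edge \<Rightarrow> maker_strategy \<Rightarrow> maker_strategy \<Rightarrow> maker_strategy" where
  "splice v e \<sigma>1 \<sigma>2 w =
     (if w = v then e else if \<exists>u. w = u @ (e, True) # v then \<sigma>1 w else \<sigma>2 w)"

lemma steps_cong:
  assumes "\<And>u. \<sigma> (u @ maker_view h) = \<sigma>' (u @ maker_view h)"
  shows "(step a \<sigma> \<tau> ^^ j) h = (step a \<sigma>' \<tau> ^^ j) h
    \<and> (\<exists>u. maker_view ((step a \<sigma>' \<tau> ^^ j) h) = u @ maker_view h)"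
proof (induction j)
  case (Suc j)
  then obtain u where u: "maker_view ((step a \<sigma>' \<tau> ^^ j) h) = u @ maker_view h" by blast
  show ?case
    using Suc assms u by (auto simp: step_def maker_move_def)
qed simp

lemma wins_from_splice:
  assumes "maker_view h = v"
    and "wins_from a n (if e \<notin> breaker_edges h then \<sigma>1 else \<sigma>2) \<tau> (answer a \<tau> (Attempt e # h))"
  shows "wins_from a n (splice v e \<sigma>1 \<sigma>2) \<tau> h"
proof -
  let ?\<sigma> = "splice v e \<sigma>1 \<sigma>2" and ?s = "e \<notin> breaker_edges h"
  let ?h = "answer a \<tau> (Attempt e # h)"
  have h: "step a ?\<sigma> \<tau> h = ?h"
    using assms(1) by (simp add: step_def maker_move_def splice_def)
  have view: "maker_view ?h = (e, ?s) # v"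
    using assms(1) by simp
  have "?\<sigma> (u @ maker_view ?h) = (if ?s then \<sigma>1 else \<sigma>2) (u @ maker_view ?h)" for u
  proof -
    \<comment> \<open>Suffixes of equal length of one list coincide, so no view falls under both
      continuations.\<close>
    have "u' @ (e, True) # v \<noteq> u @ (e, False) # v" for u'
      by (metis append_eq_append_conv length_Cons list.inject prod.inject append.assoc append_Cons
          append_Nil append_same_eq)
    then show ?thesis unfolding view by (auto simp: splice_def)
  qed
  then have "(step a ?\<sigma> \<tau> ^^ j) ?h = (step a (if ?s then \<sigma>1 else \<sigma>2) \<tau> ^^ j) ?h" for j
    using steps_cong by blast
  moreover obtain j P where "perfect_matching n P"
    "P \<subseteq> maker_edges ((step a (if ?s then \<sigma>1 else \<sigma>2) \<tau> ^^ j) ?h)"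
    using assms(2) unfolding wins_from_def by blast
  moreover have "(step a ?\<sigma> \<tau> ^^ Suc j) h = (step a ?\<sigma> \<tau> ^^ j) ?h" for j
    by (simp add: funpow_swap1 h)
  ultimately show ?thesis
    unfolding wins_from_def by metis
qed

section \<open>Soundness of \<open>secures\<close> for the actual game\<close>

lemma reply_answer:
  assumes "a > 0" "\<tau> \<in> legal_breaker b n"
    and "admissible a b n (length (maker_view h)) (maker_edges h) (breaker_edges h)" "e \<in> board n"
  shows "reply a b n (length (maker_view h)) (maker_edges h) (breaker_edges h) e
           (breaker_edges (answer a \<tau> (Attempt e # h)))"
proof -
  let ?h = "Attempt e # h" and ?t = "length (maker_view h)"
  have \<tau>: "\<tau> ?h \<subseteq> unclaimed n ?h" "card (\<tau> ?h) \<le> b"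
    using assms(2) by (auto simp: legal_breaker_def)
  have adm: "breaker_edges h \<subseteq> board n" "breaker_edges h \<inter> maker_edges h = {}"
    "card (breaker_edges h) \<le> b * (?t div a)"
    using assms(3) by (auto simp: admissible_def)
  show ?thesis
  proof (cases "a dvd Suc ?t")
    case False
    then have "Suc ?t div a = ?t div a" by (simp add: div_Suc dvd_eq_mod_eq_0)
    then show ?thesis
      using False adm by (auto simp: reply_def admissible_def answer_def)
  next
    case True
    then have div: "Suc ?t div a = Suc (?t div a)" by (simp add: div_Suc dvd_eq_mod_eq_0)
    have B: "breaker_edges (answer a \<tau> ?h) = \<tau> ?h \<union> breaker_edges h"
      using True by (simp add: answer_def breaker_turn_def)
    have card: "card (\<tau> ?h \<union> breaker_edges h) \<le> card (breaker_edges h) + b"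
      using card_Un_le[of "\<tau> ?h" "breaker_edges h"] \<tau>(2) by linarith
    have "card (\<tau> ?h \<union> breaker_edges h) \<le> b * (Suc ?t div a)"
      using card adm(3) div by simp
    then show ?thesis
      using card adm \<tau>(1) unfolding reply_def B admissible_def
      by (auto simp: unclaimed_def split: if_splits)
  qed
qed

lemma prob_bind_pmf:
  "measure_pmf.prob (bind_pmf p f) X = measure_pmf.expectation p (\<lambda>x. measure_pmf.prob (f x) X)"
proof -
  have "ennreal (measure_pmf.prob (bind_pmf p f) X) =
      (\<integral>\<^sup>+x. ennreal (measure_pmf.prob (f x) X) \<partial>measure_pmf p)"
    by (simp add: measure_pmf.emeasure_eq_measure[symmetric])
  also have "\<dots> = ennreal (measure_pmf.expectation p (\<lambda>x. measure_pmf.prob (f x) X))"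
    by (intro nn_integral_eq_integral measure_pmf.integrable_const_bound[where B=1]) auto
  finally show ?thesis
    by (simp add: integral_nonneg_AE)
qed

text \<open>The distribution is built along the derivation: a constant strategy at the leaves, a
  uniform mixture of glued continuations at a move. It is chosen after the view \<open>v\<close> but
  before \<open>h\<close> and \<open>\<tau>\<close>. Histories that differ only in PhantomBreaker's
  edges may share a view, and this order of quantifiers is where the hidden information is
  respected.\<close>

lemma secures_sound:
  assumes "secures a b n t E \<phi>" "a > 0" "board n \<noteq> {}"
    and "length v = t" "{e. (e, True) \<in> set v} = E"
  shows "\<exists>M. set_pmf M \<subseteq> legal_maker n \<and>
     (\<forall>\<tau>\<in>legal_breaker b n. \<forall>h. maker_view h = v \<longrightarrow> admissible a b n t E (breaker_edges h) \<longrightarrow>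
        \<phi> (breaker_edges h) \<le> measure_pmf.prob M {\<sigma>. wins_from a n \<sigma> \<tau> h})"
  using assms(1,4,5)
proof (induction arbitrary: v rule: secures.induct)
  case (secures_win P E t \<phi>)
  obtain e where e: "e \<in> board n" using assms(3) by blast
  have "wins_from a n \<sigma> \<tau> h" if "maker_view h = v" for \<sigma> \<tau> h
  proof -
    have "P \<subseteq> maker_edges ((step a \<sigma> \<tau> ^^ 0) h)"
      using secures_win that by (simp add: maker_edges_eq_view)
    then show ?thesis unfolding wins_from_def using secures_win(1) by blast
  qed
  then have "\<phi> (breaker_edges h) \<le> measure_pmf.prob (return_pmf (\<lambda>v. e)) {\<sigma>. wins_from a n \<sigma> \<tau> h}"
    if "maker_view h = v" "admissible a b n t E (breaker_edges h)" for h \<tau>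
    using that secures_win by simp
  then show ?case
    using e by (intro exI[of _ "return_pmf (\<lambda>v. e)"]) (auto simp: legal_maker_def)
next
  case (secures_lose t E \<phi>)
  obtain e where "e \<in> board n" using assms(3) by blast
  then show ?case
    using secures_lose
    by (intro exI[of _ "return_pmf (\<lambda>v. e)"]) (auto simp: legal_maker_def intro: order_trans)
next
  case (secures_move A t E \<psi> \<phi>)
  have fin: "finite A" using secures_move.hyps(1) finite_board finite_subset by blast
  have "\<exists>M. set_pmf M \<subseteq> legal_maker n \<and>
     (\<forall>\<tau>\<in>legal_breaker b n. \<forall>h. maker_view h = (e, s) # v \<longrightarrow>
        admissible a b n (Suc t) (if s then insert e E else E) (breaker_edges h) \<longrightarrow>
        \<psi> e s (breaker_edges h) \<le> measure_pmf.prob M {\<sigma>. wins_from a n \<sigma> \<tau> h})" if "e \<in> A" for e s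
    by (rule secures_move.IH[OF that]) (use secures_move.prems in auto)
  then obtain M where M: "\<And>e s. e \<in> A \<Longrightarrow> set_pmf (M e s) \<subseteq> legal_maker n"
    and win: "\<And>e s \<tau> h. e \<in> A \<Longrightarrow> \<tau> \<in> legal_breaker b n \<Longrightarrow> maker_view h = (e, s) # v \<Longrightarrow>
        admissible a b n (Suc t) (if s then insert e E else E) (breaker_edges h) \<Longrightarrow>
        \<psi> e s (breaker_edges h) \<le> measure_pmf.prob (M e s) {\<sigma>. wins_from a n \<sigma> \<tau> h}"
    by metis
  \<comment> \<open>Both continuations are drawn in advance and independently; the outcome of
    \<open>e\<close> selects the one that is used, so only its marginal matters.\<close>
  define N where "N e = map_pmf (\<lambda>(\<sigma>1, \<sigma>2). splice v e \<sigma>1 \<sigma>2) (pair_pmf (M e True) (M e False))" for e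
  show ?case
  proof (intro exI conjI ballI allI impI)
    show "set_pmf (bind_pmf (pmf_of_set A) N) \<subseteq> legal_maker n"
    proof
      fix \<sigma> assume "\<sigma> \<in> set_pmf (bind_pmf (pmf_of_set A) N)"
      then obtain e \<sigma>1 \<sigma>2 where *: "e \<in> A" "\<sigma>1 \<in> set_pmf (M e True)" "\<sigma>2 \<in> set_pmf (M e False)"
        "\<sigma> = splice v e \<sigma>1 \<sigma>2"
        using secures_move.hyps(2) fin by (auto simp: N_def)
      then have "\<sigma>1 w \<in> board n" "\<sigma>2 w \<in> board n" "e \<in> board n" for w
        using M[OF *(1)] secures_move.hyps(1) unfolding legal_maker_def by blast+
      then show "\<sigma> \<in> legal_maker n"
        by (simp add: *(4) legal_maker_def splice_def)
    qed
  next
    fix \<tau> h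
    assume \<tau>: "\<tau> \<in> legal_breaker b n" and h: "maker_view h = v"
      and adm: "admissible a b n t E (breaker_edges h)"
    define r where "r e = breaker_edges (answer a \<tau> (Attempt e # h))" for e
    have E: "E = maker_edges h" and t: "t = length (maker_view h)"
      using h secures_move.prems by (auto simp: maker_edges_eq_view)
    have reply: "reply a b n t E (breaker_edges h) e (r e)" if "e \<in> A" for e
      unfolding r_def E t using \<tau> adm that secures_move.hyps(1) assms(2)
      by (intro reply_answer) (auto simp: E t)
    have N: "\<psi> e (e \<notin> breaker_edges h) (r e) \<le> measure_pmf.prob (N e) {\<sigma>. wins_from a n \<sigma> \<tau> h}"
      if "e \<in> A" for e
    proof -
      let ?s = "e \<notin> breaker_edges h" and ?h = "answer a \<tau> (Attempt e # h)"
      let ?W = "{\<sigma>. wins_from a n \<sigma> \<tau> ?h}"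
      have "\<psi> e ?s (r e) \<le> measure_pmf.prob (M e ?s) ?W"
        unfolding r_def using that \<tau> h reply[OF that]
        by (intro win) (auto simp: reply_def r_def)
      also have "\<dots> = measure_pmf.prob (pair_pmf (M e True) (M e False))
          {(\<sigma>1, \<sigma>2). wins_from a n (if ?s then \<sigma>1 else \<sigma>2) \<tau> ?h}"
      proof (cases ?s)
        case True
        have "measure_pmf.prob (map_pmf fst (pair_pmf (M e True) (M e False))) ?W =
          measure_pmf.prob (pair_pmf (M e True) (M e False)) (fst -` ?W)" by simp
        then show ?thesis using True by (simp add: map_fst_pair_pmf vimage_def case_prod_unfold)
      next
        case False
        have "measure_pmf.prob (map_pmf snd (pair_pmf (M e True) (M e False))) ?W =
          measure_pmf.prob (pair_pmf (M e True) (M e False)) (snd -` ?W)" by simp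
        then show ?thesis using False by (simp add: map_snd_pair_pmf vimage_def case_prod_unfold)
      qed
      also have "\<dots> \<le> measure_pmf.prob (N e) {\<sigma>. wins_from a n \<sigma> \<tau> h}"
        unfolding N_def measure_map_pmf
        by (intro measure_pmf.finite_measure_mono) (auto intro!: wins_from_splice[OF h])
      finally show ?thesis .
    qed
    have "real (card A) * \<phi> (breaker_edges h) \<le> (\<Sum>e\<in>A. \<psi> e (e \<notin> breaker_edges h) (r e))"
      using secures_move.hyps(4)[OF adm] reply by blast
    also have "\<dots> \<le> (\<Sum>e\<in>A. measure_pmf.prob (N e) {\<sigma>. wins_from a n \<sigma> \<tau> h})"
      by (intro sum_mono N)
    finally show "\<phi> (breaker_edges h) \<le>
        measure_pmf.prob (bind_pmf (pmf_of_set A) N) {\<sigma>. wins_from a n \<sigma> \<tau> h}"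
      using secures_move.hyps(2) fin
      by (simp add: prob_bind_pmf integral_pmf_of_set field_simps card_gt_0_iff)
  qed
qed

text \<open>Conditioning on PhantomBreaker's draw, which is independent of Maker's, turns a
  randomized opponent into an average over deterministic ones.\<close>

theorem secures_win_prob:
  assumes "secures a b n 0 {} \<phi>" "a > 0" "board n \<noteq> {}"
  shows "\<exists>M\<in>randomized_maker n. \<forall>B\<in>randomized_breaker b n. \<phi> {} \<le> maker_win_prob a n M B"
proof -
  obtain M where M: "set_pmf M \<subseteq> legal_maker n"
    and win: "\<And>\<tau> h. \<tau> \<in> legal_breaker b n \<Longrightarrow> maker_view h = [] \<Longrightarrow>
       admissible a b n 0 {} (breaker_edges h) \<Longrightarrow>
       \<phi> (breaker_edges h) \<le> measure_pmf.prob M {\<sigma>. wins_from a n \<sigma> \<tau> h}"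
    using secures_sound[OF assms, of "[]"] by auto
  have *: "\<phi> {} \<le> measure_pmf.prob M {\<sigma>. maker_wins a n \<sigma> \<tau>}" if "\<tau> \<in> legal_breaker b n" for \<tau>
  proof -
    have "\<phi> {} \<le> measure_pmf.prob M {\<sigma>. wins_from a n \<sigma> \<tau> []}"
      using win[OF that, of "[]"] by (simp add: admissible_def)
    also have "\<dots> \<le> measure_pmf.prob M {\<sigma>. maker_wins a n \<sigma> \<tau>}"
      using wins_from_imp_maker_wins[OF assms(2)] by (intro measure_pmf.finite_measure_mono) auto
    finally show ?thesis .
  qed
  have "\<phi> {} \<le> maker_win_prob a n M B" if "B \<in> randomized_breaker b n" for B
  proof -
    have "maker_win_prob a n M B =
        measure_pmf.prob (bind_pmf B (\<lambda>\<tau>. map_pmf (\<lambda>\<sigma>. (\<sigma>, \<tau>)) M)) {(\<sigma>, \<tau>). maker_wins a n \<sigma> \<tau>}"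
      unfolding maker_win_prob_def pair_pmf_def map_pmf_def by (subst bind_commute_pmf) simp
    also have "\<dots> = measure_pmf.expectation B (\<lambda>\<tau>. measure_pmf.prob M {\<sigma>. maker_wins a n \<sigma> \<tau>})"
      unfolding prob_bind_pmf measure_map_pmf by (simp add: vimage_def)
    also have "\<dots> \<ge> measure_pmf.expectation B (\<lambda>\<tau>. \<phi> {})"
    proof (intro integral_mono_AE)
      show "integrable (measure_pmf B) (\<lambda>\<tau>. measure_pmf.prob M {\<sigma>. maker_wins a n \<sigma> \<tau>})"
        by (intro measure_pmf.integrable_const_bound[where B=1]) auto
    qed (use that * in \<open>auto simp: AE_measure_pmf_iff randomized_breaker_def\<close>)
    finally show ?thesis by simp
  qed
  then show ?thesis using M by (auto simp: randomized_maker_def)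
qed

section \<open>Short-term plans\<close>

lemma secures_mono:
  assumes "secures a b n t E \<phi>" "\<And>B. admissible a b n t E B \<Longrightarrow> \<phi>' B \<le> \<phi> B"
  shows "secures a b n t E \<phi>'"
  using assms(1)
proof cases
  case (secures_win P)
  then show ?thesis
    by (intro secures.secures_win[of n P]) (use assms(2) order_trans in blast)+
next
  case secures_lose
  then show ?thesis
    by (intro secures.secures_lose) (use assms(2) order_trans in blast)
next
  case (secures_move A \<psi>)
  show ?thesis
  proof (rule secures.secures_move[where A=A and \<psi>=\<psi>])
    fix B r assume *: "admissible a b n t E B" "\<And>e. e \<in> A \<Longrightarrow> reply a b n t E B e (r e)"
    have "real (card A) * \<phi>' B \<le> real (card A) * \<phi> B"
      using assms(2)[OF *(1)] by (simp add: mult_left_mono)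
    then show "real (card A) * \<phi>' B \<le> (\<Sum>e\<in>A. \<psi> e (e \<notin> B) (r e))"
      using secures_move(4)[OF *] by linarith
  qed (use secures_move in auto)
qed

text \<open>\<open>plan b n S T E L\<close>: within \<open>T\<close> attempts Maker can turn \<open>E\<close> into a set that satisfies \<open>S\<close>, and
  fails to do so with probability at most \<open>L B\<close>.\<close>

inductive plan :: "nat \<Rightarrow> nat \<Rightarrow> (edge set \<Rightarrow> bool) \<Rightarrow> nat \<Rightarrow> edge set \<Rightarrow> (edge set \<Rightarrow> real) \<Rightarrow> bool"
  for b n S where
  plan_done: "S E \<Longrightarrow> (\<And>B. B \<subseteq> board n \<Longrightarrow> 0 \<le> L B) \<Longrightarrow> plan b n S T E L"
| plan_give_up: "(\<And>B. B \<subseteq> board n \<Longrightarrow> 1 \<le> L B) \<Longrightarrow> plan b n S T E L"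
| plan_move: "A \<subseteq> board n \<Longrightarrow> A \<noteq> {} \<Longrightarrow>
      (\<And>e s. e \<in> A \<Longrightarrow> plan b n S T (if s then insert e E else E) (\<Lambda> e s)) \<Longrightarrow>
      (\<And>B r. B \<subseteq> board n \<Longrightarrow>
         (\<And>e. e \<in> A \<Longrightarrow> B \<subseteq> r e \<and> r e \<subseteq> board n \<and> card (r e) \<le> card B + b) \<Longrightarrow>
         (\<Sum>e\<in>A. \<Lambda> e (e \<notin> B) (r e)) \<le> real (card A) * L B) \<Longrightarrow>
      plan b n S (Suc T) E L"

lemma plan_mono:
  assumes "plan b n S T E L" "\<And>B. B \<subseteq> board n \<Longrightarrow> L B \<le> L' B"
  shows "plan b n S T E L'"
  using assms(1)
proof cases
  case plan_done
  then show ?thesis by (intro plan.plan_done) (use assms(2) order_trans in blast)+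
next
  case plan_give_up
  then show ?thesis by (intro plan.plan_give_up) (use assms(2) order_trans in blast)
next
  case (plan_move A T' \<Lambda>)
  show ?thesis
    unfolding plan_move(1)
  proof (rule plan.plan_move[where A=A and \<Lambda>=\<Lambda>])
    fix B r assume *: "B \<subseteq> board n"
      "\<And>e. e \<in> A \<Longrightarrow> B \<subseteq> r e \<and> r e \<subseteq> board n \<and> card (r e) \<le> card B + b"
    have "real (card A) * L B \<le> real (card A) * L' B"
      using assms(2)[OF *(1)] by (simp add: mult_left_mono)
    moreover have "(\<Sum>e\<in>A. \<Lambda> e (e \<notin> B) (r e)) \<le> real (card A) * L B"
      by (rule plan_move(5)) (use * in auto)
    ultimately show "(\<Sum>e\<in>A. \<Lambda> e (e \<notin> B) (r e)) \<le> real (card A) * L' B"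
      by linarith
  qed (use plan_move in auto)
qed

text \<open>The value \<open>g\<close> is collected only when a plan of at most \<open>T\<close>
  attempts ends; this is the worst that \<open>T\<close> replies can do to it in the
  meantime.\<close>

definition low :: "nat \<Rightarrow> nat \<Rightarrow> nat \<Rightarrow> (edge set \<Rightarrow> real) \<Rightarrow> edge set \<Rightarrow> real" where
  "low b n T g B = Min (g ` {B'. B \<subseteq> B' \<and> B' \<subseteq> board n \<and> card B' \<le> card B + b * T})"

lemma finite_low_set [simp]: "finite {B'. B \<subseteq> B' \<and> B' \<subseteq> board n \<and> card B' \<le> c}"
  by (rule finite_subset[of _ "Pow (board n)"]) auto

lemma low_le:
  assumes "B \<subseteq> B'" "B' \<subseteq> board n" "card B' \<le> card B + b * T"
  shows "low b n T g B \<le> g B'"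
  unfolding low_def using assms by (intro Min_le) auto

lemma low_ge:
  assumes "B \<subseteq> board n"
    and "\<And>B'. B \<subseteq> B' \<Longrightarrow> B' \<subseteq> board n \<Longrightarrow> card B' \<le> card B + b * T \<Longrightarrow> c \<le> g B'"
  shows "c \<le> low b n T g B"
proof -
  have "B \<in> {B'. B \<subseteq> B' \<and> B' \<subseteq> board n \<and> card B' \<le> card B + b * T}"
    using assms(1) by simp
  then have "{B'. B \<subseteq> B' \<and> B' \<subseteq> board n \<and> card B' \<le> card B + b * T} \<noteq> {}" by blast
  then show ?thesis unfolding low_def using assms(2) by (subst Min_ge_iff) auto
qed

lemma low_step:
  assumes "B \<subseteq> B'" "B' \<subseteq> board n" "card B' \<le> card B + b"
  shows "low b n (Suc T) g B \<le> low b n T g B'"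
  using assms by (intro low_ge low_le) auto

text \<open>\<open>\<Delta>\<close> is the price of a failed plan: afterwards Maker still secures
  \<open>g B - \<Delta>\<close>. The continuations are required for all times up to
  \<open>t + T\<close> and all supersets of \<open>E\<close>, since neither the length of the plan
  nor the edges it wins are known beforehand.\<close>

lemma plan_secures:
  assumes "plan b n S T E L" "0 \<le> \<Delta>"
    and "\<And>t' E'. t' \<le> t + T \<Longrightarrow> E \<subseteq> E' \<Longrightarrow> S E' \<Longrightarrow> secures a b n t' E' g"
    and "\<And>t' E'. t' \<le> t + T \<Longrightarrow> E \<subseteq> E' \<Longrightarrow> secures a b n t' E' (\<lambda>B. g B - \<Delta>)"
  shows "secures a b n t E (\<lambda>B. low b n T g B - \<Delta> * min 1 (L B))"
  using assms(1,3,4)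
proof (induction arbitrary: t rule: plan.induct)
  case (plan_done E L T)
  have "secures a b n t E g" using plan_done by simp
  then show ?case
  proof (rule secures_mono)
    fix B assume "admissible a b n t E B"
    then have B: "B \<subseteq> board n" by (simp add: admissible_def)
    have "low b n T g B \<le> g B" by (rule low_le) (use B in auto)
    moreover have "0 \<le> \<Delta> * min 1 (L B)" using plan_done(2)[OF B] assms(2) by simp
    ultimately show "low b n T g B - \<Delta> * min 1 (L B) \<le> g B" by linarith
  qed
next
  case (plan_give_up L T E)
  have "secures a b n t E (\<lambda>B. g B - \<Delta>)" using plan_give_up by simp
  then show ?case
  proof (rule secures_mono)
    fix B assume "admissible a b n t E B"
    then have B: "B \<subseteq> board n" by (simp add: admissible_def)
    have "low b n T g B \<le> g B" by (rule low_le) (use B in auto)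
    moreover have "min 1 (L B) = 1" using plan_give_up(1)[OF B] by simp
    ultimately show "low b n T g B - \<Delta> * min 1 (L B) \<le> g B - \<Delta>" by simp
  qed
next
  case (plan_move A T E \<Lambda> L)
  show ?case
  proof (rule secures_move[where A=A and \<psi>="\<lambda>e s B. low b n T g B - \<Delta> * min 1 (\<Lambda> e s B)"])
    fix e s assume e: "e \<in> A"
    show "secures a b n (Suc t) (if s then insert e E else E)
        (\<lambda>B. low b n T g B - \<Delta> * min 1 (\<Lambda> e s B))"
    proof (rule plan_move.IH[OF e])
      fix t' E' assume "t' \<le> Suc t + T" "(if s then insert e E else E) \<subseteq> E'"
      then show "secures a b n t' E' (\<lambda>B. g B - \<Delta>)"
        using plan_move.prems(2)[of t' E'] by (auto split: if_splits)
      assume "S E'"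
      with \<open>t' \<le> _\<close> \<open>_ \<subseteq> E'\<close> show "secures a b n t' E' g"
        using plan_move.prems(1)[of t' E'] by (auto split: if_splits)
    qed
  next
    fix B r assume B: "admissible a b n t E B"
      and "\<And>e. e \<in> A \<Longrightarrow> reply a b n t E B e (r e)"
    then have r: "\<And>e. e \<in> A \<Longrightarrow> B \<subseteq> r e \<and> r e \<subseteq> board n \<and> card (r e) \<le> card B + b"
      by (auto simp: reply_def admissible_def)
    \<comment> \<open>The truncation at 1 has to pass through the average, because a plan may bound
      its loss by a number above 1.\<close>
    have "(\<Sum>e\<in>A. min 1 (\<Lambda> e (e \<notin> B) (r e))) \<le> (\<Sum>e\<in>A. \<Lambda> e (e \<notin> B) (r e))"
      by (intro sum_mono) simp
    moreover have "(\<Sum>e\<in>A. min 1 (\<Lambda> e (e \<notin> B) (r e))) \<le> real (card A) * 1"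
      by (rule sum_bounded_above) simp
    ultimately have "(\<Sum>e\<in>A. min 1 (\<Lambda> e (e \<notin> B) (r e))) \<le> real (card A) * min 1 (L B)"
      using plan_move.hyps(4)[OF _ r] B by (force simp: admissible_def min_def)
    then have "\<Delta> * (\<Sum>e\<in>A. min 1 (\<Lambda> e (e \<notin> B) (r e))) \<le> \<Delta> * (real (card A) * min 1 (L B))"
      using assms(2) by (rule mult_left_mono)
    moreover have "(\<Sum>e\<in>A. low b n (Suc T) g B) \<le> (\<Sum>e\<in>A. low b n T g (r e))"
      using r by (intro sum_mono low_step) auto
    ultimately show "real (card A) * (low b n (Suc T) g B - \<Delta> * min 1 (L B))
        \<le> (\<Sum>e\<in>A. low b n T g (r e) - \<Delta> * min 1 (\<Lambda> e (e \<notin> B) (r e)))"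
      by (simp add: sum_subtractf sum_distrib_left algebra_simps)
  qed (use plan_move in auto)
qed

section \<open>Collecting many neighbours by random attempts\<close>

lemma sum_card_Int_disjoint_le:
  assumes "finite W" "finite B" "disjoint_family_on N W"
  shows "(\<Sum>x\<in>W. card (B \<inter> N x)) \<le> card B"
proof -
  have "(\<Sum>x\<in>W. card (B \<inter> N x)) = card (\<Union>x\<in>W. B \<inter> N x)"
    using assms by (intro card_UN_disjoint[symmetric]) (auto simp: disjoint_family_on_def)
  also have "\<dots> \<le> card B" using assms(2) by (intro card_mono) auto
  finally show ?thesis .
qed

lemma card_Int_reply_le:
  assumes "B \<subseteq> B'" "finite B'" "card B' \<le> card B + b"
  shows "card (B' \<inter> K) \<le> card (B \<inter> K) + b"
proof -
  have "card (B' \<inter> K) \<le> card ((B \<inter> K) \<union> (B' - B))"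
    using assms finite_subset by (intro card_mono) auto
  also have "\<dots> \<le> card (B \<inter> K) + card (B' - B)" by (rule card_Un_le)
  also have "card (B' - B) \<le> b"
    using assms finite_subset[OF assms(1,2)] by (simp add: card_Diff_subset)
  finally show ?thesis by simp
qed

lemma inj_on_edge: "inj_on (\<lambda>x. {u, x}) W"
  by (auto simp: inj_on_def doubleton_eq_iff)

lemma card_free_reply_le:
  assumes "B \<subseteq> B'" "finite B'" "card B' \<le> card B + b" "finite W"
  shows "card {x\<in>W. {u, x} \<notin> B} \<le> card {x\<in>W. {u, x} \<notin> B'} + b"
proof -
  have "card {x\<in>W. {u, x} \<notin> B} \<le> card ({x\<in>W. {u, x} \<notin> B'} \<union> {x\<in>W. {u, x} \<in> B' - B})"
    using assms(4) by (intro card_mono) auto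
  also have "\<dots> \<le> card {x\<in>W. {u, x} \<notin> B'} + card {x\<in>W. {u, x} \<in> B' - B}" by (rule card_Un_le)
  also have "card {x\<in>W. {u, x} \<in> B' - B} = card ((\<lambda>x. {u, x}) ` {x\<in>W. {u, x} \<in> B' - B})"
    by (intro card_image[symmetric] inj_on_edge)
  also have "\<dots> \<le> card (B' - B)" using assms(2) by (intro card_mono) auto
  also have "\<dots> \<le> b"
    using assms finite_subset[OF assms(1,2)] by (simp add: card_Diff_subset)
  finally show ?thesis by simp
qed

text \<open>The losses account for finding too few new neighbours of \<open>u\<close>, via the expectation of
  \<open>2 ^ (k - card X)\<close>, and for the edges of \<open>N\<close> that PhantomBreaker owns.\<close>

lemma plan_collect:
  fixes f m \<alpha> c :: real
  assumes W: "W \<subseteq> {..<n}" "u < n" "u \<notin> W"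
    and N: "disjoint_family_on N W"
    and pos: "0 < f" "0 \<le> \<alpha>" "0 \<le> c"
    and G: "\<And>r B. G r B \<Longrightarrow> B \<subseteq> board n \<Longrightarrow>
        f + real s \<le> real (card {x\<in>W. {u, x} \<notin> B}) \<and> real (card B) \<le> m"
    and G_step: "\<And>r B B'. G (Suc r) B \<Longrightarrow> B \<subseteq> B' \<Longrightarrow> B' \<subseteq> board n \<Longrightarrow>
        card B' \<le> card B + b \<Longrightarrow> G r B'"
    and final: "\<And>X E'. X \<subseteq> W \<Longrightarrow> card X \<le> s \<Longrightarrow> E \<subseteq> E' \<Longrightarrow> (\<forall>x\<in>X. {u, x} \<in> E') \<Longrightarrow>
        plan b n S T E' (\<lambda>B. if k \<le> card X \<and> G 0 B
          then min 1 (\<alpha> * card (B \<inter> (\<Union>x\<in>X. N x)) + c) else 1)"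
    and X: "X \<subseteq> W" "card X + r \<le> s" "E \<subseteq> E'" "\<forall>x\<in>X. {u, x} \<in> E'"
  shows "plan b n S (T + r) E' (\<lambda>B. if G r B
     then min 1 (2 ^ k / 2 ^ card X * (1 - f / (2 * real n)) ^ r
       + \<alpha> * (card (B \<inter> (\<Union>x\<in>X. N x)) + r * (b + m / f)) + c) else 1)"
  using X
proof (induction r arbitrary: X E')
  case 0
  have "plan b n S T E' (\<lambda>B. if k \<le> card X \<and> G 0 B
          then min 1 (\<alpha> * card (B \<inter> (\<Union>x\<in>X. N x)) + c) else 1)"
    by (rule final) (use 0 in auto)
  then show ?case
    unfolding add_0_right
  proof (rule plan_mono, goal_cases)
    case (1 B)
    define p where "p = (2::real) ^ k / 2 ^ card X"
    define q where "q = \<alpha> * card (B \<inter> (\<Union>x\<in>X. N x))"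
    have "0 \<le> q" using pos by (simp add: q_def)
    \<comment> \<open>With fewer than \<open>k\<close> neighbours the first term alone covers a
      total failure.\<close>
    moreover have "1 \<le> p" if "\<not> k \<le> card X"
      using that by (simp add: p_def power_increasing)
    moreover have "0 \<le> p" by (simp add: p_def)
    ultimately show ?case
      using pos unfolding p_def[symmetric] by (auto simp: min_def q_def[symmetric])
  qed
next
  case (Suc r)
  define \<theta> where "\<theta> = 1 - f / (2 * real n)"
  define L where "L r X B = (if G r B
     then min 1 (2 ^ k / 2 ^ card X * \<theta> ^ r
       + \<alpha> * (card (B \<inter> (\<Union>x\<in>X. N x)) + r * (b + m / f)) + c) else 1)" for r X B
  have finW: "finite W" using W(1) finite_subset by blast
  define A where "A = (\<lambda>x. {u, x}) ` (W - X)"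
  have cardA: "card A = card (W - X)" unfolding A_def by (intro card_image inj_on_edge)
  show ?case
  proof (cases "W - X = {}")
    case True
    \<comment> \<open>If every vertex of \<open>W\<close> is already collected, the guard is
      impossible, as it promises more than \<open>s\<close> free edges into
      \<open>W\<close>.\<close>
    have "\<not> G (Suc r) B" if "B \<subseteq> board n" for B
    proof
      assume "G (Suc r) B"
      then have "f + real s \<le> real (card {x\<in>W. {u, x} \<notin> B})" using G that by blast
      also have "card {x\<in>W. {u, x} \<notin> B} \<le> card X"
        using True Suc.prems(1) finW finite_subset by (intro card_mono) blast+
      finally show False using Suc.prems(2) pos by simp
    qed
    then show ?thesis by (intro plan_give_up) auto
  next
    case False
    have "plan b n S (Suc (T + r)) E' (L (Suc r) X)"
    proof (rule plan_move[where A=A and \<Lambda>="\<lambda>e s. L r (if s then X \<union> (e - {u}) else X)"])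
      show "A \<subseteq> board n" using W by (auto simp: A_def board_def)
      show "A \<noteq> {}" using False by (auto simp: A_def)
      fix e s assume "e \<in> A"
      then obtain x where x: "x \<in> W - X" "e = {u, x}" by (auto simp: A_def)
      then have eu: "X \<union> (e - {u}) = insert x X" using W by auto
      have "card (insert x X) \<le> Suc (card X)" by (rule card_insert_le_m1) auto
      then show "plan b n S (T + r) (if s then insert e E' else E') (L r (if s then X \<union> (e - {u}) else X))"
        unfolding L_def \<theta>_def eu using x Suc.prems
        by (cases s; intro Suc.IH[of "if s then insert x X else X" "if s then insert e E' else E'", simplified]) auto
    next
      fix B r' assume B: "B \<subseteq> board n"
        and r': "\<And>e. e \<in> A \<Longrightarrow> B \<subseteq> r' e \<and> r' e \<subseteq> board n \<and> card (r' e) \<le> card B + b"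
      let ?\<Lambda> = "\<lambda>e. L r (if e \<notin> B then X \<union> (e - {u}) else X) (r' e)"
      have le1: "(\<Sum>e\<in>A. ?\<Lambda> e) \<le> real (card A) * 1"
        by (rule sum_bounded_above) (simp add: L_def)
      show "(\<Sum>e\<in>A. ?\<Lambda> e) \<le> real (card A) * L (Suc r) X B"
      proof (cases "G (Suc r) B")
        case False
        then show ?thesis using le1 by (simp add: L_def)
      next
        case True
        define q where "q = card (B \<inter> (\<Union>x\<in>X. N x))"
        define Y where "Y = {x\<in>W-X. {u, x} \<notin> B}"
        define P where "P = (2::real) ^ k / 2 ^ card X * \<theta> ^ r"
        define d where "d = \<alpha> * (q + b + r * (b + m / f)) + c"
        have finB: "finite B" using B finite_subset finite_board by blast
        have finX: "finite X" using Suc.prems(1) finW finite_subset by blast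
        have f_le: "f + real s \<le> real (card {x\<in>W. {u, x} \<notin> B})" and m: "real (card B) \<le> m"
          using G[OF True B] by auto
        have "card {x\<in>W. {u, x} \<notin> B} \<le> card (Y \<union> X)"
          using finW finX by (intro card_mono) (auto simp: Y_def)
        also have "\<dots> \<le> card Y + card X" by (rule card_Un_le)
        finally have Y: "f \<le> card Y" using f_le Suc.prems(2) by simp
        have YW: "card Y \<le> card (W - X)" unfolding Y_def using finW by (intro card_mono) auto
        have Wn: "card (W - X) \<le> n"
          using card_mono[of "{..<n}" "W - X"] W(1) by auto
        have n: "real n > 0" using W(2) by simp
        have fn: "f \<le> n" using Y YW Wn by linarith
        then have \<theta>: "0 \<le> \<theta>" using n by (simp add: \<theta>_def field_simps)
        have P: "0 \<le> P" unfolding P_def using \<theta> by simp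
        \<comment> \<open>A free edge halves the first term; the reply adds at most \<open>b\<close>
          to the count, and a new \<open>x\<close> brings in \<open>B \<inter> N x\<close>.\<close>
        have each: "?\<Lambda> {u, x} \<le> (if x \<in> Y then P / 2 else P) + d + \<alpha> * card (B \<inter> N x)"
          if "x \<in> W - X" for x
        proof -
          have e: "{u, x} \<in> A" using that by (simp add: A_def)
          have r'x: "B \<subseteq> r' {u, x}" "finite (r' {u, x})" "card (r' {u, x}) \<le> card B + b"
            "r' {u, x} \<subseteq> board n"
            using r'[OF e] finite_subset finite_board by blast+
          have Gr: "G r (r' {u, x})" using G_step[OF True] r'x by blast
          have ux: "{u, x} - {u} = {x}" using that W by auto
          have q: "card (r' {u, x} \<inter> K) \<le> card (B \<inter> K) + b" for K
            by (rule card_Int_reply_le[OF r'x(1-3)])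
          show ?thesis
          proof (cases "{u, x} \<in> B")
            case True
            have "\<alpha> * card (r' {u, x} \<inter> (\<Union>x\<in>X. N x)) \<le> \<alpha> * real (q + b)"
              using q[of "\<Union>x\<in>X. N x"] pos(2) unfolding q_def
              by (intro mult_left_mono) (simp_all only: of_nat_le_iff)
            moreover have "0 \<le> \<alpha> * card (B \<inter> N x)" using pos by simp
            ultimately show ?thesis using True Gr
              by (auto simp: L_def Y_def P_def d_def min_def algebra_simps)
          next
            case False
            have "B \<inter> (\<Union>x\<in>insert x X. N x) = (B \<inter> N x) \<union> (B \<inter> (\<Union>x\<in>X. N x))" by auto
            then have "card (B \<inter> (\<Union>x\<in>insert x X. N x)) \<le> card (B \<inter> N x) + q"
              unfolding q_def by (simp add: card_Un_le)
            then have "\<alpha> * card (r' {u, x} \<inter> (\<Union>x\<in>insert x X. N x)) \<le> \<alpha> * real (card (B \<inter> N x) + q + b)"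
              using q[of "\<Union>x\<in>insert x X. N x"] pos(2)
              by (intro mult_left_mono) linarith+
            moreover have "card (insert x X) = Suc (card X)" using that finX by simp
            moreover have "x \<in> Y" using False that by (simp add: Y_def)
            ultimately show ?thesis using False Gr
              by (auto simp: L_def P_def d_def min_def ux algebra_simps)
          qed
        qed
        have "(\<Sum>e\<in>A. ?\<Lambda> e) = (\<Sum>x\<in>W-X. ?\<Lambda> {u, x})"
          unfolding A_def by (subst sum.reindex[OF inj_on_edge]) simp
        also have "\<dots> \<le> (\<Sum>x\<in>W-X. (if x \<in> Y then P / 2 else P) + d + \<alpha> * card (B \<inter> N x))"
          by (intro sum_mono each)
        also have "\<dots> = (\<Sum>x\<in>W-X. if x \<in> Y then P / 2 else P) + card (W - X) * d
             + \<alpha> * (\<Sum>x\<in>W-X. card (B \<inter> N x))"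
          by (simp add: sum.distrib sum_distrib_left)
        finally have total: "(\<Sum>e\<in>A. ?\<Lambda> e) \<le> (\<Sum>x\<in>W-X. if x \<in> Y then P / 2 else P)
             + card (W - X) * d + \<alpha> * (\<Sum>x\<in>W-X. card (B \<inter> N x))" .
        have S1: "(\<Sum>x\<in>W-X. if x \<in> Y then P / 2 else P) = card (W - X) * P - card Y * (P / 2)"
        proof -
          have "(\<Sum>x\<in>W-X. if x \<in> Y then P / 2 else P) = (\<Sum>x\<in>W-X. P - (if x \<in> Y then P / 2 else 0))"
            by (intro sum.cong) auto
          also have "\<dots> = card (W - X) * P - (\<Sum>x\<in>W-X. if x \<in> Y then P / 2 else 0)"
            by (simp add: sum_subtractf)
          also have "(\<Sum>x\<in>W-X. if x \<in> Y then P / 2 else 0) = (\<Sum>x\<in>Y. P / 2)"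
            using finW by (intro sum.mono_neutral_cong_right) (auto simp: Y_def)
          finally show ?thesis by simp
        qed
        \<comment> \<open>At least a share \<open>f / n\<close> of the choices halves
          \<open>P\<close>, which yields the factor \<open>\<theta> = 1 - f / (2 n)\<close>.\<close>
        have S2: "card (W - X) * P - card Y * (P / 2) \<le> card (W - X) * (P * \<theta>)"
        proof -
          have "f * real (card (W - X)) \<le> real (card Y) * real n"
            using Y Wn pos by (intro mult_mono) auto
          then have "P * (f * real (card (W - X))) \<le> P * (real (card Y) * real n)" using P by (rule mult_left_mono)
          then have "P * (f * real (card (W - X))) / (2 * real n) \<le> P * (real (card Y) * real n) / (2 * real n)"
            by (rule divide_right_mono) simp
          also have "\<dots> = real (card Y) * (P / 2)" using n by simp
          finally show ?thesis by (simp add: \<theta>_def right_diff_distrib mult.commute mult.left_commute)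
        qed
        \<comment> \<open>The sets \<open>N x\<close> are disjoint, so a random \<open>x\<close>
          adds on average at most \<open>card B / card (W - X) \<le> m / f\<close> edges.\<close>
        have S3: "real (\<Sum>x\<in>W-X. card (B \<inter> N x)) \<le> card (W - X) * (m / f)"
        proof -
          have "disjoint_family_on N (W - X)" using N by (auto simp: disjoint_family_on_def)
          then have "(\<Sum>x\<in>W-X. card (B \<inter> N x)) \<le> card B"
            by (intro sum_card_Int_disjoint_le) (use finB finW in auto)
          then have "real (\<Sum>x\<in>W-X. card (B \<inter> N x)) \<le> real (card B)"
            by (rule of_nat_mono)
          also note m
          also have "m \<le> card (W - X) * (m / f)"
          proof -
            have "m * f \<le> m * card (W - X)"
              by (rule mult_left_mono) (use Y YW m in linarith)+
            then have "m \<le> m * card (W - X) / f" using pos(1) by (subst pos_le_divide_eq)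
            then show ?thesis by (simp add: mult.commute)
          qed
          finally show ?thesis .
        qed
        have S4: "\<alpha> * real (\<Sum>x\<in>W-X. card (B \<inter> N x)) \<le> \<alpha> * (card (W - X) * (m / f))"
          using S3 pos(2) by (rule mult_left_mono)
        define l where "l = P * \<theta> + d + \<alpha> * (m / f)"
        have "(\<Sum>e\<in>A. ?\<Lambda> e) \<le> card (W - X) * (P * \<theta>) + card (W - X) * d
            + \<alpha> * (card (W - X) * (m / f))"
          using total S1 S2 S4 by linarith
        also have "\<dots> = real (card A) * l"
          by (simp add: cardA l_def algebra_simps)
        finally have "(\<Sum>e\<in>A. ?\<Lambda> e) \<le> real (card A) * min 1 l"
          using le1 by (auto simp: min_def)
        moreover have "l = 2 ^ k / 2 ^ card X * \<theta> ^ Suc r + \<alpha> * (q + Suc r * (b + m / f)) + c"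
          by (simp add: l_def P_def d_def algebra_simps)
        ultimately show ?thesis using True by (simp add: L_def q_def)
      qed
    qed
    then show ?thesis unfolding L_def[abs_def] \<theta>_def add_Suc_right .
  qed
qed

section \<open>Augmenting paths\<close>

text \<open>A partner function turns augmentation into a finite function update and names the
  closing edges \<open>{p x, p z}\<close> directly.\<close>

definition is_matching :: "(nat \<Rightarrow> nat) \<Rightarrow> edge set \<Rightarrow> nat set \<Rightarrow> bool" where
  "is_matching p E W \<longleftrightarrow> (\<forall>x\<in>W. p x \<in> W \<and> p x \<noteq> x \<and> p (p x) = x \<and> {x, p x} \<in> E)"

definition has_matching :: "edge set \<Rightarrow> nat set \<Rightarrow> bool" where
  "has_matching E W \<longleftrightarrow> (\<exists>p. is_matching p E W)"

lemma has_matching_mono: "has_matching E W \<Longrightarrow> E \<subseteq> E' \<Longrightarrow> has_matching E' W"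
  unfolding has_matching_def is_matching_def by blast

lemma has_matching_empty [simp]: "has_matching E {}"
  by (simp add: has_matching_def is_matching_def)

lemma has_matching_imp_perfect:
  assumes "has_matching E {..<n}"
  obtains P where "perfect_matching n P" "P \<subseteq> E"
proof -
  obtain p where p: "\<And>x. x < n \<Longrightarrow> p x < n \<and> p x \<noteq> x \<and> p (p x) = x \<and> {x, p x} \<in> E"
    using assms by (auto simp: has_matching_def is_matching_def)
  define P where "P = (\<lambda>x. {x, p x}) ` {..<n}"
  have "P \<subseteq> board n"
  proof
    fix e assume "e \<in> P"
    then obtain x where "x < n" "e = {x, p x}" by (auto simp: P_def)
    then show "e \<in> board n" using p[of x] by (auto simp: board_def)
  qed
  moreover have "\<exists>!e. e \<in> P \<and> v \<in> e" if "v < n" for v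
  proof
    show "{v, p v} \<in> P \<and> v \<in> {v, p v}" using that by (simp add: P_def)
    fix e assume "e \<in> P \<and> v \<in> e"
    then obtain x where "x < n" "e = {x, p x}" "v = x \<or> v = p x" by (auto simp: P_def)
    then show "e = {v, p v}" using p[of x] by auto
  qed
  ultimately have "perfect_matching n P" by (simp add: perfect_matching_def)
  moreover have "P \<subseteq> E"
  proof
    fix e assume "e \<in> P"
    then obtain x where "x < n" "e = {x, p x}" by (auto simp: P_def)
    then show "e \<in> E" using p[of x] by simp
  qed
  ultimately show thesis using that by blast
qed

lemma has_matching_add_edge:
  assumes "has_matching E W" "u \<notin> W" "v \<notin> W" "u \<noteq> v" "{u, v} \<in> E"
  shows "has_matching E (insert u (insert v W))"
proof -
  obtain p where p: "is_matching p E W" using assms(1) by (auto simp: has_matching_def)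
  have vu: "{v, u} \<in> E" using assms(5) by (simp add: insert_commute)
  have "is_matching (p(u := v, v := u)) E (insert u (insert v W))"
    unfolding is_matching_def
  proof
    fix y assume y: "y \<in> insert u (insert v W)"
    consider "y = u" | "y = v" | "y \<in> W" "y \<noteq> u" "y \<noteq> v" using y assms(2,3) by blast
    then show "(p(u := v, v := u)) y \<in> insert u (insert v W) \<and> (p(u := v, v := u)) y \<noteq> y
      \<and> (p(u := v, v := u)) ((p(u := v, v := u)) y) = y \<and> {y, (p(u := v, v := u)) y} \<in> E"
    proof cases
      case 3
      then have "p y \<in> W" "p y \<noteq> y" "p (p y) = y" "{y, p y} \<in> E"
        using p by (auto simp: is_matching_def)
      moreover from this have "p y \<noteq> u" "p y \<noteq> v" using assms(2,3) by blast+
      ultimately show ?thesis using 3 by simp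
    qed (use assms(4,5) vu in simp_all)
  qed
  then show ?thesis by (auto simp: has_matching_def)
qed

text \<open>The augmenting path is \<open>u, x, p x, p z, z, v\<close>.\<close>

lemma has_matching_augment:
  assumes p: "is_matching p E W" and uv: "u \<notin> W" "v \<notin> W" "u \<noteq> v"
    and xz: "x \<in> W" "z \<in> W" "x \<noteq> z" "p x \<noteq> z"
    and E: "{u, x} \<in> E" "{v, z} \<in> E" "{p x, p z} \<in> E"
  shows "has_matching E (insert u (insert v W))"
proof -
  have pin: "p y \<in> W" "p y \<noteq> y" "p (p y) = y" "{y, p y} \<in> E" if "y \<in> W" for y
    using p that by (auto simp: is_matching_def)
  have d: "p x \<noteq> p z" "p z \<noteq> x" "p x \<noteq> x" "p z \<noteq> z" "p x \<in> W" "p z \<in> W"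
    using xz pin by metis+
  have rest: "p y \<in> W" "p y \<noteq> x" "p y \<noteq> z" "p y \<noteq> p x" "p y \<noteq> p z"
    if "y \<in> W" "y \<noteq> x" "y \<noteq> z" "y \<noteq> p x" "y \<noteq> p z" for y
    using that xz pin by metis+
  have E': "{x, u} \<in> E" "{z, v} \<in> E" "{p z, p x} \<in> E"
    using E by (simp_all add: insert_commute)
  define q where "q = p(u := x, x := u, v := z, z := v, p x := p z, p z := p x)"
  have "is_matching q E (insert u (insert v W))"
    unfolding is_matching_def
  proof
    fix y assume y: "y \<in> insert u (insert v W)"
    have neq: "u \<noteq> x" "u \<noteq> z" "u \<noteq> p x" "u \<noteq> p z" "v \<noteq> x" "v \<noteq> z" "v \<noteq> p x" "v \<noteq> p z"
      using uv xz d by auto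
    have q: "q u = x" "q x = u" "q v = z" "q z = v" "q (p x) = p z" "q (p z) = p x"
      using neq uv xz d by (auto simp: q_def)
    have q': "q w = p w" if "w \<in> W" "w \<noteq> x" "w \<noteq> z" "w \<noteq> p x" "w \<noteq> p z" for w
      using that uv by (auto simp: q_def)
    consider "y = u" | "y = v" | "y = x" | "y = z" | "y = p x" | "y = p z"
      | "y \<in> W" "y \<noteq> x" "y \<noteq> z" "y \<noteq> p x" "y \<noteq> p z" using y by blast
    then show "q y \<in> insert u (insert v W) \<and> q y \<noteq> y \<and> q (q y) = y \<and> {y, q y} \<in> E"
    proof cases
      case 7
      have "q y = p y" by (rule q') (use 7 in auto)
      moreover have "q (p y) = p (p y)" by (rule q') (use rest[OF 7] in auto)
      ultimately show ?thesis using pin[OF 7(1)] by auto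
    qed (use q neq uv(3) xz d E E' in simp_all)
  qed
  then show ?thesis by (auto simp: has_matching_def)
qed

section \<open>Plans that close an augmenting path\<close>

lemma plan_last_edge:
  assumes K: "K \<subseteq> board n" "K \<noteq> {}" and S: "\<And>e. e \<in> K \<Longrightarrow> S (insert e E)"
  shows "plan b n S 1 E (\<lambda>B. card (B \<inter> K) / card K)"
proof -
  have fin: "finite K" using K finite_subset finite_board by blast
  have "plan b n S (Suc 0) E (\<lambda>B. card (B \<inter> K) / card K)"
  proof (rule plan_move[where A=K and \<Lambda>="\<lambda>e s B. if s then 0 else 1"])
    fix e s assume "e \<in> K"
    then show "plan b n S 0 (if s then insert e E else E) (\<lambda>B. if s then 0 else 1)"
      using S by (cases s) (auto intro: plan_done plan_give_up)
  next
    fix B :: "edge set"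
    have "(\<Sum>e\<in>K. if e \<notin> B then 0 else 1 :: real) = (\<Sum>e\<in>B \<inter> K. 1)"
      using fin by (intro sum.mono_neutral_cong_right) auto
    then show "(\<Sum>e\<in>K. if e \<notin> B then 0 else 1 :: real) \<le> card K * (card (B \<inter> K) / card K)"
      using fin K by simp
  qed (use K in auto)
  then show ?thesis by simp
qed

text \<open>At least \<open>k\<close> neighbours \<open>x\<close> of \<open>u\<close> and then
  \<open>k\<close> neighbours \<open>z\<close> of \<open>v\<close> leave at least
  \<open>k\<^sup>2\<close> candidates \<open>{p x, p z}\<close> for the closing edge. PhantomBreaker
  is expected to own at most \<open>s * (b + m / f)\<close> of them when \<open>v\<close> has been
  served, so a random candidate is rarely his if \<open>k\<close> is large.\<close>

lemma plan_augment:
  fixes f m :: real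
  assumes p: "is_matching p E W" and W: "W \<subseteq> {..<n}"
    and uv: "u < n" "v < n" "u \<noteq> v" "u \<notin> W" "v \<notin> W" and f: "0 < f" and k: "0 < k"
  defines "\<theta> \<equiv> 1 - f / (2 * real n)"
  shows "plan b n (\<lambda>E. has_matching E (insert u (insert v W))) (1 + s + s) E
    (\<lambda>B. if card B + b * (s + s) \<le> m
           \<and> f + 3 * s + b * (s + s) \<le> card {x\<in>W. {u, x} \<notin> B}
           \<and> f + 3 * s + b * (s + s) \<le> card {x\<in>W. {v, x} \<notin> B}
         then min 1 (2 * (2 ^ k * \<theta> ^ s) + s * (b + m / f) / k\<^sup>2) else 1)"
proof -
  \<comment> \<open>With \<open>j\<close> collecting attempts to come, a reserve of
    \<open>b * j\<close> edges is kept. Of the \<open>3 * s\<close>, one \<open>s\<close> is the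
    slack that \<open>plan_collect\<close> demands and two pay for removing \<open>X\<close> and its
    partners from \<open>W\<close>.\<close>
  define G where "G j B \<longleftrightarrow> real (card B) + b * real j \<le> m
      \<and> f + 3 * real s + b * real j \<le> card {x\<in>W. {u, x} \<notin> B}
      \<and> f + 3 * real s + b * real j \<le> card {x\<in>W. {v, x} \<notin> B}" for j B
  let ?S = "\<lambda>E. has_matching E (insert u (insert v W))"
  define c where "c = 2 ^ k * \<theta> ^ s + s * (b + m / f) / k\<^sup>2"
  have finW: "finite W" using W finite_subset by blast
  have pin: "p y \<in> W" "p y \<noteq> y" "p (p y) = y" if "y \<in> W" for y
    using p that by (auto simp: is_matching_def)
  have G_step: "G j B'" if "G (Suc j) B" "B \<subseteq> B'" "B' \<subseteq> board n" "card B' \<le> card B + b" for j B B'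
  proof -
    have fin: "finite B'" using that(3) finite_subset finite_board by blast
    have "card {x\<in>W. {w, x} \<notin> B} \<le> card {x\<in>W. {w, x} \<notin> B'} + b" for w
      by (rule card_free_reply_le[OF that(2) fin that(4) finW])
    from this[of u] this[of v] that(4) have
      "real (card {x\<in>W. {u, x} \<notin> B}) \<le> real (card {x\<in>W. {u, x} \<notin> B'}) + b"
      "real (card {x\<in>W. {v, x} \<notin> B}) \<le> real (card {x\<in>W. {v, x} \<notin> B'}) + b"
      "real (card B') \<le> real (card B) + b" by linarith+
    moreover have "b * real (Suc j) = b * real j + b" by (simp add: algebra_simps)
    ultimately show ?thesis
      using that(1) unfolding G_def by linarith
  qed
  have Gm: "real (card B) \<le> m" if "G j B" for j B
  proof -
    have "0 \<le> b * real j" by simp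
    then show ?thesis using that unfolding G_def by linarith
  qed
  have stage2: "plan b n ?S (1 + s) E' (\<lambda>B. if G s B then min 1 c else 1)"
    if X: "X \<subseteq> W" "card X \<le> s" "k \<le> card X" and E': "E \<subseteq> E'" "\<forall>x\<in>X. {u, x} \<in> E'" for X E'
  proof -
    \<comment> \<open>Removing \<open>X\<close> and its partners keeps the six vertices of a path
      distinct and the sets \<open>N z\<close> disjoint.\<close>
    define W' where "W' = W - X - p ` X"
    define N where "N z = (\<lambda>x. {p x, p z}) ` X" for z
    have finX: "finite X" using X finW finite_subset by blast
    have eq: "x = y \<and> z = w" if "{p x, p z} = {p y, p w}" "x \<in> X" "y \<in> X" "z \<in> W'" "w \<in> W'" for x y z w
    proof -
      have "x \<in> W" "y \<in> W" "z \<in> W" "w \<in> W" "z \<noteq> y" using that X by (auto simp: W'_def)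
      moreover have "p x = p y \<and> p z = p w \<or> p x = p w \<and> p z = p y"
        using that(1) by (simp add: doubleton_eq_iff)
      ultimately show ?thesis using pin(3) by metis
    qed
    have "plan b n ?S (1 + s) E' (\<lambda>B. if G s B
     then min 1 (2 ^ k / 2 ^ card ({}::nat set) * (1 - f / (2 * real n)) ^ s
       + (1 / k\<^sup>2) * (card (B \<inter> (\<Union>x\<in>{}. N x)) + s * (b + m / f)) + 0) else 1)"
    proof (rule plan_collect[where E=E' and u=v and s=s and W=W'])
      show "disjoint_family_on N W'"
        unfolding disjoint_family_on_def
      proof (intro ballI impI equals0I)
        fix z w e assume "z \<in> W'" "w \<in> W'" "z \<noteq> w" "e \<in> N z \<inter> N w"
        then obtain x y where "x \<in> X" "y \<in> X" "{p x, p z} = {p y, p w}" by (auto simp: N_def)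
        then show False using eq[of x z y w] \<open>z \<in> W'\<close> \<open>w \<in> W'\<close> \<open>z \<noteq> w\<close> by simp
      qed
      show "f + real s \<le> real (card {x\<in>W'. {v, x} \<notin> B}) \<and> real (card B) \<le> m"
        if "G r B" "B \<subseteq> board n" for r B
      proof -
        have "card {x\<in>W. {v, x} \<notin> B} \<le> card ({x\<in>W'. {v, x} \<notin> B} \<union> X \<union> p ` X)"
          using finW finX by (intro card_mono) (auto simp: W'_def)
        also have "\<dots> \<le> card {x\<in>W'. {v, x} \<notin> B} + card X + card (p ` X)"
          using card_Un_le[of "{x\<in>W'. {v, x} \<notin> B} \<union> X" "p ` X"]
            card_Un_le[of "{x\<in>W'. {v, x} \<notin> B}" X] by linarith
        finally have "card {x\<in>W. {v, x} \<notin> B} \<le> card {x\<in>W'. {v, x} \<notin> B} + card X + card X"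
          using card_image_le[OF finX, of p] by linarith
        then have "real (card {x\<in>W. {v, x} \<notin> B}) \<le> real (card {x\<in>W'. {v, x} \<notin> B}) + 2 * real s"
          using X(2) by linarith
        moreover have "0 \<le> b * real r" by simp
        ultimately show ?thesis using that(1) Gm[OF that(1)] unfolding G_def by linarith
      qed
      show "plan b n ?S 1 E'' (\<lambda>B. if k \<le> card Z \<and> G 0 B
          then min 1 (1 / k\<^sup>2 * card (B \<inter> (\<Union>x\<in>Z. N x)) + 0) else 1)"
        if Z: "Z \<subseteq> W'" "card Z \<le> s" and E'': "E' \<subseteq> E''" "\<forall>x\<in>Z. {v, x} \<in> E''" for Z E''
      proof (cases "k \<le> card Z")
        case False
        then show ?thesis by (intro plan_give_up) auto
      next
        case True
        define K where "K = (\<Union>z\<in>Z. N z)"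
        have K_alt: "K = (\<lambda>(x, z). {p x, p z}) ` (X \<times> Z)" by (auto simp: K_def N_def)
        have "card K = card (X \<times> Z)"
          unfolding K_alt
        proof (intro card_image inj_onI, clarify)
          fix x z y w assume "x \<in> X" "z \<in> Z" "y \<in> X" "w \<in> Z" "{p x, p z} = {p y, p w}"
          then show "x = y \<and> z = w" using eq[of x z y w] Z(1) by auto
        qed
        then have "k * k \<le> card K"
          using mult_le_mono[OF X(3) True] by (simp add: card_cartesian_product)
        then have cardK: "real (k\<^sup>2) \<le> card K"
          unfolding power2_eq_square by (rule of_nat_mono)
        have "plan b n ?S 1 E'' (\<lambda>B. card (B \<inter> K) / card K)"
        proof (rule plan_last_edge)
          have "{p x, p z} \<in> board n" if "x \<in> X" "z \<in> Z" for x z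
          proof -
            have "x \<in> W" "z \<in> W" "x \<noteq> z" using that X(1) Z(1) by (auto simp: W'_def)
            then show ?thesis using pin[of x] pin[of z] W by (auto simp: board_def)
          qed
          then show "K \<subseteq> board n" by (auto simp: K_alt)
          show "K \<noteq> {}"
          proof
            assume "K = {}"
            then have "real (k\<^sup>2) \<le> 0" using cardK by simp
            then show False using k by simp
          qed
          fix e assume "e \<in> K"
          then obtain x z where xz: "x \<in> X" "z \<in> Z" "e = {p x, p z}" by (auto simp: K_alt)
          have "is_matching p (insert e E'') W"
            using p E'(1) E''(1) unfolding is_matching_def by blast
          then show "has_matching (insert e E'') (insert u (insert v W))"
            by (rule has_matching_augment[where x=x and z=z])
               (use uv xz X(1) Z(1) E' E'' in \<open>auto simp: W'_def\<close>)
        qed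
        then show ?thesis
        proof (rule plan_mono)
          fix B
          have "real (card (B \<inter> K)) / card K \<le> card (B \<inter> K) / k\<^sup>2"
          proof (rule divide_left_mono[OF cardK])
            have k2: "0 < real (k\<^sup>2)" using k by simp
            show "0 < real (card K) * real (k\<^sup>2)"
              using less_le_trans[OF k2 cardK] k2 by (rule mult_pos_pos)
          qed simp
          moreover have "card (B \<inter> K) \<le> card K"
            by (rule card_mono) (use finX finite_subset[OF Z(1)] finW in \<open>auto simp: K_alt W'_def\<close>)
          then have "real (card (B \<inter> K)) / card K \<le> 1"
            by (simp add: divide_le_eq)
          ultimately show "real (card (B \<inter> K)) / card K \<le> (if k \<le> card Z \<and> G 0 B
          then min 1 (1 / k\<^sup>2 * card (B \<inter> (\<Union>x\<in>Z. N x)) + 0) else 1)"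
            by (simp add: K_def)
        qed
      qed
      show "G r B'" if "G (Suc r) B" "B \<subseteq> B'" "B' \<subseteq> board n" "card B' \<le> card B + b" for r B B'
        using G_step that by blast
    qed (use W uv f in \<open>auto simp: W'_def\<close>)
    then show ?thesis by (simp add: c_def \<theta>_def cong: if_cong)
  qed
  \<comment> \<open>While \<open>u\<close> is served there are no candidates to protect yet, hence
    \<open>\<alpha> = 0\<close> and empty \<open>N\<close>; the loss of the second collection enters
    as the additive constant. \<open>max 0\<close> supplies its sign, and \<open>c \<ge> 0\<close>
    is recovered whenever the guard holds.\<close>
  have "plan b n ?S (1 + s + s) E (\<lambda>B. if G (s + s) B
     then min 1 (2 ^ k / 2 ^ card ({}::nat set) * (1 - f / (2 * real n)) ^ s
       + 0 * (card (B \<inter> (\<Union>x\<in>({}::nat set). {})) + s * (b + m / f)) + max 0 c) else 1)"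
  proof (rule plan_collect[where E=E and u=u and s=s and W=W and G="\<lambda>r. G (r + s)"
        and N="\<lambda>_. {}" and X="{}" and \<alpha>=0 and c="max 0 c" and k=k])
    show "f + real s \<le> real (card {x\<in>W. {u, x} \<notin> B}) \<and> real (card B) \<le> m"
      if "G (r + s) B" "B \<subseteq> board n" for r B
    proof -
      have "0 \<le> b * real (r + s)" by simp
      then show ?thesis using that(1) Gm[OF that(1)] unfolding G_def by linarith
    qed
    show "plan b n ?S (1 + s) E' (\<lambda>B. if k \<le> card X \<and> G (0 + s) B
          then min 1 (0 * real (card (B \<inter> (\<Union>x\<in>X. {}))) + max 0 c) else 1)"
      if X: "X \<subseteq> W" "card X \<le> s" "E \<subseteq> E'" "\<forall>x\<in>X. {u, x} \<in> E'" for X E'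
    proof (cases "k \<le> card X")
      case False
      then show ?thesis by (intro plan_give_up) auto
    next
      case True
      show ?thesis
        by (rule plan_mono[OF stage2[OF X(1,2) True X(3,4)]]) (use True in auto)
    qed
    show "G (r + s) B'" if "G (Suc r + s) B" "B \<subseteq> B'" "B' \<subseteq> board n" "card B' \<le> card B + b" for r B B'
      using G_step[of "r + s"] that by simp
  qed (use W uv f in \<open>auto simp: disjoint_family_on_def\<close>)
  moreover have "0 \<le> c" if "G j B" for j B
  proof -
    have "0 \<le> m" using Gm[OF that] by (meson of_nat_0_le_iff order_trans)
    moreover have "f \<le> n"
    proof -
      have "card {x\<in>W. {u, x} \<notin> B} \<le> card {..<n}" using W by (intro card_mono) auto
      then have "real (card {x\<in>W. {u, x} \<notin> B}) \<le> real n" by simp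
      moreover have "0 \<le> b * real j" by simp
      ultimately show ?thesis using that unfolding G_def by linarith
    qed
    then have "0 \<le> \<theta>" using uv(1) f by (simp add: \<theta>_def field_simps)
    ultimately show ?thesis using f by (simp add: c_def)
  qed
  then have "max 0 c = c" if "G j B" for j B using that by (meson max.absorb2)
  ultimately have "plan b n ?S (1 + s + s) E (\<lambda>B. if G (s + s) B
     then min 1 (2 ^ k * \<theta> ^ s + c) else 1)"
    by (simp add: \<theta>_def cong: if_cong)
  then show ?thesis
    by (rule plan_mono) (simp add: G_def c_def algebra_simps)
qed

text \<open>The number of attempts does not depend on \<open>n\<close>: PhantomBreaker owns
  \<open>O(n)\<close> edges and linearly many edges at \<open>u\<close> and \<open>v\<close> are
  free, so each collecting attempt succeeds with probability bounded below and \<open>m / f\<close>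
  is a constant.\<close>

lemma plan_augment_const:
  fixes D \<eta> \<epsilon> :: real
  assumes "0 \<le> D" "0 < \<eta>" "\<eta> \<le> 1" "0 < \<epsilon>"
  shows "\<exists>T N0. \<forall>n\<ge>N0. \<forall>E W u v. has_matching E W \<longrightarrow> W \<subseteq> {..<n} \<longrightarrow> u < n \<longrightarrow> v < n \<longrightarrow> u \<noteq> v \<longrightarrow>
      u \<notin> W \<longrightarrow> v \<notin> W \<longrightarrow> plan b n (\<lambda>E. has_matching E (insert u (insert v W))) T E
        (\<lambda>B. if card B \<le> D * n \<and> \<eta> * n \<le> card {x\<in>W. {u, x} \<notin> B} \<and> \<eta> * n \<le> card {x\<in>W. {v, x} \<notin> B}
           then \<epsilon> else 1)"
proof -
  \<comment> \<open>\<open>\<eta> / 4\<close> is \<open>f / (2 n)\<close> for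
    \<open>f = \<eta> n / 2\<close>; the other half of \<open>\<eta> n\<close> pays for
    \<open>3 s + 2 b s\<close>.\<close>
  define \<theta> where "\<theta> = 1 - \<eta> / 4"
  have \<theta>: "0 < \<theta>" "\<theta> < 1" using assms by (auto simp: \<theta>_def)
  \<comment> \<open>With \<open>s = c * k\<close>, the factor \<open>2 ^ k * \<theta> ^ s\<close> is
    at most \<open>2 ^ k / 4 ^ k\<close>, and the blocked share of the candidates becomes
    \<open>C / k\<close>.\<close>
  obtain c where c: "\<theta> ^ c < 1 / 4"
    using real_arch_pow_inv[of "1 / 4" \<theta>] \<theta> by auto
  define C where "C = c * (b + 2 * (D + 1) / \<eta>)"
  have "\<forall>\<^sub>F k in sequentially. (1 / 2 :: real) ^ k < \<epsilon> / 4"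
    by (rule order_tendstoD(2)[OF LIMSEQ_power_zero]) (use assms(4) in auto)
  moreover have "\<forall>\<^sub>F k in sequentially. 2 * C / \<epsilon> < real k"
    using filterlim_real_sequentially by (rule filterlim_at_top_dense[THEN iffD1, rule_format])
  ultimately have "\<forall>\<^sub>F k in sequentially. (1 / 2 :: real) ^ k < \<epsilon> / 4 \<and> 2 * C / \<epsilon> < real k \<and> 0 < k"
    using eventually_gt_at_top[of 0] by eventually_elim auto
  then obtain k where k': "(1 / 2 :: real) ^ k < \<epsilon> / 4" "2 * C / \<epsilon> < real k" "0 < k"
    using eventually_happens'[OF sequentially_bot] by blast
  have "2 * C < \<epsilon> * k" using k'(2) assms(4) by (simp add: pos_divide_less_eq mult.commute)
  then have "C / k < \<epsilon> / 2" using k'(3) by (simp add: pos_divide_less_eq)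
  then have k: "2 * (1 / 2 :: real) ^ k + C / real k < \<epsilon>" "0 < k"
    using k' by linarith+
  define s where "s = c * k"
  define N0 where "N0 = nat \<lceil>2 * (3 * s + b * (s + s)) / \<eta>\<rceil> + b * (s + s) + 1"
  show ?thesis
  proof (intro exI allI impI)
    fix n E W u v
    assume n: "N0 \<le> n" and "has_matching E W" and as: "W \<subseteq> {..<n}" "u < n" "v < n" "u \<noteq> v" "u \<notin> W" "v \<notin> W"
    then obtain p where p: "is_matching p E W" by (auto simp: has_matching_def)
    have n0: "0 < real n" using n by (simp add: N0_def)
    have "2 * (3 * s + b * (s + s)) / \<eta> \<le> N0" unfolding N0_def by linarith
    then have "2 * (3 * s + b * (s + s)) / \<eta> \<le> n" using n by linarith
    then have free: "\<eta> * n / 2 + 3 * s + b * (s + s) \<le> \<eta> * n"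
      using assms by (simp add: field_simps)
    have b: "b * (s + s) \<le> real n" using n unfolding N0_def by linarith
    have f: "0 < \<eta> * n / 2" using assms n0 by simp
    have \<theta>': "1 - \<eta> * n / 2 / (2 * real n) = \<theta>" using n0 by (simp add: \<theta>_def)
    show "plan b n (\<lambda>E. has_matching E (insert u (insert v W))) (1 + s + s) E
        (\<lambda>B. if card B \<le> D * n \<and> \<eta> * n \<le> card {x\<in>W. {u, x} \<notin> B} \<and> \<eta> * n \<le> card {x\<in>W. {v, x} \<notin> B}
           then \<epsilon> else 1)"
    \<comment> \<open>The additional \<open>n\<close> in \<open>m\<close> absorbs the
      \<open>2 b s\<close> edges claimed during the plan.\<close>
    proof (rule plan_mono[OF plan_augment[OF p as(1-6) f k(2), where m="(D + 1) * n" and s=s]], goal_cases)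
      case (1 B)
      have "2 ^ k * \<theta> ^ s \<le> 2 ^ k * (1 / 4) ^ k"
        unfolding s_def power_mult using c \<theta> by (intro mult_left_mono power_mono) auto
      also have "\<dots> = (1 / 2 :: real) ^ k" by (simp add: power_mult_distrib[symmetric])
      finally have 1: "2 * (2 ^ k * \<theta> ^ s) \<le> 2 * (1 / 2) ^ k" by simp
      have "(D + 1) * n / (\<eta> * n / 2) = 2 * (D + 1) / \<eta>" using n0 by simp
      then have "s * (b + (D + 1) * n / (\<eta> * n / 2)) / k\<^sup>2 = C / k"
        using k(2) by (simp add: C_def s_def power2_eq_square)
      then have "2 * (2 ^ k * \<theta> ^ s) + s * (b + (D + 1) * n / (\<eta> * n / 2)) / k\<^sup>2 \<le> \<epsilon>"
        using 1 k(1) by linarith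
      moreover have "real (card B + b * (s + s)) \<le> (D + 1) * n" if "card B \<le> D * n"
        using that b by (simp add: algebra_simps)
      ultimately show ?case
        using free unfolding \<theta>' by auto
    qed
  qed
qed

section \<open>The endgame\<close>

definition deg :: "edge set \<Rightarrow> nat \<Rightarrow> nat" where
  "deg B u = card (B \<inter> {e. u \<in> e})"

lemma deg_reply_le:
  assumes "B \<subseteq> B'" "B' \<subseteq> board n" "card B' \<le> card B + c"
  shows "deg B' u \<le> deg B u + c"
  unfolding deg_def using assms finite_subset[OF assms(2)] by (intro card_Int_reply_le) auto

lemma card_le_free_deg:
  assumes "finite W" "u \<notin> W" "finite B"
  shows "card W \<le> card {x\<in>W. {u, x} \<notin> B} + deg B u"
proof -
  have "card W \<le> card ({x\<in>W. {u, x} \<notin> B} \<union> {x\<in>W. {u, x} \<in> B})"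
    using assms(1) by (intro card_mono) auto
  also have "\<dots> \<le> card {x\<in>W. {u, x} \<notin> B} + card {x\<in>W. {u, x} \<in> B}" by (rule card_Un_le)
  also have "card {x\<in>W. {u, x} \<in> B} = card ((\<lambda>x. {u, x}) ` {x\<in>W. {u, x} \<in> B})"
    by (intro card_image[symmetric] inj_on_edge)
  also have "\<dots> \<le> deg B u" unfolding deg_def using assms(3) by (intro card_mono) auto
  finally show ?thesis by simp
qed

text \<open>A winning probability is never negative, so branches whose bound has become worthless
  may be valued at 0.\<close>

lemma secures_max:
  assumes "secures a b n t E \<phi>"
  shows "secures a b n t E (\<lambda>B. max 0 (\<phi> B))"
  using assms
proof (induction rule: secures.induct)
  case (secures_win P E t \<phi>)
  then show ?case by (intro secures.secures_win[of n P]) auto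
next
  case (secures_lose t E \<phi>)
  then show ?case by (intro secures.secures_lose) auto
next
  case (secures_move A t E \<psi> \<phi>)
  show ?case
  proof (rule secures.secures_move[where A=A and \<psi>="\<lambda>e s B. max 0 (\<psi> e s B)"])
    fix B r assume *: "admissible a b n t E B" "\<And>e. e \<in> A \<Longrightarrow> reply a b n t E B e (r e)"
    have "real (card A) * \<phi> B \<le> (\<Sum>e\<in>A. \<psi> e (e \<notin> B) (r e))"
      by (rule secures_move.hyps(4)) (use * in auto)
    also have "\<dots> \<le> (\<Sum>e\<in>A. max 0 (\<psi> e (e \<notin> B) (r e)))" by (intro sum_mono) simp
    finally have "real (card A) * \<phi> B \<le> (\<Sum>e\<in>A. max 0 (\<psi> e (e \<notin> B) (r e)))" .
    moreover have "0 \<le> (\<Sum>e\<in>A. max 0 (\<psi> e (e \<notin> B) (r e)))" by (intro sum_nonneg) simp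
    ultimately show "real (card A) * max 0 (\<phi> B) \<le> (\<Sum>e\<in>A. max 0 (\<psi> e (e \<notin> B) (r e)))"
      by (simp add: max_def)
  qed (use secures_move in auto)
qed

text \<open>The random walk of the number \<open>j\<close> of unmatched pairs goes down with probability at least
  7/8, and \<open>2 ^ j * (9/16) ^ r\<close> is the corresponding supermartingale.\<close>

lemma secures_repairs:
  "\<exists>T N0. \<forall>n\<ge>N0. \<forall>r j t E U. U \<subseteq> {..<n} \<longrightarrow> card U = 2 * j \<longrightarrow> 6 * card U \<le> n \<longrightarrow>
     has_matching E ({..<n} - U) \<longrightarrow>
     secures a b n t E (\<lambda>B. of_bool ((\<forall>u\<in>U. 3 * (deg B u + b * (T * r)) \<le> n)
        \<and> card B + b * (T * r) \<le> (b + 1) * n) - 2 ^ j * (9 / 16) ^ r)"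
proof -
  have "0 \<le> real (b + 1)" "(0::real) < 1 / 2" "(1 / 2 :: real) \<le> 1" "(0::real) < 1 / 8" by auto
  from plan_augment_const[OF this, of b] obtain T N0 where plan: "\<forall>n\<ge>N0. \<forall>E W u v. has_matching E W \<longrightarrow> W \<subseteq> {..<n} \<longrightarrow>
      u < n \<longrightarrow> v < n \<longrightarrow> u \<noteq> v \<longrightarrow> u \<notin> W \<longrightarrow> v \<notin> W \<longrightarrow>
      plan b n (\<lambda>E. has_matching E (insert u (insert v W))) T E
        (\<lambda>B. if card B \<le> real (b + 1) * n \<and> 1 / 2 * n \<le> card {x\<in>W. {u, x} \<notin> B}
             \<and> 1 / 2 * n \<le> card {x\<in>W. {v, x} \<notin> B}
           then 1 / 8 else 1)"
    by blast
  \<comment> \<open>With \<open>r\<close> plans of \<open>T\<close> attempts ahead,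
    \<open>b * (T * r)\<close> edges are reserved, as all of them may land at one vertex.\<close>
  define light where "light n r U B \<longleftrightarrow> (\<forall>u\<in>U. 3 * (deg B u + b * (T * r)) \<le> n)
        \<and> card B + b * (T * r) \<le> (b + 1) * n" for n r and U :: "nat set" and B
  have le1: "of_bool Q - 2 ^ j * (9 / 16) ^ r \<le> (1::real)" for Q and j r :: nat
  proof -
    have "0 \<le> (2::real) ^ j * (9 / 16) ^ r" by simp
    moreover have "of_bool Q \<le> (1::real)" by simp
    ultimately show ?thesis by linarith
  qed
  have "secures a b n t E (\<lambda>B. of_bool (light n r U B) - 2 ^ j * (9 / 16) ^ r)"
    if n: "N0 \<le> n" and U: "U \<subseteq> {..<n}" "card U = 2 * j" "6 * card U \<le> n"
      and E: "has_matching E ({..<n} - U)" for n r j t E U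
    using U E
  proof (induction r arbitrary: j t E U)
    case 0
    show ?case
    proof (cases "j = 0")
      case True
      then have "U = {}" using 0 finite_subset by fastforce
      then obtain P where "perfect_matching n P" "P \<subseteq> E"
        using 0 has_matching_imp_perfect by auto
      then show ?thesis using True by (intro secures_win le1)
    next
      case False
      then have "(1::real) \<le> 2 ^ j" by simp
      then show ?thesis by (intro secures_lose) (auto simp: of_bool_def)
    qed
  next
    case (Suc r)
    have finU: "finite U" using Suc.prems(1) finite_subset by blast
    show ?case
    proof (cases j)
      case 0
      then have "U = {}" using Suc.prems(2) finU by simp
      then obtain P where "perfect_matching n P" "P \<subseteq> E"
        using Suc.prems has_matching_imp_perfect by auto
      then show ?thesis by (intro secures_win le1)
    next
      case (Suc i)
      then have "2 \<le> card U" using Suc.prems(2) by simp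
      then obtain U2 where "U2 \<subseteq> U" "card U2 = 2" by (meson obtain_subset_with_card_n)
      then obtain u v where uv: "u \<in> U" "v \<in> U" "u \<noteq> v"
        by (auto simp: card_2_iff)
      define U' where "U' = U - {u, v}"
      have cardU': "card U' = 2 * i"
        using uv finU Suc.prems(2) Suc by (simp add: U'_def card_Diff_subset)
      \<comment> \<open>The error is \<open>x\<close> after a successful repair and
        \<open>2 * x\<close> after a failed one, and a repair fails with probability at most 1/8.
        The total \<open>x + x / 8\<close> is exactly
        \<open>2 ^ j * (9 / 16) ^ Suc r\<close>.\<close>
      define x where "x = (2::real) ^ i * (9 / 16) ^ r"
      let ?g = "\<lambda>B. of_bool (light n r U B) - x"
      let ?W = "{..<n} - U"
      have W: "{..<n} - U' = insert u (insert v ?W)"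
        using uv Suc.prems(1) by (auto simp: U'_def)
      have "secures a b n t E (\<lambda>B. low b n T ?g B - x * min 1
         (if card B \<le> real (b + 1) * n \<and> 1 / 2 * n \<le> card {x\<in>?W. {u, x} \<notin> B}
             \<and> 1 / 2 * n \<le> card {x\<in>?W. {v, x} \<notin> B}
           then 1 / 8 else 1))"
      proof (rule plan_secures[OF plan[rule_format, OF n Suc.prems(4)]])
        fix t' E' assume E': "E \<subseteq> E'" "has_matching E' (insert u (insert v ?W))"
        have "secures a b n t' E' (\<lambda>B. of_bool (light n r U' B) - 2 ^ i * (9 / 16) ^ r)"
          by (rule Suc.IH) (use Suc.prems cardU' E' Suc in \<open>auto simp: W, auto simp: U'_def\<close>)
        then show "secures a b n t' E' ?g"
          by (rule secures_mono) (auto simp: light_def U'_def x_def)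
      next
        fix t' E' assume E': "E \<subseteq> E'"
        have "secures a b n t' E' (\<lambda>B. of_bool (light n r U B) - 2 ^ j * (9 / 16) ^ r)"
          by (rule Suc.IH) (use Suc.prems has_matching_mono[OF _ E'] in auto)
        then show "secures a b n t' E' (\<lambda>B. ?g B - x)"
          by (rule secures_mono) (simp add: x_def Suc)
      qed (use uv Suc.prems(1) in \<open>auto simp: x_def\<close>)
      then show ?thesis
      proof (rule secures_mono[OF secures_max])
        fix B assume "admissible a b n t E B"
        then have B: "B \<subseteq> board n" "finite B"
          using finite_subset[OF _ finite_board] by (auto simp: admissible_def)
        show "of_bool (light n (Suc r) U B) - 2 ^ j * (9 / 16) ^ Suc r
          \<le> max 0 (low b n T ?g B - x * min 1
         (if card B \<le> real (b + 1) * n \<and> 1 / 2 * n \<le> card {x\<in>?W. {u, x} \<notin> B}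
             \<and> 1 / 2 * n \<le> card {x\<in>?W. {v, x} \<notin> B}
           then 1 / 8 else 1))"
        proof (cases "light n (Suc r) U B")
          case False
          have "0 \<le> (2::real) ^ j * (9 / 16) ^ Suc r" by simp
          then show ?thesis using False by (intro max.coboundedI1) (simp del: power_Suc)
        next
          case True
          have "1 - x \<le> low b n T ?g B"
          proof (rule low_ge[OF B(1)])
            fix B' assume B': "B \<subseteq> B'" "B' \<subseteq> board n" "card B' \<le> card B + b * T"
            have "light n r U B'"
              unfolding light_def
            proof (intro conjI ballI)
              fix w assume "w \<in> U"
              then have "3 * (deg B w + b * (T * Suc r)) \<le> n" using True by (simp add: light_def)
              then show "3 * (deg B' w + b * (T * r)) \<le> n"
                using deg_reply_le[OF B', of w] by (simp add: algebra_simps)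
            next
              have "card B + b * (T * Suc r) \<le> (b + 1) * n" using True by (simp add: light_def)
              then show "card B' + b * (T * r) \<le> (b + 1) * n"
                using B'(3) by (simp add: algebra_simps)
            qed
            then show "1 - x \<le> ?g B'" by simp
          qed
          \<comment> \<open>At least \<open>5 n / 6\<close> vertices are matched and at most
            \<open>n / 3\<close> of them are blocked from \<open>w\<close>, which leaves
            \<open>n / 2\<close>.\<close>
          moreover have free: "1 / 2 * n \<le> card {x\<in>?W. {w, x} \<notin> B}" if "w \<in> U" for w
          proof -
            have "card ?W \<le> card {x\<in>?W. {w, x} \<notin> B} + deg B w"
              using that B(2) by (intro card_le_free_deg) auto
            moreover have "card ?W = n - card U"
              using Suc.prems(1) finU by (simp add: card_Diff_subset)
            moreover have "3 * (deg B w + b * (T * Suc r)) \<le> n" using True that by (simp add: light_def)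
            then have "3 * deg B w \<le> n" by simp
            ultimately have "n \<le> 2 * card {x\<in>?W. {w, x} \<notin> B}"
              using Suc.prems(3) by linarith
            then show ?thesis by simp
          qed
          moreover have "card B \<le> (b + 1) * n" using True by (simp add: light_def)
          then have "real (card B) \<le> real ((b + 1) * n)" by (rule of_nat_mono)
          then have "card B \<le> real (b + 1) * n" by (simp only: of_nat_mult)
          moreover have "2 ^ j * (9 / 16) ^ Suc r = x + x * (1 / 8)"
            by (simp add: x_def Suc)
          ultimately show ?thesis using free[OF uv(1)] free[OF uv(2)] True by simp
        qed
      qed
    qed
  qed
  then show ?thesis unfolding light_def by blast
qed

text \<open>The walk gets about four plans per pair. PhantomBreaker's edges during all of them are
  kept to at most \<open>n / 12\<close>, the gap between the degree \<open>n / 4\<close> at the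
  start and the degree \<open>n / 3\<close> that a repair tolerates.\<close>

lemma secures_endgame:
  fixes \<epsilon> :: real
  assumes "0 < \<epsilon>"
  shows "\<exists>\<gamma>::real. 0 < \<gamma> \<and> \<gamma> \<le> 1 / 6 \<and> (\<exists>N0. \<forall>n\<ge>N0. \<forall>t E U. U \<subseteq> {..<n} \<longrightarrow> even (card U) \<longrightarrow> card U \<le> \<gamma> * n \<longrightarrow>
     has_matching E ({..<n} - U) \<longrightarrow>
     secures a b n t E (\<lambda>B. of_bool ((\<forall>u\<in>U. 4 * deg B u \<le> n) \<and> card B \<le> b * n) - \<epsilon>))"
proof -
  obtain T N0 where secures: "\<forall>n\<ge>N0. \<forall>r j t E U. U \<subseteq> {..<n} \<longrightarrow> card U = 2 * j \<longrightarrow>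
     6 * card U \<le> n \<longrightarrow> has_matching E ({..<n} - U) \<longrightarrow>
     secures a b n t E (\<lambda>B. of_bool ((\<forall>u\<in>U. 3 * (deg B u + b * (T * r)) \<le> n)
        \<and> card B + b * (T * r) \<le> (b + 1) * n) - 2 ^ j * (9 / 16) ^ r)"
    using secures_repairs[of a b] by blast
  obtain R where R: "(9 / 16 :: real) ^ R < \<epsilon>"
    using real_arch_pow_inv[OF assms, of "9 / 16"] by auto
  \<comment> \<open>Half of the allowance \<open>n / 12\<close> goes to the \<open>4 * j\<close>
    plans and is controlled by \<open>K\<close>; the other half goes to the \<open>R\<close> plans
    and is controlled by the lower bound on \<open>n\<close>.\<close>
  define K where "K = 48 * (b * T + 1)"
  define \<gamma> :: real where "\<gamma> = min (1 / 6) (1 / K)"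
  have K: "0 < real K" unfolding K_def by (simp only: of_nat_0_less_iff) simp
  then have \<gamma>: "0 < \<gamma>" "\<gamma> \<le> 1 / 6" by (simp_all add: \<gamma>_def)
  have main: "secures a b n t E (\<lambda>B. of_bool ((\<forall>u\<in>U. 4 * deg B u \<le> n) \<and> card B \<le> b * n) - \<epsilon>)"
    if n: "N0 + 24 * (b * (T * R)) \<le> n" and U: "U \<subseteq> {..<n}" "even (card U)" "card U \<le> \<gamma> * n"
      "has_matching E ({..<n} - U)" for n t E U
  proof -
    obtain j where j: "card U = 2 * j" using U(2) by blast
    \<comment> \<open>Four plans per pair cancel the factor \<open>2 ^ j\<close>, because
      \<open>2 * (9 / 16) ^ 4 < 1\<close>; the remaining \<open>R\<close> push the error below
      \<open>\<epsilon>\<close>.\<close>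
    define r where "r = 4 * j + R"
    have "\<gamma> * n \<le> 1 / 6 * n" using \<gamma> by (intro mult_right_mono) auto
    then have U6: "6 * card U \<le> n" using U(3) by linarith
    have "\<gamma> * n \<le> 1 / K * n" by (intro mult_right_mono) (auto simp: \<gamma>_def)
    then have "real (card U) \<le> n / K" using U(3) by simp
    then have "real (card U) * real K \<le> n" using K by (simp only: pos_le_divide_eq)
    then have "real (card U * K) \<le> n" by simp
    then have "card U * K \<le> n" by (simp only: of_nat_le_iff)
    then have "48 * (card U * (b * T)) \<le> n" by (simp add: K_def algebra_simps)
    then have r: "12 * (b * (T * r)) \<le> n"
      using n by (simp add: r_def j algebra_simps)
    have "secures a b n t E (\<lambda>B. of_bool ((\<forall>u\<in>U. 3 * (deg B u + b * (T * r)) \<le> n)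
        \<and> card B + b * (T * r) \<le> (b + 1) * n) - 2 ^ j * (9 / 16) ^ r)"
      by (rule secures[rule_format]) (use n U U6 j in auto)
    then show ?thesis
    proof (rule secures_mono)
      fix B :: "edge set"
      have "(2::real) ^ j * (9 / 16) ^ r = (2 * (9 / 16) ^ 4) ^ j * (9 / 16) ^ R"
        by (simp add: r_def power_add power_mult power_mult_distrib)
      also have "\<dots> \<le> 1 * (9 / 16) ^ R"
        by (intro mult_right_mono power_le_one) (auto simp: power_divide)
      finally have "(2::real) ^ j * (9 / 16) ^ r \<le> \<epsilon>" using R by simp
      moreover have "3 * (deg B u + b * (T * r)) \<le> n" if "4 * deg B u \<le> n" for u
      proof -
        have "3 * (d + q) \<le> n" if "4 * d \<le> n" "12 * q \<le> n" for d q :: nat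
          using that by simp
        then show ?thesis using that r by blast
      qed
      moreover have "card B + b * (T * r) \<le> (b + 1) * n" if "card B \<le> b * n"
        using that r by simp
      ultimately show "of_bool ((\<forall>u\<in>U. 4 * deg B u \<le> n) \<and> card B \<le> b * n) - \<epsilon>
         \<le> of_bool ((\<forall>u\<in>U. 3 * (deg B u + b * (T * r)) \<le> n)
        \<and> card B + b * (T * r) \<le> (b + 1) * n) - 2 ^ j * (9 / 16) ^ r"
        by (auto simp: of_bool_def)
    qed
  qed
  show ?thesis
    by (rule exI[of _ \<gamma>], intro conjI \<gamma> exI[of _ "N0 + 24 * (b * (T * R))"] allI impI main)
qed

section \<open>Matching without failures\<close>

lemma sum_deg_le:
  assumes "finite R" "B \<subseteq> board n"
  shows "(\<Sum>w\<in>R. deg B w) \<le> 2 * card B"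
proof -
  have fin: "finite B" using assms(2) finite_subset finite_board by blast
  have "(\<Sum>w\<in>R. deg B w) = (\<Sum>w\<in>R. \<Sum>e\<in>B. of_bool (w \<in> e))"
    using fin by (simp add: deg_def Int_def)
  also have "\<dots> = (\<Sum>e\<in>B. \<Sum>w\<in>R. of_bool (w \<in> e))" by (rule sum.swap)
  also have "\<dots> \<le> (\<Sum>e\<in>B. 2)"
  proof (rule sum_mono)
    fix e assume "e \<in> B"
    then have e: "finite e" "card e = 2" using assms(2) by (auto simp: board_def nsets_def)
    have "(\<Sum>w\<in>R. of_bool (w \<in> e)) = card (R \<inter> e)" using assms(1) by (simp add: Int_def)
    also have "\<dots> \<le> card e" using e by (intro card_mono) auto
    finally show "(\<Sum>w\<in>R. of_bool (w \<in> e)) \<le> (2::nat)" using e by simp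
  qed
  finally show ?thesis by simp
qed

lemma deg_Diff:
  assumes "B \<subseteq> B'" "finite B'"
  shows "deg B' w = deg B w + deg (B' - B) w"
proof -
  have "B' \<inter> {e. w \<in> e} = (B \<inter> {e. w \<in> e}) \<union> ((B' - B) \<inter> {e. w \<in> e})" using assms by auto
  then show ?thesis
    unfolding deg_def using assms(2) finite_subset[OF assms]
    by (simp only:) (rule card_Un_disjoint, auto)
qed

lemma sum_deg_Diff_le:
  assumes "finite R" "B \<subseteq> B'" "B' \<subseteq> board n" "card B' \<le> card B + c"
  shows "(\<Sum>w\<in>R. deg (B' - B) w) \<le> 2 * c"
proof -
  have fin: "finite B'" using assms(3) finite_subset finite_board by blast
  have "(\<Sum>w\<in>R. deg (B' - B) w) \<le> 2 * card (B' - B)"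
    by (rule sum_deg_le[OF assms(1)]) (use assms in auto)
  also have "card (B' - B) \<le> c"
    using assms fin finite_subset[OF assms(2) fin] by (simp add: card_Diff_subset)
  finally show ?thesis by simp
qed

text \<open>The solution of \<open>w (d + 1) = w d - z * (w d + A)\<close> with \<open>w 0 = 1\<close>, cut off at 0. It vanishes at some
  \<open>d\<close>, but as long as it is positive, what PhantomBreaker takes from the smallest weight in one move
  is made up for by the chance that Maker matches that vertex.\<close>

definition wt :: "real \<Rightarrow> real \<Rightarrow> nat \<Rightarrow> real" where
  "wt A z d = max 0 ((1 + A) * (1 - z) ^ d - A)"

lemma wt_0 [simp]: "wt A z 0 = 1" by (simp add: wt_def)

lemma wt_nonneg [simp]: "0 \<le> wt A z d" by (simp add: wt_def)

lemma wt_le_1: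
  assumes "0 \<le> A" "0 \<le> z" "z \<le> 1"
  shows "wt A z d \<le> 1"
proof -
  have "(1 - z) ^ d \<le> 1" using assms by (intro power_le_one) auto
  then have "(1 + A) * (1 - z) ^ d \<le> (1 + A) * 1" using assms by (intro mult_left_mono) auto
  then show ?thesis by (simp add: wt_def)
qed

text \<open>At weight \<open>w\<close> one unit of degree costs
  \<open>z (w + A) = w z (1 + A / w)\<close>, and \<open>Z\<close> bounds \<open>1 / w\<close>.
  Bernoulli's inequality extends this to \<open>j\<close> units at once.\<close>

lemma wt_step:
  assumes "0 \<le> A" "0 \<le> z" "z \<le> 1" "1 \<le> Z * wt A z d"
  shows "wt A z d * (1 - j * (z * (1 + A * Z))) \<le> wt A z (d + j)"
proof -
  define y where "y = wt A z d"
  have "y \<noteq> 0" using assms(4) by (auto simp: y_def)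
  then have y: "(1 + A) * (1 - z) ^ d = y + A" "0 < y" by (auto simp: y_def wt_def max_def split: if_splits)
  have "1 - j * z \<le> (1 - z) ^ j"
    using Bernoulli_inequality[of "- z" j] assms by simp
  then have "(y + A) * (1 - j * z) \<le> (y + A) * (1 - z) ^ j"
    using y assms by (intro mult_left_mono) auto
  also have "\<dots> = (1 + A) * (1 - z) ^ (d + j)" by (simp add: y(1)[symmetric] power_add)
  finally have 1: "(y + A) * (1 - j * z) - A \<le> wt A z (d + j)" by (simp add: wt_def)
  have "A * 1 \<le> A * (Z * y)" using assms unfolding y_def by (intro mult_left_mono) auto
  then have "j * z * A \<le> j * z * (A * (Z * y))" using assms by (intro mult_left_mono) auto
  then show ?thesis using 1 unfolding y_def[symmetric] by (simp add: algebra_simps)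
qed

text \<open>Since \<open>1 - z \<le> exp (- z)\<close>, the weight has died out beyond degree
  \<open>L / z\<close>; the condition on \<open>L\<close> ties \<open>A\<close> to the largest
  degree that is tolerated.\<close>

lemma wt_pos_imp_small:
  assumes "0 \<le> A" "z \<le> 1" "1 + A \<le> A * exp L" "0 < wt A z d"
  shows "z * d \<le> L"
proof -
  have "A < (1 + A) * (1 - z) ^ d" using assms(4) by (auto simp: wt_def max_def split: if_splits)
  also have "\<dots> \<le> (1 + A) * exp (- z) ^ d"
    using assms exp_ge_add_one_self[of "- z"] by (intro mult_left_mono power_mono) auto
  also have "\<dots> \<le> A * exp L * exp (- z) ^ d" using assms by (intro mult_right_mono) auto
  also have "\<dots> = A * exp (L - z * d)" by (simp add: exp_of_nat_mult[symmetric] mult_exp_exp mult.commute)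
  finally have "A * 1 < A * exp (L - z * d)" by simp
  then have "1 < exp (L - z * d)" using assms(1) by (simp only: mult_less_cancel_left)
  then show ?thesis by simp
qed

section \<open>The product potential and its change in one step\<close>

definition pot :: "real \<Rightarrow> real \<Rightarrow> nat set \<Rightarrow> edge set \<Rightarrow> real" where
  "pot A z R B = (\<Prod>w\<in>R. wt A z (deg B w))"

lemma pot_nonneg [simp]: "0 \<le> pot A z R B"
  unfolding pot_def by (intro prod_nonneg) auto

text \<open>At most \<open>b\<close> new edges raise the degrees by at most \<open>2 b\<close> in
  total. By the Weierstrass product inequality the relative losses at most add up, however the edges
  are distributed.\<close>

lemma pot_reply:
  assumes R: "finite R" and B: "B \<subseteq> B'" "B' \<subseteq> board n" "card B' \<le> card B + b"
    and par: "0 \<le> A" "0 \<le> z" "z \<le> 1" "0 \<le> Z"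
    and Z: "\<And>w. w \<in> R \<Longrightarrow> 1 \<le> Z * wt A z (deg B w)"
  shows "pot A z R B * (1 - 2 * real b * (z * (1 + A * Z))) \<le> pot A z R B'"
proof (cases "2 * real b * (z * (1 + A * Z)) \<le> 1")
  case False
  then have "pot A z R B * (1 - 2 * real b * (z * (1 + A * Z))) \<le> 0"
    by (intro mult_nonneg_nonpos) auto
  then show ?thesis using pot_nonneg order_trans by blast
next
  case True
  define c where "c = z * (1 + A * Z)"
  have c: "0 \<le> c" using par by (simp add: c_def)
  define j where "j w = deg (B' - B) w" for w
  have fin: "finite B'" using B(2) finite_subset finite_board by blast
  have sum_j: "(\<Sum>w\<in>R. j w) \<le> 2 * b" unfolding j_def by (rule sum_deg_Diff_le[OF R B])
  have "(\<Sum>w\<in>R. real (j w) * c) = real (\<Sum>w\<in>R. j w) * c" by (simp add: sum_distrib_right)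
  also have "\<dots> \<le> real (2 * b) * c" using sum_j c by (intro mult_right_mono of_nat_mono)
  finally have sum_jc: "(\<Sum>w\<in>R. real (j w) * c) \<le> 2 * real b * c" by simp
  have jc: "0 \<le> real (j w) * c \<and> real (j w) * c \<le> 1" if "w \<in> R" for w
  proof -
    have "real (j w) * c \<le> (\<Sum>w\<in>R. real (j w) * c)"
      using that R c by (intro member_le_sum) auto
    then show ?thesis using sum_jc True c by (simp add: c_def)
  qed
  have "1 - 2 * real b * c \<le> 1 - (\<Sum>w\<in>R. real (j w) * c)" using sum_jc by simp
  also have "\<dots> \<le> (\<Prod>w\<in>R. 1 - real (j w) * c)"
    by (rule Weierstrass_prod_ineq) (use jc in auto)
  finally have "pot A z R B * (1 - 2 * real b * c) \<le> pot A z R B * (\<Prod>w\<in>R. 1 - real (j w) * c)"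
    by (intro mult_left_mono) auto
  also have "\<dots> = (\<Prod>w\<in>R. wt A z (deg B w) * (1 - real (j w) * c))"
    by (simp add: pot_def prod.distrib)
  also have "\<dots> \<le> pot A z R B'"
    unfolding pot_def
  proof (rule prod_mono)
    fix w assume w: "w \<in> R"
    have "wt A z (deg B w) * (1 - real (j w) * c) \<le> wt A z (deg B w + j w)"
      unfolding c_def by (rule wt_step) (use par Z w in auto)
    then show "0 \<le> wt A z (deg B w) * (1 - real (j w) * c) \<and>
        wt A z (deg B w) * (1 - real (j w) * c) \<le> wt A z (deg B' w)"
      using jc[OF w] deg_Diff[OF B(1) fin, of w] by (simp add: j_def)
  qed
  finally show ?thesis by (simp add: c_def)
qed

text \<open>Removing a matched pair divides the product by two weights that are at most 1. Only the
  gain at \<open>v\<close> is credited: each of the at least \<open>card R - 1 - deg B v\<close>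
  free edges at \<open>v\<close> gains a factor \<open>1 / W v\<close>. Pairs owned by
  PhantomBreaker contribute nothing.\<close>

lemma pot_remove_pairs:
  assumes R: "finite R" "v \<in> R" and B: "finite B"
    and W: "\<And>w. w \<in> R \<Longrightarrow> 0 < W w \<and> W w \<le> (1::real)"
  shows "(\<Prod>w\<in>R. W w) * (real (card R choose 2) - card B
        + (1 / W v - 1) * (real (card R) - 1 - deg B v))
      \<le> (\<Sum>e\<in>nsets R 2 - B. \<Prod>w\<in>R-e. W w)"
proof -
  define F where "F = nsets R 2 - B"
  define Q where "Q = (\<Prod>w\<in>R. W w)"
  have finF: "finite F" using R by (simp add: F_def finite_imp_finite_nsets)
  have Q: "0 < Q" unfolding Q_def using W by (intro prod_pos) auto
  have Wv: "0 < W v" "W v \<le> 1" using W R by auto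
  have "card (R - {v}) \<le> card {x\<in>R-{v}. {v, x} \<notin> B} + deg B v"
    using R B by (intro card_le_free_deg) auto
  moreover have "card {x\<in>R-{v}. {v, x} \<notin> B} = card ((\<lambda>x. {v, x}) ` {x\<in>R-{v}. {v, x} \<notin> B})"
    by (intro card_image[symmetric] inj_on_edge)
  moreover have "\<dots> \<le> card {e\<in>F. v \<in> e}"
    using R by (intro card_mono finite_subset[OF _ finF]) (auto simp: F_def)
  moreover have "card (R - {v}) = card R - 1" "card R \<ge> 1"
    using R by (auto simp: Suc_le_eq card_gt_0_iff)
  ultimately have star: "real (card R) - 1 - deg B v \<le> card {e\<in>F. v \<in> e}" by linarith
  have "card (nsets R 2) \<le> card F + card B"
    using card_mono[of "F \<union> B" "nsets R 2"] finF B card_Un_le[of F B] by (fastforce simp: F_def)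
  then have cardF: "real (card R choose 2) - card B \<le> card F"
    using card_nsets[of R 2] by simp
  have each: "Q * (1 + (if v \<in> e then 1 / W v - 1 else 0)) \<le> (\<Prod>w\<in>R-e. W w)" if "e \<in> F" for e
  proof -
    have e: "e \<subseteq> R" "finite e" using that by (auto simp: F_def nsets_def)
    have split: "Q = (\<Prod>w\<in>R-e. W w) * (\<Prod>w\<in>e. W w)"
      unfolding Q_def using R e by (metis prod.subset_diff)
    have pos: "0 < (\<Prod>w\<in>R-e. W w)" using W by (intro prod_pos) auto
    have "(\<Prod>w\<in>e. W w) \<le> (if v \<in> e then W v else 1)"
    proof (cases "v \<in> e")
      case True
      then have "(\<Prod>w\<in>e. W w) = W v * (\<Prod>w\<in>e-{v}. W w)" using e by (simp add: prod.remove)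
      also have "\<dots> \<le> W v * 1"
        using W e Wv by (intro mult_left_mono prod_le_1) (auto simp: less_imp_le subset_iff)
      finally show ?thesis using True by simp
    next
      case False
      then show ?thesis using W e by (auto intro!: prod_le_1 simp: less_imp_le subset_iff)
    qed
    then have "(\<Prod>w\<in>e. W w) * (1 + (if v \<in> e then 1 / W v - 1 else 0)) \<le>
        (if v \<in> e then W v else 1) * (1 + (if v \<in> e then 1 / W v - 1 else 0))"
      using Wv by (intro mult_right_mono) auto
    also have "\<dots> = 1" using Wv by simp
    finally have "(\<Prod>w\<in>R-e. W w) * ((\<Prod>w\<in>e. W w) * (1 + (if v \<in> e then 1 / W v - 1 else 0)))
        \<le> (\<Prod>w\<in>R-e. W w) * 1" using pos by (intro mult_left_mono) auto
    then show ?thesis by (simp add: split mult.assoc)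
  qed
  have "real (card R choose 2) - card B + (1 / W v - 1) * (real (card R) - 1 - deg B v)
     \<le> card F + (1 / W v - 1) * card {e\<in>F. v \<in> e}"
    using cardF star Wv by (intro add_mono mult_left_mono) auto
  also have "\<dots> = (\<Sum>e\<in>F. 1 + (if v \<in> e then 1 / W v - 1 else 0))"
    using finF by (simp add: sum.distrib sum.inter_filter[symmetric])
  finally have "Q * (real (card R choose 2) - card B + (1 / W v - 1) * (real (card R) - 1 - deg B v))
     \<le> Q * (\<Sum>e\<in>F. 1 + (if v \<in> e then 1 / W v - 1 else 0))"
    using Q by (intro mult_left_mono) auto
  also have "\<dots> \<le> (\<Sum>e\<in>F. \<Prod>w\<in>R-e. W w)"
    unfolding sum_distrib_left by (intro sum_mono each)
  finally show ?thesis by (simp add: Q_def F_def)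
qed

text \<open>Without failures \<open>t\<close> attempts have matched \<open>2 t\<close> vertices,
  hence \<open>n = card U + 2 * t\<close>. On average a step keeps at least the share
  \<open>\<rho>\<close> of the potential; in the condition on \<open>\<rho>\<close>,
  \<open>Z\<close> stands for the reciprocal of the smallest weight. The cut-off
  \<open>\<xi>\<close> keeps \<open>Z\<close> bounded. The halving pays for the endgame, which wins
  with probability at least 1/2 when no degree is large.\<close>

lemma secures_without_failure:
  fixes A z \<rho> \<xi> :: real
  assumes "a > 0"
    and final: "\<And>t E U. U \<subseteq> {..<n} \<Longrightarrow> card U = M \<Longrightarrow> has_matching E ({..<n} - U) \<Longrightarrow>
      secures a b n t E (\<lambda>B. of_bool ((\<forall>u\<in>U. 4 * deg B u \<le> n) \<and> card B \<le> b * n) - 1 / 2)"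
    and par: "0 < A" "0 \<le> z" "z \<le> 1" "0 < \<xi>" "0 \<le> \<rho>" "\<rho> \<le> 1"
    and small: "\<And>d. 0 < wt A z d \<Longrightarrow> 4 * d \<le> n \<and> 2 * d + 1 \<le> M"
    and \<rho>: "\<And>Z m. 1 \<le> Z \<Longrightarrow> Z \<le> 1 / \<xi> \<Longrightarrow> M < m \<Longrightarrow> m \<le> n \<Longrightarrow>
      2 * real b * (z * (1 + A * Z)) \<le> 1 \<and>
      \<rho> * (m choose 2) \<le> (1 - 2 * real b * (z * (1 + A * Z))) *
        (real (m choose 2) - b * real n + (Z - 1) * ((real m - 1) / 2))"
    and U: "U \<subseteq> {..<n}" "card U = M + 2 * S" "n = card U + 2 * t" "has_matching E ({..<n} - U)"
  shows "secures a b n t E (\<lambda>B. (\<rho> ^ S * pot A z U B - \<xi>) / 2)"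
  using U
proof (induction S arbitrary: U t E)
  case 0
  have "secures a b n t E (\<lambda>B. of_bool ((\<forall>u\<in>U. 4 * deg B u \<le> n) \<and> card B \<le> b * n) - 1 / 2)"
    by (rule final) (use 0 in auto)
  then show ?case
  proof (rule secures_mono[OF secures_max])
    fix B assume B: "admissible a b n t E B"
    have "t div a \<le> t" by simp
    then have "t div a \<le> n" using 0(3) by linarith
    then have "b * (t div a) \<le> b * n" by (rule mult_le_mono2)
    then have cardB: "card B \<le> b * n" using B unfolding admissible_def by linarith
    show "(\<rho> ^ 0 * pot A z U B - \<xi>) / 2
      \<le> max 0 (of_bool ((\<forall>u\<in>U. 4 * deg B u \<le> n) \<and> card B \<le> b * n) - 1 / 2)"
    proof (cases "\<forall>u\<in>U. 4 * deg B u \<le> n")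
      case True
      have "pot A z U B \<le> 1" unfolding pot_def using par by (intro prod_le_1) (auto intro: wt_le_1)
      then show ?thesis using True cardB par(4) by simp
    next
      case False
      then obtain u where u: "u \<in> U" "\<not> 4 * deg B u \<le> n" by blast
      \<comment> \<open>A vertex of degree above \<open>n / 4\<close> has weight 0 and annihilates
        the whole potential.\<close>
      then have "wt A z (deg B u) = 0" using small[of "deg B u"] wt_nonneg[of A z "deg B u"] by linarith
      then have "pot A z U B = 0" unfolding pot_def using u 0(1) finite_subset by (intro prod_zero) auto
      then show ?thesis using False par(4) by simp
    qed
  qed
next
  case (Suc S)
  define m where "m = card U"
  have finU: "finite U" using Suc.prems(1) finite_subset by blast
  have m: "m \<le> n" "2 \<le> m" "M < m" using Suc.prems by (auto simp: m_def)
  define A' where "A' = nsets U 2"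
  have cardA': "card A' = m choose 2" unfolding A'_def m_def by (rule card_nsets)
  have finA': "finite A'" using finU by (simp add: A'_def finite_imp_finite_nsets)
  \<comment> \<open>A failed attempt is written off with value 0.\<close>
  define \<psi> where "\<psi> e s B = (if s then max 0 ((\<rho> ^ S * pot A z (U - e) B - \<xi>) / 2) else 0)" for e s B
  show ?case
  proof (rule secures_move[where A=A' and \<psi>=\<psi>])
    show "A' \<subseteq> board n" unfolding A'_def board_def by (rule nsets_mono[OF Suc.prems(1)])
    show "A' \<noteq> {}" using m cardA' by (auto simp: zero_less_binomial_iff)
    fix e s assume e: "e \<in> A'"
    show "secures a b n (Suc t) (if s then insert e E else E) (\<psi> e s)"
    proof (cases s)
      case False
      then show ?thesis by (intro secures_lose) (simp add: \<psi>_def)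
    next
      case True
      from e obtain u v where uv: "u \<in> U" "v \<in> U" "u \<noteq> v" "e = {u, v}"
        by (auto simp: A'_def nsets_2_eq)
      have W: "{..<n} - (U - e) = insert u (insert v ({..<n} - U))"
        using uv Suc.prems(1) by auto
      have "has_matching (insert e E) (insert u (insert v ({..<n} - U)))"
        by (rule has_matching_add_edge)
           (use uv has_matching_mono[OF Suc.prems(4)] in auto)
      moreover have "card (U - e) = card U - 2"
        using uv finU by (simp add: card_Diff_subset)
      ultimately have "secures a b n (Suc t) (insert e E) (\<lambda>B. (\<rho> ^ S * pot A z (U - e) B - \<xi>) / 2)"
        by (intro Suc.IH) (use Suc.prems W in auto)
      from secures_max[OF this] show ?thesis using True by (simp add: \<psi>_def[abs_def])
    qed
  next
    fix B r assume B: "admissible a b n t E B"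
      and r: "\<And>e. e \<in> A' \<Longrightarrow> reply a b n t E B e (r e)"
    have Bn: "B \<subseteq> board n" "finite B" using B finite_subset[OF _ finite_board] by (auto simp: admissible_def)
    have "t div a \<le> t" by simp
    then have "t div a \<le> n" using Suc.prems(3) by linarith
    then have "b * (t div a) \<le> b * n" by (rule mult_le_mono2)
    then have "card B \<le> b * n" using B unfolding admissible_def by linarith
    then have "real (card B) \<le> real (b * n)" by (rule of_nat_mono)
    then have cardB: "real (card B) \<le> b * real n" by simp
    show "real (card A') * ((\<rho> ^ Suc S * pot A z U B - \<xi>) / 2) \<le> (\<Sum>e\<in>A'. \<psi> e (e \<notin> B) (r e))"
    proof (cases "pot A z U B \<le> \<xi>")
      case True
      have "\<rho> ^ Suc S * pot A z U B \<le> 1 * pot A z U B"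
        using par by (intro mult_right_mono power_le_one) auto
      then have "real (card A') * ((\<rho> ^ Suc S * pot A z U B - \<xi>) / 2) \<le> 0"
        using True by (intro mult_nonneg_nonpos) auto
      also have "0 \<le> (\<Sum>e\<in>A'. \<psi> e (e \<notin> B) (r e))" by (intro sum_nonneg) (simp add: \<psi>_def)
      finally show ?thesis .
    next
      case False
      define W where "W w = wt A z (deg B w)" for w
      define Q where "Q = pot A z U B"
      have W1: "W w \<le> 1" for w unfolding W_def using par by (intro wt_le_1) auto
      \<comment> \<open>All weights are at most 1, so each is at least the product and thus above
        \<open>\<xi>\<close>.\<close>
      have W\<xi>: "\<xi> < W w" if "w \<in> U" for w
      proof -
        have "Q = W w * (\<Prod>w\<in>U-{w}. W w)"
          unfolding Q_def pot_def W_def using that finU by (simp add: prod.remove)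
        also have "\<dots> \<le> W w * 1"
          using W1 by (intro mult_left_mono prod_le_1) (auto simp: W_def)
        finally show ?thesis using False by (simp add: Q_def)
      qed
      have "U \<noteq> {}" using m by (auto simp: m_def)
      \<comment> \<open>The most endangered vertex: its weight bounds PhantomBreaker's relative gain
        through \<open>Z\<close>, and Maker's chance to match it supplies the term with
        \<open>Z - 1\<close>.\<close>
      then obtain v where v: "v \<in> U" "\<And>w. w \<in> U \<Longrightarrow> W v \<le> W w"
        using ex_is_arg_min_if_finite[OF finU, of W] by (auto simp: is_arg_min_linorder)
      define Z where "Z = 1 / W v"
      have Wv: "0 < W v" using W\<xi>[OF v(1)] par by linarith
      have Z: "1 \<le> Z" "Z \<le> 1 / \<xi>"
        using Wv W1[of v] W\<xi>[OF v(1)] par(4) by (auto simp: Z_def field_simps)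
      define \<beta> where "\<beta> = 2 * real b * (z * (1 + A * Z))"
      define G where "G = real (m choose 2) - b * real n + (Z - 1) * ((real m - 1) / 2)"
      have \<beta>: "\<beta> \<le> 1" and step: "\<rho> * (m choose 2) \<le> (1 - \<beta>) * G"
        using \<rho>[OF Z m(3,1)] by (auto simp: \<beta>_def G_def)
      have dv: "2 * deg B v + 1 \<le> m" using small[of "deg B v"] Wv m(3) by (simp add: W_def)
      have Q0: "0 \<le> Q" by (simp add: Q_def)
      have "\<rho> * (m choose 2) * Q \<le> (1 - \<beta>) * G * Q" using step Q0 by (rule mult_right_mono)
      also have "\<dots> = (1 - \<beta>) * (Q * G)" by simp
      also have "\<dots> \<le> (1 - \<beta>) * (\<Sum>e\<in>A'-B. pot A z (U - e) B)"
      proof (rule mult_left_mono)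
        have "real (2 * deg B v + 1) \<le> real m" using dv by (rule of_nat_mono)
        then have "(real m - 1) / 2 \<le> real (card U) - 1 - deg B v" by (simp add: m_def)
        then have "(Z - 1) * ((real m - 1) / 2) \<le> (Z - 1) * (real (card U) - 1 - deg B v)"
          using Z by (intro mult_left_mono) auto
        then have "G \<le> real (card U choose 2) - card B + (1 / W v - 1) * (real (card U) - 1 - deg B v)"
          using cardB unfolding G_def Z_def[symmetric] m_def by (intro add_mono diff_mono order_refl)
        then have "Q * G \<le> Q * (real (card U choose 2) - card B + (1 / W v - 1) * (real (card U) - 1 - deg B v))"
          using Q0 by (rule mult_left_mono)
        also have "\<dots> \<le> (\<Sum>e\<in>nsets U 2 - B. \<Prod>w\<in>U-e. W w)"
          unfolding Q_def pot_def W_def[symmetric]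
          by (rule pot_remove_pairs[OF finU v(1) Bn(2)]) (use W1 W\<xi> par(4) in \<open>auto intro: less_trans\<close>)
        finally show "Q * G \<le> (\<Sum>e\<in>A'-B. pot A z (U - e) B)"
          by (simp add: A'_def pot_def W_def)
      qed (use \<beta> in simp)
      also have "\<dots> \<le> (\<Sum>e\<in>A'-B. pot A z (U - e) (r e))"
        unfolding sum_distrib_left
      proof (rule sum_mono)
        fix e assume "e \<in> A' - B"
        then have e: "B \<subseteq> r e" "r e \<subseteq> board n" "card (r e) \<le> card B + b"
          using r[of e] by (auto simp: reply_def admissible_def)
        have "pot A z (U - e) B * (1 - \<beta>) \<le> pot A z (U - e) (r e)"
          unfolding \<beta>_def
        proof (rule pot_reply[OF _ e])
          fix w assume "w \<in> U - e"
          then have "Z * W v \<le> Z * W w" using v(2) Z by (intro mult_left_mono) auto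
          then show "1 \<le> Z * wt A z (deg B w)" using Wv by (simp add: Z_def W_def)
        qed (use finU par Z in auto)
        then show "(1 - \<beta>) * pot A z (U - e) B \<le> pot A z (U - e) (r e)" by (simp add: mult.commute)
      qed
      finally have main: "\<rho> * (m choose 2) * Q \<le> (\<Sum>e\<in>A'-B. pot A z (U - e) (r e))" .
      have 1: "real (card (A' - B)) * \<xi> \<le> real (card A') * \<xi>"
        using finA' par by (intro mult_right_mono of_nat_mono card_mono) auto
      have 2: "\<rho> ^ S * (\<rho> * (m choose 2) * Q) \<le> \<rho> ^ S * (\<Sum>e\<in>A'-B. pot A z (U - e) (r e))"
        using main par by (intro mult_left_mono) auto
      have "real (card A') * ((\<rho> ^ Suc S * Q - \<xi>) / 2)
          = (\<rho> ^ S * (\<rho> * (m choose 2) * Q) - real (card A') * \<xi>) / 2"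
        by (simp add: cardA' right_diff_distrib mult_ac)
      also have "\<dots> \<le> (\<rho> ^ S * (\<Sum>e\<in>A'-B. pot A z (U - e) (r e)) - real (card (A' - B)) * \<xi>) / 2"
        by (intro divide_right_mono diff_mono 1 2) simp
      also have "\<dots> = (\<Sum>e\<in>A'-B. (\<rho> ^ S * pot A z (U - e) (r e) - \<xi>) / 2)"
        by (simp add: sum_divide_distrib[symmetric] sum_subtractf sum_distrib_left)
      also have "\<dots> \<le> (\<Sum>e\<in>A'-B. \<psi> e (e \<notin> B) (r e))"
        by (intro sum_mono) (simp add: \<psi>_def)
      also have "\<dots> \<le> (\<Sum>e\<in>A'. \<psi> e (e \<notin> B) (r e))"
        using finA' by (intro sum_mono2) (auto simp: \<psi>_def)
      finally show ?thesis by (simp add: Q_def)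
    qed
  qed
qed

section \<open>Choice of constants for arbitrary \<open>b\<close>\<close>

lemma real_choose_2: "real (m choose 2) = real m * (real m - 1) / 2"
proof (cases m)
  case (Suc k)
  have "even (m * (m - 1))" by (simp add: Suc)
  then have "2 * (m choose 2) = m * (m - 1)" by (simp add: choose_two)
  then have "real (2 * (m choose 2)) = real (m * (m - 1))" by (simp only:)
  then show ?thesis by (simp add: Suc algebra_simps)
qed simp

text \<open>PhantomBreaker's term \<open>Z / 2\<close> is outweighed by Maker's gain
  \<open>Z - 1\<close> when \<open>Z\<close> is large. The loss per step is therefore
  \<open>O(1 / n)\<close> uniformly in \<open>Z\<close>, and a product of \<open>n\<close> such
  factors stays away from 0.\<close>

lemma one_step_decay:
  fixes n Z C K :: real
  assumes "0 < n" "1 \<le> Z" "0 \<le> C" "0 \<le> K" "2 * (K + Z / 2) \<le> n"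
  shows "1 - (1 + C + K) / n \<le> (1 - (K + Z / 2) / n) * (1 - C / n + (Z - 1) / n)"
proof -
  define \<beta> where "\<beta> = (K + Z / 2) / n"
  define x where "x = (Z - 1 - C) / n"
  have \<beta>: "0 \<le> \<beta>" "\<beta> \<le> 1 / 2" using assms by (auto simp: \<beta>_def field_simps)
  have x: "1 - C / n + (Z - 1) / n = 1 + x" by (simp add: x_def diff_divide_distrib)
  have "1 - (1 + C + K) / n \<le> 1 + x - \<beta> - \<beta> * x"
  proof (cases "0 \<le> x")
    case True
    then have "\<beta> * x \<le> 1 / 2 * x" using \<beta> by (intro mult_right_mono) auto
    moreover have "x / 2 - \<beta> + (1 + C + K) / n = (1 + C) / (2 * n)"
      using assms(1) by (simp add: x_def \<beta>_def field_simps)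
    moreover have "0 \<le> (1 + C) / (2 * n)" using assms by simp
    ultimately show ?thesis by linarith
  next
    case False
    then have "\<beta> * x \<le> 0" using \<beta> by (intro mult_nonneg_nonpos) auto
    moreover have "x - \<beta> + (1 + C + K) / n = Z / (2 * n)"
      using assms(1) by (simp add: x_def \<beta>_def field_simps)
    moreover have "0 \<le> Z / (2 * n)" using assms by simp
    ultimately show ?thesis by linarith
  qed
  also have "\<dots> = (1 - \<beta>) * (1 + x)" by (simp add: algebra_simps)
  finally show ?thesis unfolding x \<beta>_def .
qed

lemma even_approx:
  fixes x :: real
  assumes "0 \<le> x"
  obtains M :: nat where "even M" "M \<le> x" "x - 2 \<le> M"
proof
  let ?M = "2 * nat \<lfloor>x / 2\<rfloor>"
  show "even ?M" by simp
  have "0 \<le> \<lfloor>x / 2\<rfloor>" using assms by simp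
  then have "real ?M = 2 * of_int \<lfloor>x / 2\<rfloor>" by simp
  then show "?M \<le> x" "x - 2 \<le> ?M" by linarith+
qed

lemma win_with_positive_probability:
  assumes "a > 0" "b > 0"
  shows "\<exists>c::real. 0 < c \<and> (\<exists>N0. \<forall>n\<ge>N0. even n \<longrightarrow> (\<exists>\<phi>. secures a b n 0 {} \<phi> \<and> c \<le> \<phi> {}))"
proof -
  have "(0::real) < 1 / 2" by simp
  from secures_endgame[OF this, of a b] obtain \<gamma> :: real and N0 where \<gamma>: "0 < \<gamma>" "\<gamma> \<le> 1 / 6"
    and final: "\<forall>n\<ge>N0. \<forall>t E U. U \<subseteq> {..<n} \<longrightarrow> even (card U) \<longrightarrow> card U \<le> \<gamma> * n \<longrightarrow>
      has_matching E ({..<n} - U) \<longrightarrow>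
      secures a b n t E (\<lambda>B. of_bool ((\<forall>u\<in>U. 4 * deg B u \<le> n) \<and> card B \<le> b * n) - 1 / 2)"
    by blast
  define h where "h = \<gamma> / 8"
  \<comment> \<open>Makes \<open>4 * b * \<kappa>\<close> the quadratic Taylor term of
    \<open>exp (\<kappa> * h)\<close>. With the next constant this gives
    \<open>1 + A \<le> A * exp (\<kappa> * h)\<close>, so that weights vanish above degree
    \<open>h * n\<close>.\<close>
  define \<kappa> where "\<kappa> = 8 * b / h\<^sup>2"
  \<comment> \<open>For \<open>z = \<kappa> / n\<close> the cost \<open>2 * b * z * A * Z\<close>
    becomes \<open>Z / (2 n)\<close>, half of the leading part \<open>Z / n\<close> of Maker's
    gain.\<close>
  define A where "A = 1 / (4 * b * \<kappa>)"
  \<comment> \<open>More than \<open>M\<close> unmatched vertices span at least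
    \<open>\<gamma>^2 n^2 / 8\<close> pairs, of which PhantomBreaker's at most \<open>b * n\<close>
    edges are a share of at most \<open>C / n\<close>.\<close>
  define C where "C = 8 * b / \<gamma>\<^sup>2"
  define C2 where "C2 = 1 + C + 2 * b * \<kappa>"
  \<comment> \<open>A quarter of the limit of \<open>(1 - C2 / n) ^ n\<close>, so that
    \<open>\<rho> ^ S\<close> is at least \<open>2 * \<xi>\<close> for large
    \<open>n\<close>.\<close>
  define \<xi> where "\<xi> = exp (- C2) / 4"
  have h: "0 < h" using \<gamma> by (simp add: h_def)
  have b: "0 < real b" using assms by simp
  have \<kappa>: "0 < \<kappa>" using h b by (simp add: \<kappa>_def)
  have A: "0 < A" using \<kappa> b by (simp add: A_def)
  have C: "0 \<le> C" by (simp add: C_def)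
  have C2: "0 \<le> C2" using C \<kappa> b by (simp add: C2_def)
  have \<xi>: "0 < \<xi>" by (simp add: \<xi>_def)
  have "4 * b * \<kappa> = (\<kappa> * h)\<^sup>2 / 2"
    using h by (simp add: \<kappa>_def power2_eq_square field_simps)
  moreover have "0 \<le> \<kappa> * h" using \<kappa> h by simp
  ultimately have "1 + 4 * b * \<kappa> \<le> 1 + \<kappa> * h + (\<kappa> * h)\<^sup>2 / 2" by linarith
  also have "\<dots> \<le> exp (\<kappa> * h)" using \<kappa> h by (intro exp_lower_Taylor_quadratic) simp
  finally have "A * (1 + 4 * b * \<kappa>) \<le> A * exp (\<kappa> * h)" using A by (intro mult_left_mono) auto
  moreover have "A * (1 + 4 * b * \<kappa>) = 1 + A" using \<kappa> b by (simp add: A_def field_simps)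
  ultimately have expA: "1 + A \<le> A * exp (\<kappa> * h)" by simp
  have "(\<lambda>n. (1 + (- C2) / real n) ^ n) \<longlonglongrightarrow> exp (- C2)" by (rule tendsto_exp_limit_sequentially)
  then have "\<forall>\<^sub>F n in sequentially. exp (- C2) / 2 < (1 + (- C2) / real n) ^ n"
    by (rule order_tendstoD) simp
  moreover have "\<forall>\<^sub>F n in sequentially. x \<le> real n" for x
    using filterlim_real_sequentially by (auto simp: filterlim_at_top)
  from this[of "max (max (4 / \<gamma>) \<kappa>) (max C2 (2 * (2 * b * \<kappa> + 1 / \<xi>)))"]
  have "\<forall>\<^sub>F n in sequentially. max (max (4 / \<gamma>) \<kappa>) (max C2 (2 * (2 * b * \<kappa> + 1 / \<xi>))) \<le> real n" .
  ultimately have "\<forall>\<^sub>F n in sequentially. exp (- C2) / 2 < (1 + (- C2) / real n) ^ n \<and>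
      max (max (4 / \<gamma>) \<kappa>) (max C2 (2 * (2 * b * \<kappa> + 1 / \<xi>))) \<le> real n \<and> N0 \<le> n"
    using eventually_ge_at_top[of N0] by eventually_elim auto
  then obtain N1 where N1: "\<And>n. n \<ge> N1 \<Longrightarrow> exp (- C2) / 2 < (1 + (- C2) / real n) ^ n \<and>
      max (max (4 / \<gamma>) \<kappa>) (max C2 (2 * (2 * b * \<kappa> + 1 / \<xi>))) \<le> real n \<and> N0 \<le> n"
    unfolding eventually_sequentially by blast
  have "\<exists>\<phi>. secures a b n 0 {} \<phi> \<and> \<xi> / 2 \<le> \<phi> {}" if n: "n \<ge> N1" "even n" for n
  proof -
    have lim: "exp (- C2) / 2 < (1 + (- C2) / real n) ^ n" and N0: "N0 \<le> n"
      and big: "4 / \<gamma> \<le> n" "\<kappa> \<le> n" "C2 \<le> n" "2 * (2 * b * \<kappa> + 1 / \<xi>) \<le> n"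
      using N1[OF n(1)] by auto
    have n0: "0 < real n" using big(2) \<kappa> by linarith
    have \<gamma>n: "4 \<le> \<gamma> * n" using big(1) \<gamma> by (simp add: field_simps)
    then have "0 \<le> \<gamma> * n" by simp
    then obtain M :: nat where M: "even M" "M \<le> \<gamma> * n" "\<gamma> * n - 2 \<le> M" by (rule even_approx)
    define z where "z = \<kappa> / n"
    define \<rho> where "\<rho> = 1 - C2 / n"
    have z: "0 \<le> z" "z \<le> 1"
      using \<kappa> big(2) n0 by (simp_all add: z_def divide_le_eq_1_pos)
    have \<rho>: "0 \<le> \<rho>" "\<rho> \<le> 1"
      using C2 big(3) n0 by (simp_all add: \<rho>_def divide_le_eq_1_pos)
    have "\<gamma> * n \<le> 1 / 6 * n" using \<gamma> by (intro mult_right_mono) auto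
    then have "real M \<le> real n" using M by linarith
    then have Mn: "M \<le> n" by simp
    then obtain k where k: "n = M + k" using le_Suc_ex by blast
    then have "even k" using M(1) n(2) by simp
    then obtain S where "k = 2 * S" by (rule evenE)
    then have S: "n = M + 2 * S" using k by simp
    have "secures a b n 0 {} (\<lambda>B. (\<rho> ^ S * pot A z {..<n} B - \<xi>) / 2)"
    proof (rule secures_without_failure[where M=M])
      fix t E U
      assume "U \<subseteq> {..<n}" "card U = M" "has_matching E ({..<n} - U)"
      then show "secures a b n t E (\<lambda>B. of_bool ((\<forall>u\<in>U. 4 * deg B u \<le> n) \<and> card B \<le> b * n) - 1 / 2)"
        using final N0 M by auto
    next
      fix d assume "0 < wt A z d"
      then have "z * d \<le> \<kappa> * h" using wt_pos_imp_small[of A z "\<kappa> * h" d] A z expA by simp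
      then have "\<kappa> * d \<le> \<kappa> * (h * n)" using n0 by (simp add: z_def field_simps)
      then have "real d \<le> h * n" using \<kappa> by simp
      then have d: "8 * real d \<le> \<gamma> * n" by (simp add: h_def)
      then have "real (4 * d) \<le> real n" "real (2 * d + 1) \<le> real M"
        using \<open>\<gamma> * n \<le> 1 / 6 * n\<close> M(3) \<gamma>n by auto
      then show "4 * d \<le> n \<and> 2 * d + 1 \<le> M" by (simp only: of_nat_le_iff)
    next
      fix Z :: real and m :: nat
      assume Z: "1 \<le> Z" "Z \<le> 1 / \<xi>" and m: "M < m" "m \<le> n"
      define K where "K = 2 * b * \<kappa>"
      have \<beta>: "2 * real b * (z * (1 + A * Z)) = (K + Z / 2) / n"
        using b \<kappa> n0 by (simp add: z_def A_def K_def field_simps)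
      have K: "0 \<le> K" using b \<kappa> by (simp add: K_def)
      have KZ: "2 * (K + Z / 2) \<le> n" using big(4) Z(1,2) by (simp add: K_def)
      define N2 where "N2 = real (m choose 2)"
      have m1: "\<gamma> * n / 2 \<le> real m - 1" using m M(3) \<gamma>n by linarith
      have mp: "0 < real m" using m by simp
      have "\<gamma> * n / 2 * (\<gamma> * n / 2) \<le> real m * (real m - 1)"
        using m1 \<gamma>n by (intro mult_mono) auto
      then have N2: "\<gamma>\<^sup>2 * n\<^sup>2 / 8 \<le> N2"
        by (simp add: N2_def real_choose_2 power2_eq_square field_simps)
      have "b * real n = \<gamma>\<^sup>2 * n\<^sup>2 / 8 * (C / n)"
        using n0 \<gamma> by (simp add: C_def power2_eq_square)
      also have "\<dots> \<le> N2 * (C / n)" using N2 C by (intro mult_right_mono) auto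
      finally have 1: "b * real n \<le> N2 * (C / n)" .
      have "N2 * ((Z - 1) / n) \<le> N2 * ((Z - 1) / m)"
        using Z m mp n0 by (intro mult_left_mono divide_left_mono) (auto simp: N2_def)
      also have "\<dots> = (Z - 1) * ((real m - 1) / 2)"
        using mp by (simp add: N2_def real_choose_2 field_simps)
      finally have 2: "N2 * ((Z - 1) / n) \<le> (Z - 1) * ((real m - 1) / 2)" .
      have distr: "p * (1 - x + y) * w = p * (w - w * x + w * y)" for p x y w :: real
        by (simp add: algebra_simps)
      have \<beta>1: "(K + Z / 2) / n \<le> 1" using KZ K Z n0 by (simp add: field_simps)
      have "\<rho> \<le> (1 - (K + Z / 2) / n) * (1 - C / n + (Z - 1) / n)"
        using one_step_decay[OF n0 Z(1) C K KZ] by (simp add: \<rho>_def C2_def K_def)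
      then have "\<rho> * N2 \<le> (1 - (K + Z / 2) / n) * (1 - C / n + (Z - 1) / n) * N2"
        by (rule mult_right_mono) (simp add: N2_def)
      also have "\<dots> = (1 - (K + Z / 2) / n) * (N2 - N2 * (C / n) + N2 * ((Z - 1) / n))"
        by (rule distr)
      also have "\<dots> \<le> (1 - (K + Z / 2) / n) * (N2 - b * real n + (Z - 1) * ((real m - 1) / 2))"
        by (intro mult_left_mono add_mono diff_mono order_refl 1 2) (use \<beta>1 in simp)
      finally show "2 * real b * (z * (1 + A * Z)) \<le> 1 \<and>
        \<rho> * (m choose 2) \<le> (1 - 2 * real b * (z * (1 + A * Z))) *
        (real (m choose 2) - b * real n + (Z - 1) * ((real m - 1) / 2))"
        using \<beta>1 unfolding \<beta> N2_def by blast
    qed (use assms A z \<rho> \<xi> S in auto)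
    moreover have "pot A z {..<n} {} = 1" by (simp add: pot_def deg_def)
    moreover have "\<xi> / 2 \<le> (\<rho> ^ S * 1 - \<xi>) / 2"
    proof -
      have "2 * \<xi> \<le> \<rho> ^ n" using lim by (simp add: \<rho>_def \<xi>_def)
      also have "\<dots> \<le> \<rho> ^ S" using \<rho> S by (intro power_decreasing) auto
      finally show ?thesis by simp
    qed
    ultimately show ?thesis by (intro exI[of _ "\<lambda>B. (\<rho> ^ S * pot A z {..<n} B - \<xi>) / 2"]) simp
  qed
  then show ?thesis using \<xi> by (intro exI[of _ "\<xi> / 2"]) auto
qed

section \<open>Matching with immediate repairs\<close>

text \<open>Each vertex is avoided by \<open>card U - 1 choose 2\<close> pairs. Removing a uniformly
  random pair thus preserves the average of \<open>d\<close> in expectation.\<close>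

lemma sum_remove_pairs:
  fixes d :: "nat \<Rightarrow> real"
  assumes "finite U"
  shows "(\<Sum>e\<in>nsets U 2. \<Sum>w\<in>U-e. d w) = real (card U - 1 choose 2) * (\<Sum>w\<in>U. d w)"
proof -
  have fin: "finite (nsets U 2)" using assms by (rule finite_imp_finite_nsets)
  have "(\<Sum>e\<in>nsets U 2. \<Sum>w\<in>U-e. d w) = (\<Sum>e\<in>nsets U 2. \<Sum>w\<in>U. if w \<notin> e then d w else 0)"
    using assms by (intro sum.cong refl sum.mono_neutral_cong_left) auto
  also have "\<dots> = (\<Sum>w\<in>U. \<Sum>e\<in>nsets U 2. if w \<notin> e then d w else 0)" by (rule sum.swap)
  also have "\<dots> = (\<Sum>w\<in>U. real (card U - 1 choose 2) * d w)"
  proof (intro sum.cong refl)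
    fix w assume w: "w \<in> U"
    have "(\<Sum>e\<in>nsets U 2. if w \<notin> e then d w else 0) = (\<Sum>e\<in>nsets (U - {w}) 2. d w)"
      using fin by (intro sum.mono_neutral_cong_right) (auto simp: nsets_def)
    also have "\<dots> = real (card (nsets (U - {w}) 2)) * d w" by simp
    also have "card (nsets (U - {w}) 2) = card U - 1 choose 2"
      using w assms by (simp add: card_nsets)
    finally show "(\<Sum>e\<in>nsets U 2. if w \<notin> e then d w else 0) = real (card U - 1 choose 2) * d w" .
  qed
  finally show ?thesis by (simp add: sum_distrib_left)
qed

lemma sum_deg_reply_le:
  assumes "finite R" "B \<subseteq> B'" "B' \<subseteq> board n" "card B' \<le> card B + c"
  shows "(\<Sum>w\<in>R. real (deg B' w)) \<le> (\<Sum>w\<in>R. real (deg B w)) + 2 * real c"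
proof -
  have fin: "finite B'" using assms(3) finite_subset finite_board by blast
  have "(\<Sum>w\<in>R. real (deg B' w)) = (\<Sum>w\<in>R. real (deg B w)) + real (\<Sum>w\<in>R. deg (B' - B) w)"
    by (simp add: deg_Diff[OF assms(2) fin] sum.distrib)
  moreover have "real (\<Sum>w\<in>R. deg (B' - B) w) \<le> real (2 * c)"
    using sum_deg_Diff_le[OF assms] by (rule of_nat_mono)
  ultimately show ?thesis by simp
qed

text \<open>Edges in \<open>F\<close> do not meet \<open>W\<close> and cannot block the way from
  \<open>u\<close> into it. The edges that make attempts fail are thus missing where they would
  obstruct a repair.\<close>

lemma card_free_ge:
  assumes "finite W" "u \<notin> W" "B \<subseteq> board n" "F \<subseteq> B" "\<And>e. e \<in> F \<Longrightarrow> e \<inter> W = {}"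
  shows "card W + card F \<le> card {x\<in>W. {u, x} \<notin> B} + card B"
proof -
  have fin: "finite B" using assms(3) finite_subset finite_board by blast
  have "card W \<le> card {x\<in>W. {u, x} \<notin> B - F} + deg (B - F) u"
    by (rule card_le_free_deg) (use assms fin in auto)
  then have "card W + card F \<le> card {x\<in>W. {u, x} \<notin> B - F} + deg (B - F) u + card F"
    by simp
  also have "deg (B - F) u \<le> card (B - F)" unfolding deg_def using fin by (intro card_mono) auto
  also have "card (B - F) = card B - card F"
    using assms(4) fin by (simp add: card_Diff_subset finite_subset)
  also have "{x\<in>W. {u, x} \<notin> B - F} = {x\<in>W. {u, x} \<notin> B}" using assms(5) by fastforce
  finally show ?thesis using card_mono[OF fin assms(4)] by linarith
qed

text \<open>In \<open>\<phi>\<close>, \<open>f\<close> counts the failures so far;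
  \<open>\<epsilon>\<^sub>2\<close> pays for the endgame, \<open>\<kappa>\<close> for the risk of
  each of the \<open>S\<close> remaining steps, \<open>\<mu>\<close> for each failure. The degree
  sum times \<open>M / card U\<close> predicts the degree sum when \<open>M\<close> vertices are
  left, the logarithm bounds what future edges add to it, and \<open>4 / n\<close> is Markov's
  inequality for a degree above \<open>n / 4\<close>. A failure delays the matching by at most
  \<open>T\<close> attempts, hence the condition on \<open>t\<close>.\<close>

lemma secures_with_repairs:
  fixes \<eta> \<epsilon>\<^sub>2 \<epsilon>\<^sub>3 \<mu> \<kappa> :: real
  assumes ab: "a > 0" "b \<le> 2 * a" and M: "2 \<le> M"
    and final: "\<And>t E U. U \<subseteq> {..<n} \<Longrightarrow> card U = M \<Longrightarrow> has_matching E ({..<n} - U) \<Longrightarrow>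
      secures a b n t E (\<lambda>B. of_bool ((\<forall>u\<in>U. 4 * deg B u \<le> n) \<and> card B \<le> b * n) - \<epsilon>\<^sub>2)"
    and plan: "\<And>E W u v. has_matching E W \<Longrightarrow> W \<subseteq> {..<n} \<Longrightarrow> u < n \<Longrightarrow> v < n \<Longrightarrow> u \<noteq> v \<Longrightarrow>
      u \<notin> W \<Longrightarrow> v \<notin> W \<Longrightarrow> plan b n (\<lambda>E. has_matching E (insert u (insert v W))) T E
        (\<lambda>B. if card B \<le> 2 * real n \<and> \<eta> / 2 * n \<le> card {x\<in>W. {u, x} \<notin> B}
             \<and> \<eta> / 2 * n \<le> card {x\<in>W. {v, x} \<notin> B} then \<epsilon>\<^sub>3 else 1)"
    and par: "0 < \<mu>" "0 \<le> \<epsilon>\<^sub>2" "0 \<le> \<epsilon>\<^sub>3" "0 \<le> \<kappa>" "\<eta> \<le> 1"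
    and big: "2 * real T / \<mu> + 2 \<le> \<eta> * n / 2" "8 * real b * real T \<le> \<mu> * n"
    and \<kappa>: "\<And>m. M < m \<Longrightarrow> m \<le> n \<Longrightarrow>
      \<eta> * n \<le> \<kappa> * (m choose 2) \<and> 2 * real n * (\<epsilon>\<^sub>3 + 2 * \<mu>) \<le> \<kappa> * (m choose 2)"
  defines "\<phi> \<equiv> \<lambda>S f U B. 1 - \<epsilon>\<^sub>2 - \<kappa> * real S - \<mu> * real f
      - 4 / n * ((\<Sum>u\<in>U. real (deg B u)) * (M / card U) + 2 * real b * real M * ln (card U / M))"
  assumes U: "U \<subseteq> {..<n}" "card U = M + 2 * S" "2 * t + card U \<le> n + 2 * T * f"
      "has_matching E ({..<n} - U)"
  shows "secures a b n t E (\<phi> S f U)"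
  using U
proof (induction S arbitrary: f t E U)
  have \<phi>_le: "\<phi> S f U B \<le> 1 - \<mu> * f - 4 / n * ((\<Sum>u\<in>U. real (deg B u)) * (M / card U))" "\<phi> S f U B \<le> 1"
    if "M \<le> card U" for S f U B
  proof -
    have "0 \<le> ln (card U / M)" using that M by (intro ln_ge_zero) simp
    then have "0 \<le> 4 / n * (2 * real b * real M * ln (card U / M))" by simp
    moreover have "0 \<le> 4 / n * ((\<Sum>u\<in>U. real (deg B u)) * (M / card U))"
      by (intro mult_nonneg_nonneg sum_nonneg divide_nonneg_nonneg) auto
    moreover have "0 \<le> \<kappa> * real S" "0 \<le> \<mu> * real f" using par by auto
    ultimately have "\<phi> S f U B \<le> 1 - \<mu> * f - 4 / n * ((\<Sum>u\<in>U. real (deg B u)) * (M / card U)) \<and> \<phi> S f U B \<le> 1"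
      using par(2) unfolding \<phi>_def distrib_left by linarith
    then show "\<phi> S f U B \<le> 1 - \<mu> * f - 4 / n * ((\<Sum>u\<in>U. real (deg B u)) * (M / card U))" "\<phi> S f U B \<le> 1"
      by blast+
  qed
  \<comment> \<open>Once \<open>\<mu> * f\<close> reaches 1 the bound is worthless, so fewer than
    \<open>1 / \<mu>\<close> failures matter and their total delay is bounded.\<close>
  have Tf: "2 * real T * real f + 2 \<le> \<eta> * n / 2" if "\<mu> * real f < 1" for f
  proof -
    have "real f \<le> 1 / \<mu>" using that par(1) by (simp add: field_simps)
    then have "2 * real T * real f \<le> 2 * real T * (1 / \<mu>)" by (intro mult_left_mono) auto
    then show ?thesis using big(1) by simp
  qed
  have \<eta>n: "\<eta> * n \<le> n" using par(5) mult_right_mono[of \<eta> 1 n] by simp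
  {
    case 0
    show ?case
    proof (cases "\<mu> * real f < 1")
      case False
      then have "\<phi> 0 f U B \<le> 0" for B
      proof -
        have "0 \<le> 4 / n * ((\<Sum>u\<in>U. real (deg B u)) * (M / card U))"
          by (intro mult_nonneg_nonneg sum_nonneg divide_nonneg_nonneg) auto
        then show ?thesis using \<phi>_le(1)[of U 0 f B] 0(2) False by simp
      qed
      then show ?thesis by (intro secures_lose)
    next
      case True
      have "secures a b n t E (\<lambda>B. of_bool ((\<forall>u\<in>U. 4 * deg B u \<le> n) \<and> card B \<le> b * n) - \<epsilon>\<^sub>2)"
        by (rule final) (use 0 in auto)
      then show ?thesis
      proof (rule secures_mono[OF secures_max])
        fix B assume B: "admissible a b n t E B"
        have "real (2 * T * f) \<le> n" using Tf[OF True] \<eta>n by simp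
        then have "2 * T * f \<le> n" by (simp only: of_nat_le_iff)
        then have "t \<le> n" using 0(3) by linarith
        moreover have "t div a \<le> t" by simp
        ultimately have "t div a \<le> n" by linarith
        then have "b * (t div a) \<le> b * n" by (rule mult_le_mono2)
        then have cardB: "card B \<le> b * n" using B unfolding admissible_def by linarith
        show "\<phi> 0 f U B \<le> max 0 (of_bool ((\<forall>u\<in>U. 4 * deg B u \<le> n) \<and> card B \<le> b * n) - \<epsilon>\<^sub>2)"
        proof (cases "\<forall>u\<in>U. 4 * deg B u \<le> n")
          case True
          have "0 \<le> 4 / n * ((\<Sum>u\<in>U. real (deg B u)) * (M / card U) + 2 * real b * real M * ln (card U / M))"
            using 0(2) M by (intro mult_nonneg_nonneg add_nonneg_nonneg sum_nonneg) auto
          moreover have "0 \<le> \<mu> * real f" using par by simp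
          ultimately have "\<phi> 0 f U B \<le> 1 - \<epsilon>\<^sub>2" by (simp add: \<phi>_def)
          then show ?thesis using True cardB by simp
        next
          case False
          then obtain u where u: "u \<in> U" "n < 4 * deg B u" by (auto simp: not_le)
          have n0: "0 < real n" using U(1) u 0(1) by (cases n) auto
          have finU: "finite U" using 0(1) finite_subset by blast
          have "real n \<le> 4 * real (deg B u)" using u(2) by linarith
          also have "\<dots> \<le> 4 * (\<Sum>u\<in>U. real (deg B u))"
            using u(1) finU by (intro mult_left_mono member_le_sum) auto
          finally have "1 \<le> 4 / n * (\<Sum>u\<in>U. real (deg B u))" using n0 by (simp add: field_simps)
          moreover have "0 \<le> \<mu> * real f" using par by simp
          ultimately have "\<phi> 0 f U B \<le> 0"
            using \<phi>_le(1)[of U 0 f B] 0(2) M by simp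
          then show ?thesis by simp
        qed
      qed
    qed
  next
    case (Suc S)
    define m where "m = card U"
    have finU: "finite U" using Suc.prems(1) finite_subset by blast
    have mn: "m \<le> n" using card_mono[of "{..<n}" U] Suc.prems(1) by (simp add: m_def)
    have m: "M + 2 \<le> m" "M < m" using Suc.prems by (auto simp: m_def)
    have n0: "0 < real n" using mn m by simp
    show ?case
    proof (cases "\<mu> * real f < 1")
      case False
      then have "\<phi> (Suc S) f U B \<le> 0" for B
      proof -
        have "0 \<le> 4 / n * ((\<Sum>u\<in>U. real (deg B u)) * (M / card U))"
          by (intro mult_nonneg_nonneg sum_nonneg divide_nonneg_nonneg) auto
        then show ?thesis using \<phi>_le(1)[of U "Suc S" f B] m False by (simp add: m_def)
      qed
      then show ?thesis by (intro secures_lose)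
    next
      case True
      define A where "A = nsets U 2"
      have cardA: "card A = m choose 2" unfolding A_def m_def by (rule card_nsets)
      have finA: "finite A" using finU by (simp add: A_def finite_imp_finite_nsets)
      define W where "W = {..<n} - U"
      have cardW: "card W = n - m"
        using Suc.prems(1) finU by (simp add: W_def m_def card_Diff_subset)
      define L where "L e B = (if card B \<le> 2 * real n \<and> (\<forall>u\<in>e. \<eta> / 2 * n \<le> card {x\<in>W. {u, x} \<notin> B})
        then \<epsilon>\<^sub>3 else 1)" for e B
      define g where "g e B = max 0 (\<phi> S (Suc f) (U - e) B)" for e B
      \<comment> \<open>If the repair plan fails, the game is given up, hence the price 1.\<close>
      define \<psi> where "\<psi> e s B = (if s then max 0 (\<phi> S f (U - e) B)
          else max 0 (low b n T (g e) B - 1 * min 1 (L e B)))" for e s B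
      have card_Ue: "card (U - e) = m - 2" "finite e" "e \<subseteq> U" if "e \<in> A" for e
        using that finU by (auto simp: A_def nsets_def m_def card_Diff_subset)
      show ?thesis
      proof (rule secures_move[where A=A and \<psi>=\<psi>])
        show "A \<subseteq> board n" unfolding A_def board_def by (rule nsets_mono[OF Suc.prems(1)])
        show "A \<noteq> {}" using m cardA by (auto simp: zero_less_binomial_iff)
        fix e s assume e: "e \<in> A"
        from e obtain u v where uv: "u \<in> U" "v \<in> U" "u \<noteq> v" "e = {u, v}"
          by (auto simp: A_def nsets_2_eq)
        have W': "{..<n} - (U - e) = insert u (insert v W)"
          using uv Suc.prems(1) by (auto simp: W_def)
        have cards: "card (U - e) = M + 2 * S" "card (U - e) + 2 = card U"
          using card_Ue[OF e] Suc.prems(2) m by (auto simp: m_def)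
        show "secures a b n (Suc t) (if s then insert e E else E) (\<psi> e s)"
        proof (cases s)
          case True
          have "has_matching (insert e E) (insert u (insert v W))"
            by (rule has_matching_add_edge)
               (use uv has_matching_mono[OF Suc.prems(4)] in \<open>auto simp: W_def\<close>)
          then have "secures a b n (Suc t) (insert e E) (\<phi> S f (U - e))"
            by (intro Suc.IH) (use Suc.prems W' cards in auto)
          from secures_max[OF this] show ?thesis using True by (simp add: \<psi>_def[abs_def])
        next
          case False
          have "secures a b n (Suc t) E (\<lambda>B. low b n T (g e) B - 1 * min 1 (if card B \<le> 2 * real n
             \<and> \<eta> / 2 * n \<le> card {x\<in>W. {u, x} \<notin> B}
             \<and> \<eta> / 2 * n \<le> card {x\<in>W. {v, x} \<notin> B} then \<epsilon>\<^sub>3 else 1))"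
          proof (rule plan_secures[OF plan])
            fix t' E' assume t': "t' \<le> Suc t + T" "E \<subseteq> E'" "has_matching E' (insert u (insert v W))"
            have "secures a b n t' E' (\<phi> S (Suc f) (U - e))"
              by (rule Suc.IH) (use Suc.prems W' cards t' in auto)
            from secures_max[OF this] show "secures a b n t' E' (g e)" by (simp add: g_def[abs_def])
          next
            fix t' E'
            have "g e B - 1 \<le> 0" for B using \<phi>_le(2)[of "U - e"] cards by (simp add: g_def)
            then show "secures a b n t' E' (\<lambda>B. g e B - 1)" by (intro secures_lose)
          qed (use uv Suc.prems(1,4) in \<open>auto simp: W_def\<close>)
          from secures_max[OF this] show ?thesis using False by (simp add: \<psi>_def[abs_def] L_def uv(4))
        qed
      next
        fix B r assume B: "admissible a b n t E B"
          and r: "\<And>e. e \<in> A \<Longrightarrow> reply a b n t E B e (r e)"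
        have Bn: "B \<subseteq> board n" "finite B" using B finite_subset[OF _ finite_board] by (auto simp: admissible_def)
        have re: "B \<subseteq> r e" "r e \<subseteq> board n" "card (r e) \<le> card B + b" "card (r e) \<le> b * (Suc t div a)"
          if "e \<in> A" for e using r[OF that] by (auto simp: reply_def admissible_def)
        \<comment> \<open>Here \<open>b \<le> 2 * a\<close> enters: \<open>k\<close> attempts bring
          PhantomBreaker at most as many edges as \<open>k\<close> successes match vertices.\<close>
        have half: "b * (k div a) \<le> 2 * k" for k
        proof -
          have "b * (k div a) \<le> 2 * a * (k div a)" using ab(2) by (rule mult_le_mono1)
          also have "\<dots> \<le> 2 * k" by (simp add: mult.assoc)
          finally show ?thesis .
        qed
        define D where "D = (\<Sum>u\<in>U. real (deg B u))"
        \<comment> \<open>The value after matching \<open>e\<close>, with \<open>b\<close> new edges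
          that count at both ends.\<close>
        define lin where "lin e = 1 - \<epsilon>\<^sub>2 - \<kappa> * S - \<mu> * f
          - 4 / n * (((\<Sum>u\<in>U-e. real (deg B u)) + 2 * real b) * (M / real (m - 2)) + 2 * real b * real M * ln (real (m - 2) / M))" for e
        have "M \<le> m - 2" "0 < m - 2" using m M by linarith+
        then have "real M \<le> real (m - 2)" "0 < real (m - 2)" by (simp_all only: of_nat_le_iff of_nat_0_less_iff)
        then have Mm: "0 \<le> M / real (m - 2)" "M / real (m - 2) \<le> 1"
          by (simp_all only: divide_le_eq_1_pos) (intro divide_nonneg_nonneg, auto)
        have \<phi>_ge: "lin e - \<mu> * i - 8 * real b * real k / n \<le> \<phi> S (f + i) (U - e) B'"
          if "e \<in> A" "B \<subseteq> B'" "B' \<subseteq> board n" "card B' \<le> card B + (b + b * k)" for e B' i k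
        proof -
          have "(\<Sum>u\<in>U-e. real (deg B' u)) \<le> (\<Sum>u\<in>U-e. real (deg B u)) + 2 * real (b + b * k)"
            by (rule sum_deg_reply_le) (use that finU in auto)
          then have "(\<Sum>u\<in>U-e. real (deg B' u)) * (M / real (m - 2))
              \<le> ((\<Sum>u\<in>U-e. real (deg B u)) + 2 * real (b + b * k)) * (M / real (m - 2))"
            using Mm by (intro mult_right_mono)
          also have "\<dots> = ((\<Sum>u\<in>U-e. real (deg B u)) + 2 * real b) * (M / real (m - 2)) + 2 * real b * real k * (M / real (m - 2))"
            by (simp add: algebra_simps)
          also have "2 * real b * real k * (M / real (m - 2)) \<le> 2 * real b * real k * 1"
            using Mm by (intro mult_left_mono) auto
          finally have "4 / n * ((\<Sum>u\<in>U-e. real (deg B' u)) * (M / real (m - 2)))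
             \<le> 4 / n * (((\<Sum>u\<in>U-e. real (deg B u)) + 2 * real b) * (M / real (m - 2)) + 2 * real b * real k)"
            by (intro mult_left_mono) auto
          then show ?thesis
            unfolding lin_def \<phi>_def card_Ue(1)[OF that(1)] by (simp add: distrib_left)
        qed
        have lin_le: "lin e \<le> 1" if "e \<in> A" for e
        proof -
          have "0 \<le> ln (real (m - 2) / M)" using m M by (intro ln_ge_zero) auto
          then have "0 \<le> 4 / n * (((\<Sum>u\<in>U-e. real (deg B u)) + 2 * real b) * (M / real (m - 2)) + 2 * real b * real M * ln (real (m - 2) / M))"
            using Mm by (intro mult_nonneg_nonneg add_nonneg_nonneg sum_nonneg) auto
          moreover have "0 \<le> \<kappa> * real S" "0 \<le> \<mu> * real f" using par by auto
          ultimately show ?thesis unfolding lin_def using par(2) by linarith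
        qed
        define N where "N = real (m choose 2)"
        have N: "N = real m * (real m - 1) / 2" unfolding N_def by (rule real_choose_2)
        \<comment> \<open>Averaging over \<open>e\<close> turns the degree sum \<open>D\<close> into
          \<open>D * (m - 2) / m\<close>, which the new weight \<open>M / (m - 2)\<close> converts
          back into \<open>D * (M / m)\<close>.\<close>
        have sum_lin: "N * (\<phi> (Suc S) f U B + \<kappa>) \<le> (\<Sum>e\<in>A. lin e)"
        proof -
          have "(\<Sum>e\<in>A. \<Sum>u\<in>U-e. real (deg B u)) = real (m - 1 choose 2) * D"
            unfolding A_def D_def m_def by (rule sum_remove_pairs[OF finU])
          also have "real (m - 1 choose 2) = N * (real (m - 2) / m)"
            using m by (simp add: N real_choose_2 of_nat_diff field_simps)
          finally have avg: "(\<Sum>e\<in>A. \<Sum>u\<in>U-e. real (deg B u)) = N * (real (m - 2) / m) * D" .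
          have gen: "(\<Sum>e\<in>A. (x e + c) * k) = ((\<Sum>e\<in>A. x e) + N * c) * k" for x and c k :: real
            by (simp add: sum_distrib_right[symmetric] sum.distrib cardA N_def)
          have "(\<Sum>e\<in>A. ((\<Sum>u\<in>U-e. real (deg B u)) + 2 * real b) * (M / real (m - 2)))
              = (N * (real (m - 2) / m) * D + N * (2 * real b)) * (M / real (m - 2))"
            unfolding gen avg ..
          also have "\<dots> = N * (D * (M / m) + 2 * real b * real M * (1 / real (m - 2)))"
          proof -
            have "(N * (k / x) * D + N * c) * (y / k) = N * (D * (y / x) + c * y * (1 / k))"
              if "k \<noteq> 0" for k x c y :: real
              using that by (simp add: distrib_right distrib_left add_divide_distrib mult_ac)
            then show ?thesis using \<open>0 < real (m - 2)\<close> by (metis less_irrefl)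
          qed
          finally have 1: "(\<Sum>e\<in>A. ((\<Sum>u\<in>U-e. real (deg B u)) + 2 * real b) * (M / real (m - 2)))
              = N * (D * (M / m) + 2 * real b * real M * (1 / real (m - 2)))" .
          have "(\<Sum>e\<in>A. lin e) = N * (1 - \<epsilon>\<^sub>2 - \<kappa> * S - \<mu> * f) - 4 / n * (N * (D * (M / m) + 2 * real b * real M * (1 / real (m - 2)))
              + N * (2 * real b * real M * ln (real (m - 2) / M)))"
            unfolding lin_def sum_subtractf sum_distrib_left[symmetric] sum.distrib 1
            by (simp add: cardA N_def algebra_simps)
          also have "\<dots> = N * (1 - \<epsilon>\<^sub>2 - \<kappa> * S - \<mu> * f - 4 / n * (D * (M / m)
              + 2 * real b * real M * (1 / real (m - 2) + ln (real (m - 2) / M))))"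
            by (simp add: algebra_simps)
          finally have 2: "(\<Sum>e\<in>A. lin e) = \<dots>" .
          \<comment> \<open>The drop of the logarithm from \<open>m\<close> to \<open>m - 2\<close>
            is at least \<open>2 / m \<ge> 1 / (m - 2)\<close> and pays for the new edges.\<close>
          have "1 / real (m - 2) + ln (real (m - 2) / M) \<le> ln (m / M)"
          proof -
            have "real (m - 2) = real m - 2" "4 \<le> real m" using m M by auto
            then have p: "0 < real (m - 2)" and "1 / real (m - 2) \<le> 1 - real (m - 2) / m"
              by (auto simp: field_simps)
            moreover have "ln (real (m - 2) / m) \<le> real (m - 2) / m - 1"
              using p by (intro ln_le_minus_one) auto
            moreover have "ln (real (m - 2) / m) = ln (real (m - 2) / M) - ln (m / M)"
              using p M by (simp add: ln_div)
            ultimately show ?thesis by linarith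
          qed
          then have "2 * real b * real M * (1 / real (m - 2) + ln (real (m - 2) / M)) \<le> 2 * real b * real M * ln (m / M)"
            by (intro mult_left_mono) auto
          then have "4 / n * (D * (M / m) + 2 * real b * real M * (1 / real (m - 2) + ln (real (m - 2) / M)))
            \<le> 4 / n * (D * (M / m) + 2 * real b * real M * ln (m / M))"
            by (rule mult_left_mono[OF add_left_mono]) simp
          then have "\<phi> (Suc S) f U B + \<kappa> \<le> 1 - \<epsilon>\<^sub>2 - \<kappa> * S - \<mu> * f - 4 / n * (D * (M / m)
              + 2 * real b * real M * (1 / real (m - 2) + ln (real (m - 2) / M)))"
            unfolding \<phi>_def D_def m_def by (simp add: algebra_simps)
          then show ?thesis unfolding 2 by (intro mult_left_mono) (auto simp: N_def)
        qed
        define F where "F = A \<inter> B"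
        have \<psi>_nonneg: "0 \<le> \<psi> e s B'" for e s B' by (simp add: \<psi>_def)
        have \<psi>_True: "lin e \<le> \<psi> e True (r e)" if "e \<in> A" for e
          using \<phi>_ge[OF that re(1,2)[OF that], of 0 0] re(3)[OF that] by (simp add: \<psi>_def)
        have loss: "(\<Sum>e\<in>F. lin e - \<psi> e False (r e)) \<le> \<kappa> * N"
        proof (cases "card F < \<eta> * n")
          case True
          \<comment> \<open>Few failing pairs: losing the game at every failure is
            affordable.\<close>
          have "(\<Sum>e\<in>F. lin e - \<psi> e False (r e)) \<le> (\<Sum>e\<in>F. 1)"
          proof (rule sum_mono)
            fix e assume "e \<in> F"
            then have "lin e \<le> 1" by (intro lin_le) (simp add: F_def)
            then show "lin e - \<psi> e False (r e) \<le> 1" using \<psi>_nonneg[of e False "r e"] by linarith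
          qed
          also have "\<dots> \<le> \<eta> * n" using True by simp
          also have "\<dots> \<le> \<kappa> * N" using \<kappa>[OF m(2) mn] by (simp add: N_def)
          finally show ?thesis .
        next
          case False
          \<comment> \<open>Many failing pairs: failures cannot be ignored, but now at least
            \<open>\<eta> n\<close> of PhantomBreaker's edges lie inside \<open>U\<close> and a
            repair finds room. It costs \<open>\<epsilon>\<^sub>3 + 2 * \<mu>\<close>, with one
            \<open>\<mu>\<close> for the counter and one for the degrees added during the
            plan.\<close>
          have 2: "2 * real T * real f + 2 \<le> \<eta> * n / 2" using Tf[OF True] by simp
          have "lin e - \<psi> e False (r e) \<le> \<epsilon>\<^sub>3 + 2 * \<mu>" if "e \<in> F" for e
          proof -
            have e: "e \<in> A" using that by (simp add: F_def)
            have finre: "finite (r e)" using re(2)[OF e] finite_subset finite_board by blast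
            have "card (r e) \<le> 2 * Suc t" using re(4)[OF e] half[of "Suc t"] by linarith
            then have "card (r e) + m \<le> n + 2 * T * f + 2" using Suc.prems(3) by (simp add: m_def)
            then have card_re: "card (r e) + m \<le> n + (2 * real T * real f + 2)"
              by (metis (mono_tags) of_nat_le_iff of_nat_add of_nat_mult of_nat_numeral add.assoc)
            have "\<eta> / 2 * n \<le> card {x\<in>W. {u, x} \<notin> r e}" if "u \<in> e" for u
            proof -
              \<comment> \<open>As \<open>card (r e)\<close> exceeds \<open>card W\<close> by at
                most \<open>\<eta> n / 2\<close>, at least \<open>\<eta> n / 2\<close> edges from
                \<open>u\<close> into \<open>W\<close> are free.\<close>
              have "card W + card F \<le> card {x\<in>W. {u, x} \<notin> r e} + card (r e)"
                by (rule card_free_ge)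
                   (use that card_Ue(3)[OF e] re[OF e] in \<open>auto simp: W_def F_def A_def nsets_def\<close>)
              then have "real (card W) + card F \<le> card {x\<in>W. {u, x} \<notin> r e} + real (card (r e))"
                by linarith
              moreover have "real (card W) = real n - m" using cardW mn by (simp add: of_nat_diff)
              ultimately show ?thesis using card_re False 2 by linarith
            qed
            moreover have "card (r e) \<le> 2 * real n" using card_re 2 \<eta>n n0 by linarith
            ultimately have L: "L e (r e) = \<epsilon>\<^sub>3" by (simp add: L_def)
            have "lin e - \<mu> - 8 * real b * real T / n \<le> low b n T (g e) (r e)"
            proof (rule low_ge[OF re(2)[OF e]])
              fix B' assume B': "r e \<subseteq> B'" "B' \<subseteq> board n" "card B' \<le> card (r e) + b * T"
              have "lin e - \<mu> * real 1 - 8 * real b * real T / n \<le> \<phi> S (f + 1) (U - e) B'"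
                by (rule \<phi>_ge[OF e _ B'(2)]) (use B' re(1,3)[OF e] in auto)
              then show "lin e - \<mu> - 8 * real b * real T / n \<le> g e B'" by (simp add: g_def)
            qed
            moreover have "8 * real b * real T / n \<le> \<mu>" using big(2) n0 by (simp add: pos_divide_le_eq)
            ultimately show ?thesis unfolding \<psi>_def L by auto
          qed
          then have "(\<Sum>e\<in>F. lin e - \<psi> e False (r e)) \<le> (\<Sum>e\<in>F. \<epsilon>\<^sub>3 + 2 * \<mu>)"
            by (intro sum_mono)
          also have "\<dots> = card F * (\<epsilon>\<^sub>3 + 2 * \<mu>)" by simp
          also have "\<dots> \<le> 2 * real n * (\<epsilon>\<^sub>3 + 2 * \<mu>)"
          proof (rule mult_right_mono)
            have "card F \<le> card B" unfolding F_def using Bn by (intro card_mono) auto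
            also have "\<dots> \<le> b * (t div a)" using B by (simp add: admissible_def)
            also have "\<dots> \<le> 2 * t" by (rule half)
            also have "\<dots> \<le> n + 2 * T * f" using Suc.prems(3) by linarith
            finally have "real (card F) \<le> real (n + 2 * T * f)" by (rule of_nat_mono)
            then have "real (card F) \<le> n + 2 * real T * real f" by simp
            then show "real (card F) \<le> 2 * real n" using 2 \<eta>n n0 by linarith
          qed (use par in simp)
          also have "\<dots> \<le> \<kappa> * N" using \<kappa>[OF m(2) mn] by (simp add: N_def)
          finally show ?thesis .
        qed
        have "N * \<phi> (Suc S) f U B \<le> (\<Sum>e\<in>A. lin e) - \<kappa> * N"
          using sum_lin by (simp add: algebra_simps)
        also have "(\<Sum>e\<in>A. lin e) = (\<Sum>e\<in>A-F. lin e) + (\<Sum>e\<in>F. lin e)"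
          using finA by (intro sum.subset_diff) (auto simp: F_def)
        also have "(\<Sum>e\<in>A-F. lin e) \<le> (\<Sum>e\<in>A-F. \<psi> e True (r e))"
          using \<psi>_True by (intro sum_mono) auto
        finally have "N * \<phi> (Suc S) f U B \<le> (\<Sum>e\<in>A-F. \<psi> e True (r e)) + (\<Sum>e\<in>F. \<psi> e False (r e))"
          using loss by (simp add: sum_subtractf)
        also have "\<dots> = (\<Sum>e\<in>A-F. \<psi> e (e \<notin> B) (r e)) + (\<Sum>e\<in>F. \<psi> e (e \<notin> B) (r e))"
          by (intro arg_cong2[where f="(+)"] sum.cong) (auto simp: F_def)
        also have "\<dots> = (\<Sum>e\<in>A. \<psi> e (e \<notin> B) (r e))"
          using finA by (intro sum.subset_diff[symmetric]) (auto simp: F_def)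
        finally show "real (card A) * \<phi> (Suc S) f U B \<le> (\<Sum>e\<in>A. \<psi> e (e \<notin> B) (r e))"
          by (simp add: N_def cardA)
      qed
    qed
  }
qed

section \<open>Choice of constants for \<open>b \<le> 2 a\<close>\<close>

lemma ln_le_2_sqrt:
  assumes "0 < (x::real)"
  shows "ln x \<le> 2 * sqrt x"
proof -
  have "ln x = ln (sqrt x * sqrt x)" using assms by simp
  also have "\<dots> = 2 * ln (sqrt x)" using assms by (simp only: ln_mult_pos real_sqrt_gt_zero mult_2)
  also have "ln (sqrt x) \<le> sqrt x" using ln_le_minus_one[of "sqrt x"] assms by simp
  finally show ?thesis by simp
qed

lemma win_with_high_probability:
  fixes \<epsilon> :: real
  assumes ab: "a > 0" "b > 0" "b \<le> 2 * a" and \<epsilon>: "0 < \<epsilon>" "\<epsilon> \<le> 1"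
  shows "\<exists>N0. \<forall>n\<ge>N0. even n \<longrightarrow> (\<exists>\<phi>. secures a b n 0 {} \<phi> \<and> 1 - \<epsilon> \<le> \<phi> {})"
proof -
  define \<epsilon>2 where "\<epsilon>2 = \<epsilon> / 4"
  have "0 < \<epsilon>2" using \<epsilon> by (simp add: \<epsilon>2_def)
  from secures_endgame[OF this, of a b] obtain \<gamma>0 :: real and N0 where \<gamma>0: "0 < \<gamma>0" "\<gamma>0 \<le> 1 / 6"
    and final: "\<forall>n\<ge>N0. \<forall>t E U. U \<subseteq> {..<n} \<longrightarrow> even (card U) \<longrightarrow> card U \<le> \<gamma>0 * n \<longrightarrow>
      has_matching E ({..<n} - U) \<longrightarrow>
      secures a b n t E (\<lambda>B. of_bool ((\<forall>u\<in>U. 4 * deg B u \<le> n) \<and> card B \<le> b * n) - \<epsilon>2)"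
    by blast
  have b: "0 < real b" using ab by simp
  \<comment> \<open>Solves \<open>8 * b * (2 * y) = \<epsilon> / 4\<close>; the choice of
    \<open>\<gamma>\<close> then ensures \<open>sqrt (2 * \<gamma>) \<le> y\<close>.\<close>
  define y where "y = \<epsilon> / (64 * b)"
  have y: "0 < y" using \<epsilon> b by (simp add: y_def)
  define \<gamma> where "\<gamma> = min \<gamma>0 (y\<^sup>2 / 2)"
  have \<gamma>: "0 < \<gamma>" "\<gamma> \<le> \<gamma>0" "\<gamma> \<le> 1 / 6" "2 * \<gamma> \<le> y\<^sup>2" using \<gamma>0 y by (auto simp: \<gamma>_def)
  \<comment> \<open>The left side bounds the logarithmic term of the value at the start; it vanishes
    with \<open>\<gamma>\<close>, which is why few vertices are left to the endgame.\<close>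
  have ln: "8 * b * \<gamma> * ln (2 / \<gamma>) \<le> \<epsilon> / 4"
  proof -
    have "\<gamma> * ln (2 / \<gamma>) \<le> \<gamma> * (2 * sqrt (2 / \<gamma>))"
      using \<gamma>(1) by (intro mult_left_mono ln_le_2_sqrt) auto
    also have "\<gamma> * sqrt (2 / \<gamma>) = sqrt (2 * \<gamma>)"
    proof -
      have "\<gamma> * sqrt (2 / \<gamma>) = sqrt (\<gamma>\<^sup>2) * sqrt (2 / \<gamma>)" using \<gamma>(1) by simp
      also have "\<dots> = sqrt (\<gamma>\<^sup>2 * (2 / \<gamma>))" by (rule real_sqrt_mult[symmetric])
      also have "\<gamma>\<^sup>2 * (2 / \<gamma>) = 2 * \<gamma>" using \<gamma>(1) by (simp add: power2_eq_square)
      finally show ?thesis .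
    qed
    then have "\<gamma> * (2 * sqrt (2 / \<gamma>)) = 2 * sqrt (2 * \<gamma>)" by simp
    also have "sqrt (2 * \<gamma>) \<le> y" using \<gamma> y by (intro real_le_lsqrt) auto
    finally have "8 * b * (\<gamma> * ln (2 / \<gamma>)) \<le> 8 * b * (2 * y)" by (intro mult_left_mono) auto
    also have "\<dots> = \<epsilon> / 4" using b by (simp add: y_def)
    finally show ?thesis by (simp add: mult.assoc)
  qed
  \<comment> \<open>With at least \<open>\<gamma>^2 n^2 / 8\<close> pairs, a loss of
    \<open>\<epsilon> / (2 n)\<close> per step allows \<open>\<epsilon> \<gamma>^2 n / 16\<close> in
    the sum over pairs. Both constants keep the two kinds of failure losses below that.\<close>
  define \<mu> where "\<mu> = \<epsilon> * \<gamma>\<^sup>2 / 384"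
  define \<eta> where "\<eta> = \<epsilon> * \<gamma>\<^sup>2 / 128"
  have \<mu>: "0 < \<mu>" using \<epsilon> \<gamma> by (simp add: \<mu>_def)
  have \<gamma>2: "\<gamma>\<^sup>2 \<le> 1" using \<gamma> by (intro power_le_one) auto
  have \<eta>: "0 < \<eta>" "\<eta> \<le> 1"
    using \<epsilon> \<gamma> mult_mono[OF \<epsilon>(2) \<gamma>2] by (auto simp: \<eta>_def)
  have "0 \<le> (2::real)" "0 < \<eta> / 2" "\<eta> / 2 \<le> 1" using \<eta> by auto
  from plan_augment_const[OF this \<mu>, of b] obtain T N1 where plan:
    "\<forall>n\<ge>N1. \<forall>E W u v. has_matching E W \<longrightarrow> W \<subseteq> {..<n} \<longrightarrow> u < n \<longrightarrow> v < n \<longrightarrow> u \<noteq> v \<longrightarrow>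
      u \<notin> W \<longrightarrow> v \<notin> W \<longrightarrow> plan b n (\<lambda>E. has_matching E (insert u (insert v W))) T E
        (\<lambda>B. if card B \<le> 2 * real n \<and> \<eta> / 2 * n \<le> card {x\<in>W. {u, x} \<notin> B}
          \<and> \<eta> / 2 * n \<le> card {x\<in>W. {v, x} \<notin> B} then \<mu> else 1)"
    by blast
  define N2 where "N2 = nat \<lceil>4 / \<gamma>\<rceil> + nat \<lceil>2 * (2 * real T / \<mu> + 2) / \<eta>\<rceil> + nat \<lceil>8 * real b * real T / \<mu>\<rceil> + N0 + N1"
  have "\<exists>\<phi>. secures a b n 0 {} \<phi> \<and> 1 - \<epsilon> \<le> \<phi> {}" if n: "n \<ge> N2" "even n" for n
  proof -
    have "4 / \<gamma> \<le> n" "2 * (2 * real T / \<mu> + 2) / \<eta> \<le> n" "8 * real b * real T / \<mu> \<le> n"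
      and nN: "N0 \<le> n" "N1 \<le> n"
      using n(1) unfolding N2_def by linarith+
    then have \<gamma>n: "4 \<le> \<gamma> * n" and big: "2 * real T / \<mu> + 2 \<le> \<eta> * n / 2" "8 * real b * real T \<le> \<mu> * n"
      using \<gamma>(1) \<mu> \<eta>(1) by (simp_all add: pos_divide_le_eq mult.commute)
    then have "0 \<le> \<gamma> * n" by simp
    then obtain M :: nat where M: "even M" "M \<le> \<gamma> * n" "\<gamma> * n - 2 \<le> M" by (rule even_approx)
    have n0: "0 < real n" using \<gamma>n \<gamma>(1) by (cases n) auto
    have "\<gamma> * n \<le> 1 / 6 * n" using \<gamma> by (intro mult_right_mono) auto
    then have "real M \<le> real n" using M by linarith
    then have "M \<le> n" by simp
    then obtain k where k: "n = M + k" using le_Suc_ex by blast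
    then have "even k" using M(1) n(2) by simp
    then obtain S where "k = 2 * S" by (rule evenE)
    then have S: "n = M + 2 * S" using k by simp
    have \<gamma>\<gamma>0: "\<gamma> * n \<le> \<gamma>0 * n" using \<gamma> by (intro mult_right_mono) auto
    \<comment> \<open>The endgame, the remaining steps and the degrees cost at most
      \<open>\<epsilon> / 4\<close> each.\<close>
    define \<phi> where "\<phi> = (\<lambda>B. 1 - \<epsilon>2 - \<epsilon> / 2 / n * real S - \<mu> * real 0
      - 4 / n * ((\<Sum>u\<in>{..<n}. real (deg B u)) * (M / card {..<n}) + 2 * real b * real M * ln (card {..<n} / M)))"
    have "secures a b n 0 {} \<phi>"
      unfolding \<phi>_def
    proof (rule secures_with_repairs[where \<eta>=\<eta> and \<epsilon>\<^sub>3=\<mu>])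
      fix t E U
      assume "U \<subseteq> {..<n}" "card U = M" "has_matching E ({..<n} - U)"
      then show "secures a b n t E (\<lambda>B. of_bool ((\<forall>u\<in>U. 4 * deg B u \<le> n) \<and> card B \<le> b * n) - \<epsilon>2)"
        using final[rule_format, of n U E t] nN M \<gamma>\<gamma>0 by simp
    next
      fix E W u v
      assume "has_matching E W" "W \<subseteq> {..<n}" "u < n" "v < n" "u \<noteq> v" "u \<notin> W" "v \<notin> W"
      then show "plan b n (\<lambda>E. has_matching E (insert u (insert v W))) T E
        (\<lambda>B. if card B \<le> 2 * real n \<and> \<eta> / 2 * n \<le> card {x\<in>W. {u, x} \<notin> B}
             \<and> \<eta> / 2 * n \<le> card {x\<in>W. {v, x} \<notin> B} then \<mu> else 1)"
        by (rule plan[rule_format, OF nN(2)])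
    next
      fix m :: nat assume m: "M < m" "m \<le> n"
      have m1: "\<gamma> * n / 2 \<le> real m - 1" using m M(3) \<gamma>n by linarith
      have "\<gamma> * n / 2 * (\<gamma> * n / 2) \<le> real m * (real m - 1)"
        using m1 \<gamma>n by (intro mult_mono) auto
      then have "\<gamma>\<^sup>2 * n\<^sup>2 / 8 \<le> real (m choose 2)"
        by (simp add: real_choose_2 power2_eq_square field_simps)
      then have "\<epsilon> / 2 / n * (\<gamma>\<^sup>2 * n\<^sup>2 / 8) \<le> \<epsilon> / 2 / n * (m choose 2)"
        using \<epsilon> by (intro mult_left_mono) auto
      moreover have "\<epsilon> / 2 / n * (\<gamma>\<^sup>2 * n\<^sup>2 / 8) = \<epsilon> * \<gamma>\<^sup>2 * n / 16"
        using n0 by (simp add: power2_eq_square)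
      moreover have "\<eta> * n = \<epsilon> * \<gamma>\<^sup>2 * n / 128" "2 * real n * (\<mu> + 2 * \<mu>) = \<epsilon> * \<gamma>\<^sup>2 * n / 64"
        by (simp_all add: \<eta>_def \<mu>_def)
      moreover have "0 \<le> \<epsilon> * \<gamma>\<^sup>2 * n" using \<epsilon> by simp
      ultimately show "\<eta> * n \<le> \<epsilon> / 2 / n * (m choose 2) \<and> 2 * real n * (\<mu> + 2 * \<mu>) \<le> \<epsilon> / 2 / n * (m choose 2)"
        by linarith
    next
      have "2 \<le> real M" using M(3) \<gamma>n by linarith
      then show "2 \<le> M" by simp
    qed (use ab \<mu> \<eta> \<epsilon> big S in \<open>auto simp: \<epsilon>2_def\<close>)
    moreover have "1 - \<epsilon> \<le> \<phi> {}"
    proof -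
      have M0: "0 < real M" using M(3) \<gamma>n by linarith
      have "real n / M \<le> 2 / \<gamma>"
        using M(3) \<gamma>n M0 \<gamma>(1) by (simp add: field_simps)
      then have "ln (real n / M) \<le> ln (2 / \<gamma>)" by (rule ln_mono) (use n0 M0 in simp)
      moreover have "0 \<le> ln (real n / M)" using M0 \<open>real M \<le> real n\<close> by (intro ln_ge_zero) simp
      ultimately have "real M * ln (real n / M) \<le> \<gamma> * n * ln (2 / \<gamma>)"
        using M(2) \<gamma>n by (intro mult_mono) auto
      then have "8 * b / n * (real M * ln (real n / M)) \<le> 8 * b / n * (\<gamma> * n * ln (2 / \<gamma>))"
        by (intro mult_left_mono) auto
      also have "\<dots> = 8 * b * \<gamma> * ln (2 / \<gamma>)" using n0 by simp
      also note ln
      finally have X: "4 / n * (2 * real b * real M * ln (real n / M)) \<le> \<epsilon> / 4"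
        by (simp add: mult.assoc)
      have "\<epsilon> / 2 / n * real S \<le> \<epsilon> / 2 / n * (n / 2)"
        using S \<epsilon> by (intro mult_left_mono) auto
      also have "\<dots> = \<epsilon> / 4" using n0 by simp
      finally show ?thesis using X \<epsilon> by (simp add: \<phi>_def deg_def \<epsilon>2_def)
    qed
    ultimately show ?thesis by blast
  qed
  then show ?thesis by blast
qed

section \<open>Assembly of both claims, with an error that tends to 0\<close>

lemma board_nonempty:
  assumes "2 \<le> n"
  shows "board n \<noteq> {}"
proof -
  have "{0, 1} \<in> board n" using assms by (simp add: board_def)
  then show ?thesis by blast
qed

theorem theorem4:
  fixes a b :: nat
  assumes "a > 0" and "b > 0"
  shows "(b > 2 * a \<longrightarrow>
            (\<exists>c::real. c > 0 \<and>
              (\<exists>n0. \<forall>n\<ge>n0. even n \<longrightarrow>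
                (\<exists>M \<in> randomized_maker n. \<forall>B \<in> randomized_breaker b n.
                   maker_win_prob a n M B \<ge> c))))
       \<and> (b \<le> 2 * a \<longrightarrow>
            (\<exists>p :: nat \<Rightarrow> real. p \<longlonglongrightarrow> 1 \<and>
              (\<exists>n0. \<forall>n\<ge>n0. even n \<longrightarrow>
                (\<exists>M \<in> randomized_maker n. \<forall>B \<in> randomized_breaker b n.
                   maker_win_prob a n M B \<ge> p n))))"
proof (intro conjI impI)
  have win: "\<exists>M \<in> randomized_maker n. \<forall>B \<in> randomized_breaker b n. maker_win_prob a n M B \<ge> c"
    if "\<exists>\<phi>. secures a b n 0 {} \<phi> \<and> c \<le> \<phi> {}" "2 \<le> n" for n c
    using that secures_win_prob assms(1) board_nonempty by (meson order_trans)
  obtain c :: real and N0 where c: "0 < c"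
    "\<And>n. n \<ge> N0 \<Longrightarrow> even n \<Longrightarrow> \<exists>\<phi>. secures a b n 0 {} \<phi> \<and> c \<le> \<phi> {}"
    using win_with_positive_probability[OF assms] by blast
  show "\<exists>c::real. c > 0 \<and> (\<exists>n0. \<forall>n\<ge>n0. even n \<longrightarrow>
      (\<exists>M \<in> randomized_maker n. \<forall>B \<in> randomized_breaker b n. maker_win_prob a n M B \<ge> c))"
    using c by (intro exI[of _ c] conjI exI[of _ "N0 + 2"] allI impI win) auto
  assume b: "b \<le> 2 * a"
  have "\<exists>N0. \<forall>n\<ge>N0. even n \<longrightarrow> (\<exists>\<phi>. secures a b n 0 {} \<phi> \<and> 1 - 1 / real (Suc k) \<le> \<phi> {})" for k
    by (rule win_with_high_probability[OF assms b]) auto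
  then obtain N where N: "\<And>k n. n \<ge> N k \<Longrightarrow> even n \<Longrightarrow>
      \<exists>\<phi>. secures a b n 0 {} \<phi> \<and> 1 - 1 / real (Suc k) \<le> \<phi> {}"
    by metis
  \<comment> \<open>Diagonal choice: the best level whose threshold \<open>n\<close> has already
    passed. The bound \<open>k \<le> n\<close> keeps the set finite.\<close>
  define K where "K n = Max {k. k \<le> n \<and> N k \<le> n}" for n
  have fin: "finite {k. k \<le> n \<and> N k \<le> n}" for n by simp
  have K: "N (K n) \<le> n" if "N 0 \<le> n" for n
  proof -
    have "{k. k \<le> n \<and> N k \<le> n} \<noteq> {}" using that by auto
    then show ?thesis using Max_in[OF fin] unfolding K_def by blast
  qed
  have "filterlim K at_top sequentially"
    unfolding filterlim_at_top
  proof
    fix k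
    have "k \<le> K n" if "n \<ge> max k (N k)" for n
      unfolding K_def using that by (intro Max_ge fin) auto
    then show "\<forall>\<^sub>F n in sequentially. k \<le> K n"
      unfolding eventually_sequentially by blast
  qed
  then have "(\<lambda>n. inverse (real (Suc (K n)))) \<longlonglongrightarrow> 0"
    by (rule filterlim_compose[OF LIMSEQ_inverse_real_of_nat])
  then have "(\<lambda>n. 1 - inverse (real (Suc (K n)))) \<longlonglongrightarrow> 1 - 0"
    by (intro tendsto_intros)
  then have lim: "(\<lambda>n. 1 - 1 / real (Suc (K n))) \<longlonglongrightarrow> 1"
    by (simp add: inverse_eq_divide)
  have "\<exists>M \<in> randomized_maker n. \<forall>B \<in> randomized_breaker b n.
      maker_win_prob a n M B \<ge> 1 - 1 / real (Suc (K n))" if "n \<ge> N 0 + 2" "even n" for n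
    by (rule win[OF N]) (use K that in auto)
  then show "\<exists>p :: nat \<Rightarrow> real. p \<longlonglongrightarrow> 1 \<and> (\<exists>n0. \<forall>n\<ge>n0. even n \<longrightarrow>
      (\<exists>M \<in> randomized_maker n. \<forall>B \<in> randomized_breaker b n. maker_win_prob a n M B \<ge> p n))"
    using lim by (intro exI[of _ "\<lambda>n. 1 - 1 / real (Suc (K n))"] conjI exI[of _ "N 0 + 2"]) auto
qed

end
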